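(* Let $n,N\ge1$ be integers and, for $j=1,\dots,n$, let $c_j=a_j+ib_j\in C^\infty(\mathbb{T}^1;\mathbb{C})$ ($a_j,b_j$ real-valued) and let $P_j(D_x)$ be a pseudo-differential operator on $\mathbb{T}^N$ with toroidal symbol $p_j=\alpha_j+i\beta_j\in S^{m_j}(\mathbb{Z}^N)$ ($\alpha_j,\beta_j$ real-valued, $m_j\in\mathbb{R}$). Let $\mathbb{L}$ be the system on $\mathbb{T}^{n+N}$ given by $L_j=D_{t_j}+c_j(t_j)P_j(D_x)$, $j=1,\dots,n$, and let $L_{j0}=D_{t_j}+c_{j0}P_j(D_x)$, where $c_{j0}=(2\pi)^{-1}\int_0^{2\pi}c_j(s)\,ds$. If there exists $j\in\{1,\dots,n\}$ such that $L_{j0}$ is globally hypoelliptic on $\mathbb{T}^1_{t_j}\times\mathbb{T}^N_x$ and $j\in\mathcal{H}\cup\mathcal{L}$, then the system $\mathbb{L}$ is globally hypoelliptic.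
   Context: $\mathbb{T}^d=(\mathbb{R}/2\pi\mathbb{Z})^d$ and $D_{t_j}=i^{-1}\partial_{t_j}$. The class $S^{m}(\mathbb{Z}^N)$ of toroidal symbols of order $m$ consists of functions $p:\mathbb{Z}^N\to\mathbb{C}$ such that for every multi-index $\alpha$ there is $C_\alpha>0$ with $|\Delta_\xi^\alpha p(\xi)|\le C_\alpha(1+\|\xi\|)^{m-|\alpha|}$ for all $\xi$, where $\Delta_\xi^\alpha$ are the forward difference operators; in particular $|p(\xi)|\le C(1+\|\xi\|)^m$. The operator with symbol $p$ is $P(D_x)u(x)=\sum_{\xi\in\mathbb{Z}^N}e^{ix\cdot\xi}p(\xi)\widehat{u}(\xi)$, where $\widehat{u}(\xi)$ are the Fourier coefficients; it acts in the $x$ variables. A system $L_1,\dots,L_n$ on $\mathbb{T}^{n+N}$ is globally hypoelliptic if the conditions $u\in\mathcal{D}'(\mathbb{T}^{n+N})$ and $L_ju\in C^\infty(\mathbb{T}^{n+N})$ for all $j$ imply $u\in C^\infty(\mathbb{T}^{n+N})$. A single operator $L$ on $\mathbb{T}^{1+N}$ is globally hypoelliptic if $u\in\mathcal{D}'(\mathbb{T}^{1+N})$ and $Lu\in C^\infty(\mathbb{T}^{1+N})$ imply $u\in C^\infty(\mathbb{T}^{1+N})$. A function $\phi:\mathbb{Z}^N\to\mathbb{C}$ satisfies $\phi(\xi)=O(\log(\|\xi\|))$ if there are positive constants $\kappa,n_0$ with $|\phi(\xi)|\le\kappa\log(\|\xi\|)$ for all $\|\xi\|\ge n_0$; otherwise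 $\phi$ has super-logarithmic growth. A real function does not change sign if it is everywhere $\ge0$ or everywhere $\le0$. Put $\mathcal{M}_j(t_j,\xi)=c_j(t_j)p_j(\xi)$, so $\Im\mathcal{M}_j(t_j,\xi)=a_j(t_j)\beta_j(\xi)+b_j(t_j)\alpha_j(\xi)$. $\mathcal{H}$ is the set of $j\in\{1,\dots,n\}$ for which there is a constant $\Theta>0$ with $\inf_{t\in\mathbb{T}^1}\Im\mathcal{M}_j(t,\xi)\ge-\Theta$ for all $\xi\in\mathbb{Z}^N$. $\mathcal{L}$ is the set of $j\in\{1,\dots,n\}$ for which one of the following holds: (i) $p_j(\xi)=O(\log(\|\xi\|))$; (ii) $\alpha_j(\xi)=O(\log(\|\xi\|))$, $\beta_j(\xi)$ has super-logarithmic growth and $a_j$ does not change sign; (iii) $\alpha_j(\xi)$ has super-logarithmic growth, $\beta_j(\xi)=O(\log(\|\xi\|))$ and $b_j$ does not change sign. *)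

theory Defs
  imports "HOL-Analysis.Analysis"
begin

text \<open>
  Functions on the torus \<open>(\<real> / 2\<pi>\<int>)\<^sup>d\<close> are functions on a \<open>d\<close>-dimensional Euclidean space
  that are \<open>2\<pi>\<close>-periodic in every coordinate. The torus \<open>\<T>\<^sup>n\<^sup>+\<^sup>N\<close> is modelled on
  \<^typ>\<open>(real ^ 'n) \<times> (real ^ 'N)\<close>, the torus \<open>\<T>\<^sup>1\<^sup>+\<^sup>N\<close> on \<^typ>\<open>real \<times> (real ^ 'N)\<close>.
\<close>

subsection \<open>Smooth functions and distributions on the torus\<close>

definition pderiv_dir :: "'a::euclidean_space \<Rightarrow> ('a \<Rightarrow> complex) \<Rightarrow> 'a \<Rightarrow> complex" where
  "pderiv_dir b f = (\<lambda>z. frechet_derivative f (at z) b)"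

definition iter_pderiv :: "'a::euclidean_space list \<Rightarrow> ('a \<Rightarrow> complex) \<Rightarrow> 'a \<Rightarrow> complex" where
  "iter_pderiv bs f = foldr pderiv_dir bs f"

text \<open>All iterated partial derivatives exist and are differentiable, hence also continuous.\<close>

definition smooth :: "('a::euclidean_space \<Rightarrow> complex) \<Rightarrow> bool" where
  "smooth f \<longleftrightarrow> (\<forall>bs. set bs \<subseteq> Basis \<longrightarrow> iter_pderiv bs f differentiable_on UNIV)"

definition torus_smooth :: "('a::euclidean_space \<Rightarrow> complex) set" where
  "torus_smooth = {f. smooth f \<and> (\<forall>b\<in>Basis. \<forall>z. f (z + (2 * pi) *\<^sub>R b) = f z)}"

definition torus_cell :: "'a::euclidean_space set" where
  "torus_cell = cbox 0 (\<Sum>b\<in>Basis. (2 * pi) *\<^sub>R b)"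

definition Ck_norm :: "nat \<Rightarrow> ('a::euclidean_space \<Rightarrow> complex) \<Rightarrow> real" where
  "Ck_norm k f =
     (\<Sum>bs | set bs \<subseteq> Basis \<and> length bs \<le> k. SUP z. norm (iter_pderiv bs f z))"

text \<open>
  Distributions are the continuous linear functionals on the Frechet space of smooth functions.
  They are represented by functionals on all functions, whose values are meaningful on
  \<^const>\<open>torus_smooth\<close> only.
\<close>

type_synonym 'a functional = "('a \<Rightarrow> complex) \<Rightarrow> complex"

definition torus_distribution :: "'a::euclidean_space functional set" where
  "torus_distribution = {u.
     (\<forall>\<phi>\<in>torus_smooth. \<forall>\<psi>\<in>torus_smooth. u (\<lambda>z. \<phi> z + \<psi> z) = u \<phi> + u \<psi>) \<and>
     (\<forall>a. \<forall>\<phi>\<in>torus_smooth. u (\<lambda>z. a * \<phi> z) = a * u \<phi>) \<and>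
     (\<exists>C k. \<forall>\<phi>\<in>torus_smooth. norm (u \<phi>) \<le> C * Ck_norm k \<phi>)}"

definition smooth_distribution :: "'a::euclidean_space functional \<Rightarrow> bool" where
  "smooth_distribution u \<longleftrightarrow>
     (\<exists>f\<in>torus_smooth. \<forall>\<phi>\<in>torus_smooth. u \<phi> = integral torus_cell (\<lambda>z. f z * \<phi> z))"

text \<open>A system is given by its set of operators; a single operator \<open>L\<close> is the system \<open>{L}\<close>.\<close>

definition globally_hypoelliptic ::
    "('a::euclidean_space functional \<Rightarrow> 'a functional) set \<Rightarrow> bool" where
  "globally_hypoelliptic Ls \<longleftrightarrow>
     (\<forall>u\<in>torus_distribution. (\<forall>L\<in>Ls. smooth_distribution (L u)) \<longrightarrow> smooth_distribution u)"

subsection \<open>Toroidal symbols\<close>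

definition vec_of_int :: "int ^ 'N \<Rightarrow> real ^ 'N" where
  "vec_of_int \<xi> = (\<chi> i. of_int (\<xi> $ i))"

definition fwd_diff :: "'N \<Rightarrow> (int ^ 'N \<Rightarrow> complex) \<Rightarrow> int ^ 'N \<Rightarrow> complex" where
  "fwd_diff j p = (\<lambda>\<xi>. p (\<xi> + axis j 1) - p \<xi>)"

text \<open>
  For a multi-index \<open>\<alpha>\<close>, the composition of the powers \<open>\<Delta>\<^sub>j\<^bsup>\<alpha> j\<^esup>\<close> over all coordinates \<open>j\<close>.
  The order of composition is irrelevant by \<open>fwd_diff_comp_fun_commute\<close> below.
\<close>

definition multi_diff ::
    "('N::finite \<Rightarrow> nat) \<Rightarrow> (int ^ 'N \<Rightarrow> complex) \<Rightarrow> int ^ 'N \<Rightarrow> complex" where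
  "multi_diff \<alpha> p = Finite_Set.fold (\<lambda>j q. (fwd_diff j ^^ \<alpha> j) q) p UNIV"

lemma fwd_diff_commute: "fwd_diff i (fwd_diff j p) = fwd_diff j (fwd_diff i p)"
  by (simp add: fwd_diff_def algebra_simps)

lemma fwd_diff_funpow_commute:
  "(fwd_diff i ^^ a) ((fwd_diff j ^^ b) p) = (fwd_diff j ^^ b) ((fwd_diff i ^^ a) p)"
proof -
  have *: "fwd_diff i ((fwd_diff j ^^ b) q) = (fwd_diff j ^^ b) (fwd_diff i q)" for q
    by (induction b) (simp_all, metis fwd_diff_commute)
  show ?thesis
    by (induction a) (simp_all add: *)
qed

lemma fwd_diff_comp_fun_commute: "comp_fun_commute (\<lambda>j. fwd_diff j ^^ \<alpha> j)"
  by unfold_locales (simp add: fun_eq_iff fwd_diff_funpow_commute)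

definition toroidal_symbol :: "real \<Rightarrow> (int ^ 'N::finite \<Rightarrow> complex) set" where
  "toroidal_symbol m = {p. \<forall>\<alpha>. \<exists>C>0. \<forall>\<xi>.
     norm (multi_diff \<alpha> p \<xi>) \<le> C * (1 + norm (vec_of_int \<xi>)) powr (m - real (\<Sum>j\<in>UNIV. \<alpha> j))}"

subsection \<open>The operators\<close>

text \<open>
  The partial Fourier coefficient \<open>u\<^sup>^(\<cdot>, \<xi>)\<close> in the second variable,
  a distribution in the first variable.
\<close>

definition partial_fourier ::
    "('a::euclidean_space \<times> (real ^ 'N)) functional \<Rightarrow> int ^ 'N \<Rightarrow> 'a functional" where
  "partial_fourier u \<xi> = (\<lambda>\<psi>.
     complex_of_real (1 / (2 * pi) ^ CARD('N)) * u (\<lambda>(t, x). \<psi> t * exp (- \<i> * of_real (x \<bullet> vec_of_int \<xi>))))"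

text \<open>
  The distribution \<open>P(D\<^sub>x) u = \<Sum>\<^sub>\<xi> exp (i x\<cdot>\<xi>) p(\<xi>) u\<^sup>^(\<cdot>, \<xi>)\<close>: each summand is applied to
  the test function \<open>\<phi>(t, x)\<close> by integrating out \<open>x\<close> against \<open>exp (i x\<cdot>\<xi>)\<close> first.
\<close>

definition pseudo_diff ::
    "(int ^ 'N \<Rightarrow> complex) \<Rightarrow> ('a::euclidean_space \<times> (real ^ 'N)) functional
      \<Rightarrow> ('a \<times> (real ^ 'N)) functional" where
  "pseudo_diff p u = (\<lambda>\<phi>. \<Sum>\<^sub>\<infinity>\<xi>.
     p \<xi> * partial_fourier u \<xi>
       (\<lambda>t. integral torus_cell (\<lambda>x. exp (\<i> * of_real (x \<bullet> vec_of_int \<xi>)) * \<phi> (t, x))))"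

text \<open>Transposition gives \<open>\<langle>D u, \<phi>\<rangle> = - \<langle>u, D \<phi>\<rangle>\<close> and \<open>\<langle>g u, \<phi>\<rangle> = \<langle>u, g \<phi>\<rangle>\<close>.\<close>

definition dist_D :: "'a::euclidean_space \<Rightarrow> 'a functional \<Rightarrow> 'a functional" where
  "dist_D b u = (\<lambda>\<phi>. - u (\<lambda>z. inverse \<i> * pderiv_dir b \<phi> z))"

definition dist_mult :: "('a \<Rightarrow> complex) \<Rightarrow> 'a functional \<Rightarrow> 'a functional" where
  "dist_mult g u = (\<lambda>\<phi>. u (\<lambda>z. g z * \<phi> z))"

text \<open>
  The operator \<open>D\<^sub>b + c(t\<^sub>b) P(D\<^sub>x)\<close>, where \<open>b\<close> is a coordinate direction of the \<open>t\<close>-space and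
  \<open>t\<^sub>b = t \<bullet> b\<close>: for \<open>t \<in> \<real>\<^sup>n\<close> and \<open>b = axis j 1\<close> this is \<open>t\<^sub>j\<close>, for \<open>t \<in> \<real>\<close> and \<open>b = 1\<close> it is \<open>t\<close>.
\<close>

definition evol_op ::
    "'a::euclidean_space \<Rightarrow> (real \<Rightarrow> complex) \<Rightarrow> (int ^ 'N \<Rightarrow> complex)
      \<Rightarrow> ('a \<times> (real ^ 'N)) functional \<Rightarrow> ('a \<times> (real ^ 'N)) functional" where
  "evol_op b c p u =
     (\<lambda>\<phi>. dist_D (b, 0) u \<phi> + dist_mult (\<lambda>(t, x). c (t \<bullet> b)) (pseudo_diff p u) \<phi>)"

definition system_op ::
    "('n::finite \<Rightarrow> real \<Rightarrow> complex) \<Rightarrow> ('n \<Rightarrow> int ^ 'N \<Rightarrow> complex) \<Rightarrow> 'n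
      \<Rightarrow> ((real ^ 'n) \<times> (real ^ 'N)) functional \<Rightarrow> ((real ^ 'n) \<times> (real ^ 'N)) functional" where
  "system_op c p j = evol_op (axis j 1) (c j) (p j)"

definition circle_mean :: "(real \<Rightarrow> complex) \<Rightarrow> complex" where
  "circle_mean c = complex_of_real (1 / (2 * pi)) * integral {0..2 * pi} c"

definition averaged_op ::
    "('n \<Rightarrow> real \<Rightarrow> complex) \<Rightarrow> ('n \<Rightarrow> int ^ 'N \<Rightarrow> complex) \<Rightarrow> 'n
      \<Rightarrow> (real \<times> (real ^ 'N)) functional \<Rightarrow> (real \<times> (real ^ 'N)) functional" where
  "averaged_op c p j = evol_op 1 (\<lambda>_. circle_mean (c j)) (p j)"

subsection \<open>Growth and sign conditions\<close>

definition log_growth :: "(int ^ 'N::finite \<Rightarrow> 'b::real_normed_vector) \<Rightarrow> bool" where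
  "log_growth \<phi> \<longleftrightarrow> (\<exists>\<kappa>>0. \<exists>n0>0. \<forall>\<xi>. norm (vec_of_int \<xi>) \<ge> n0 \<longrightarrow>
     norm (\<phi> \<xi>) \<le> \<kappa> * ln (norm (vec_of_int \<xi>)))"

abbreviation super_log_growth :: "(int ^ 'N::finite \<Rightarrow> 'b::real_normed_vector) \<Rightarrow> bool" where
  "super_log_growth \<phi> \<equiv> \<not> log_growth \<phi>"

definition no_sign_change :: "(real \<Rightarrow> real) \<Rightarrow> bool" where
  "no_sign_change f \<longleftrightarrow> (\<forall>t. f t \<ge> 0) \<or> (\<forall>t. f t \<le> 0)"

definition set_H ::
    "('n \<Rightarrow> real \<Rightarrow> complex) \<Rightarrow> ('n \<Rightarrow> int ^ 'N::finite \<Rightarrow> complex) \<Rightarrow> 'n set" where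
  "set_H c p = {j. \<exists>\<Theta>>0. \<forall>\<xi>. (INF t. Im (c j t * p j \<xi>)) \<ge> - \<Theta>}"

definition set_L ::
    "('n \<Rightarrow> real \<Rightarrow> complex) \<Rightarrow> ('n \<Rightarrow> int ^ 'N::finite \<Rightarrow> complex) \<Rightarrow> 'n set" where
  "set_L c p = {j.
     log_growth (p j) \<or>
     (log_growth (\<lambda>\<xi>. Re (p j \<xi>)) \<and> super_log_growth (\<lambda>\<xi>. Im (p j \<xi>)) \<and>
        no_sign_change (\<lambda>t. Re (c j t))) \<or>
     (super_log_growth (\<lambda>\<xi>. Re (p j \<xi>)) \<and> log_growth (\<lambda>\<xi>. Im (p j \<xi>)) \<and>
        no_sign_change (\<lambda>t. Im (c j t)))}"

end

theory Submission
  imports Defs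
begin

text \<open>
  Let \<open>u\<close> be a distribution with \<open>L\<^sub>k u\<close> smooth for all \<open>k\<close>. Since a distribution with rapidly
  decreasing Fourier coefficients is a smooth function
  (\<open>smooth_distribution_if_rapid_coefficients\<close>), it is enough to estimate the coefficients
  \<open>u\<^sup>^(\<tau>, \<xi>)\<close>, with \<open>\<tau>\<close> dual to \<open>t\<close> and \<open>\<xi>\<close> dual to \<open>x\<close>. The distinguished operator \<open>L\<^sub>j\<close> gives the
  decay in \<open>\<xi>\<close>, the whole system then gives the decay in \<open>\<tau>\<close>.

  Hypoellipticity of the averaged operator is used as a condition on small divisors. If, along an
  infinite set of frequencies \<open>\<xi>\<close> and for suitable \<open>\<tau>(\<xi>)\<close>, the symbol \<open>\<tau>(\<xi>) + c\<^sub>j\<^sub>0 p\<^sub>j(\<xi>)\<close> decreased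
  faster than every negative power of \<open>\<parallel>\<xi>\<parallel>\<close>, the sum of the characters \<open>exp (i (\<tau>(\<xi>) t + x\<cdot>\<xi>))\<close> would
  be a singular distribution that the averaged operator maps to a smooth function
  (\<open>hypoelliptic_imp_diophantine\<close>). So there is a lower bound by a negative power of \<open>\<parallel>\<xi>\<parallel>\<close> outside a
  bounded set of frequencies, and it carries over to the divisors
  \<open>exp (\<plusminus> 2\<pi>i c\<^sub>j\<^sub>0 p\<^sub>j(\<xi>)) - 1\<close> (\<open>exp_minus_one_lower_bound\<close>).

  Tested against \<open>\<psi>(t\<^sub>j) exp (- i x\<cdot>\<xi>)\<close>, possibly times functions of the other variables \<open>t\<^sub>k\<close>, the
  operator \<open>L\<^sub>j\<close> becomes the transposed ordinary differential operator \<open>\<psi> \<mapsto> i \<psi>' + c\<^sub>j p\<^sub>j(\<xi>) \<psi>\<close>. Its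
  periodic solutions for a given right-hand side are integrals against \<open>exp (i p\<^sub>j(\<xi>) \<integral> c\<^sub>j)\<close> divided
  by one of the above divisors. For either choice of sign there is a formula with one of the two
  divisors, in which the integral runs forwards or backwards in \<open>t\<^sub>j\<close>. Membership of \<open>j\<close> in one of the
  two sets implies that, for each large \<open>\<xi>\<close>, the imaginary part of \<open>c\<^sub>j p\<^sub>j(\<xi>)\<close> has a constant or logarithmic
  bound on one side (\<open>one_sided_log_bound\<close>); integrating in the right direction, the exponential is
  polynomially bounded in \<open>\<xi>\<close>. Hence every test function of this form is, for large \<open>\<xi>\<close>, the image
  of a test function of the same form that is larger by at most a power of \<open>\<parallel>\<xi>\<parallel>\<close>, and \<open>u\<close> is
  evaluated on it by integrating the smooth function \<open>L\<^sub>j u\<close>. Moving only \<open>x\<close>-derivatives to \<open>L\<^sub>j u\<close>, one obtains rapid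
  decay in \<open>\<xi>\<close>, uniformly in \<open>\<tau>\<close>; the remaining bounded set of \<open>\<xi>\<close> costs a power of \<open>\<parallel>\<tau>\<parallel>\<close>, by
  continuity of \<open>u\<close> (\<open>decay_in_space_frequency\<close>).

  Finally each equation \<open>L\<^sub>k u \<in> C\<^sup>\<infinity>\<close> expresses \<open>\<tau>\<^sub>k u\<^sup>^(\<tau>, \<xi>)\<close> by \<open>p\<^sub>k(\<xi>)\<close> times a coefficient of
  \<open>c\<^sub>k u\<close>, up to a rapidly decreasing term. As any power of \<open>\<xi>\<close> can be afforded, this gains one power of
  \<open>\<tau>\<close> at a time (\<open>decay_in_time_frequency\<close>). The multiplications by \<open>c\<^sub>k\<close> are accommodated by
  estimating, in place of the coefficients alone, the values of \<open>u\<close> on characters with arbitrary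
  amplitudes \<open>\<Prod>\<^sub>k g\<^sub>k(t\<^sub>k)\<close>.
\<close>

section \<open>Calculus of smooth functions\<close>

lemma iter_pderiv_Nil [simp]: "iter_pderiv [] f = f"
  by (simp add: iter_pderiv_def)

lemma iter_pderiv_Cons: "iter_pderiv (b # bs) f = pderiv_dir b (iter_pderiv bs f)"
  by (simp add: iter_pderiv_def)

lemma iter_pderiv_snoc: "iter_pderiv (bs @ [b]) f = iter_pderiv bs (pderiv_dir b f)"
  by (simp add: iter_pderiv_def)

lemma iter_pderiv_append: "iter_pderiv (as @ bs) f = iter_pderiv as (iter_pderiv bs f)"
  by (simp add: iter_pderiv_def)

lemma pderiv_dir_eq: "(f has_derivative f') (at z) \<Longrightarrow> pderiv_dir b f z = f' b"
  unfolding pderiv_dir_def by (metis frechet_derivative_at)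

lemma differentiable_has_pderiv:
  "f differentiable (at z) \<Longrightarrow> (f has_derivative (\<lambda>b. pderiv_dir b f z)) (at z)"
  by (metis (no_types, lifting) ext frechet_derivative_works pderiv_dir_def)

lemma differentiable_on_UNIV_iff: "f differentiable_on UNIV \<longleftrightarrow> (\<forall>z. f differentiable (at z))"
  by (simp add: differentiable_on_def)

lemma smooth_differentiable: "smooth f \<Longrightarrow> f differentiable (at z)"
  unfolding smooth_def
  by (metis differentiable_on_UNIV_iff empty_subsetI iter_pderiv_Nil list.set(1))

lemma smooth_iter_pderiv: "smooth f \<Longrightarrow> set bs \<subseteq> Basis \<Longrightarrow> smooth (iter_pderiv bs f)"
  unfolding smooth_def by (auto simp flip: iter_pderiv_append)

lemma smooth_pderiv: "smooth f \<Longrightarrow> b \<in> Basis \<Longrightarrow> smooth (pderiv_dir b f)"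
  using smooth_iter_pderiv[of f "[b]"] by (simp add: iter_pderiv_Cons)

lemma smooth_continuous_on: "smooth f \<Longrightarrow> continuous_on S f"
  by (meson continuous_at_imp_continuous_on differentiable_imp_continuous_within smooth_differentiable)

text \<open>
  Smoothness is a greatest fixed point: a class of differentiable functions that is closed under
  partial derivatives consists of smooth functions. This avoids any explicit Leibniz or chain rule
  of higher order.
\<close>

lemma smooth_coinduct:
  assumes "X f"
    and "\<And>f z. X f \<Longrightarrow> f differentiable (at z)"
    and "\<And>f b. X f \<Longrightarrow> b \<in> Basis \<Longrightarrow> X (pderiv_dir b f)"
  shows "smooth f"
proof -
  have "X (iter_pderiv bs f)" if "set bs \<subseteq> Basis" for bs
    using that by (induction bs) (auto simp: iter_pderiv_Cons assms)
  then show ?thesis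
    using assms(2) by (auto simp: smooth_def differentiable_on_UNIV_iff)
qed

inductive gen_alg :: "('a::euclidean_space \<Rightarrow> complex) set \<Rightarrow> ('a \<Rightarrow> complex) \<Rightarrow> bool"
  for G where
    gen: "g \<in> G \<Longrightarrow> gen_alg G g"
  | smooth: "smooth g \<Longrightarrow> gen_alg G g"
  | add: "gen_alg G f \<Longrightarrow> gen_alg G g \<Longrightarrow> gen_alg G (\<lambda>z. f z + g z)"
  | mult: "gen_alg G f \<Longrightarrow> gen_alg G g \<Longrightarrow> gen_alg G (\<lambda>z. f z * g z)"

lemma pderiv_dir_add:
  assumes "f differentiable (at z)" "g differentiable (at z)"
  shows "pderiv_dir b (\<lambda>z. f z + g z) z = pderiv_dir b f z + pderiv_dir b g z"
  by (rule pderiv_dir_eq) (intro has_derivative_add assms differentiable_has_pderiv)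

lemma pderiv_dir_mult:
  assumes "f differentiable (at z)" "g differentiable (at z)"
  shows "pderiv_dir b (\<lambda>z. f z * g z) z = f z * pderiv_dir b g z + pderiv_dir b f z * g z"
  by (rule pderiv_dir_eq) (intro has_derivative_mult assms differentiable_has_pderiv)

lemma pderiv_dir_const [simp]: "pderiv_dir b (\<lambda>z. c) = (\<lambda>z. 0)"
  by (rule ext, rule pderiv_dir_eq) simp

lemma pderiv_dir_cmult:
  assumes "f differentiable (at z)"
  shows "pderiv_dir b (\<lambda>z. c * f z) z = c * pderiv_dir b f z"
  using pderiv_dir_mult[of "\<lambda>_. c" z f b] assms by simp

text \<open>
  To show that a function is smooth it suffices to write its derivatives as polynomials in the
  function itself and in functions already known to be smooth. For a solution of a linear
  differential equation this is precisely the equation.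
\<close>

lemma smooth_gen_alg:
  assumes G: "\<And>g z. g \<in> G \<Longrightarrow> g differentiable (at z)"
    "\<And>g b. g \<in> G \<Longrightarrow> b \<in> Basis \<Longrightarrow> gen_alg G (pderiv_dir b g)"
    and f: "gen_alg G f"
  shows "smooth f"
proof (rule smooth_coinduct[where X = "gen_alg G", OF f])
  have *: "f differentiable (at z) \<and> (\<forall>b\<in>Basis. gen_alg G (pderiv_dir b f))" if "gen_alg G f" for f z
    using that
  proof (induction arbitrary: z)
    case (gen g)
    then show ?case using G by auto
  next
    case (smooth g)
    then show ?case by (auto simp: smooth_differentiable smooth_pderiv intro: gen_alg.smooth)
  next
    case (add f g)
    have "pderiv_dir b (\<lambda>z. f z + g z) = (\<lambda>z. pderiv_dir b f z + pderiv_dir b g z)" for b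
      using add.IH by (auto simp: pderiv_dir_add)
    then show ?case using add by (auto intro: gen_alg.add)
  next
    case (mult f g)
    have "pderiv_dir b (\<lambda>z. f z * g z) = (\<lambda>z. f z * pderiv_dir b g z + pderiv_dir b f z * g z)" for b
      using mult.IH by (auto simp: pderiv_dir_mult)
    then show ?case using mult by (auto intro!: gen_alg.add gen_alg.mult)
  qed
  fix f assume f: "gen_alg G f"
  show "f differentiable (at z)" for z using * f by blast
  show "gen_alg G (pderiv_dir b f)" if "b \<in> Basis" for b using * f that by blast
qed

lemma smooth_const [simp]: "smooth (\<lambda>z. c)"
  by (rule smooth_coinduct[where X = "\<lambda>f. \<exists>c. f = (\<lambda>z. c)"]) auto

lemma smooth_add: "smooth f \<Longrightarrow> smooth g \<Longrightarrow> smooth (\<lambda>z. f z + g z)"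
  by (rule smooth_gen_alg[of "{}"]) (simp_all add: gen_alg.add gen_alg.smooth)

lemma smooth_mult: "smooth f \<Longrightarrow> smooth g \<Longrightarrow> smooth (\<lambda>z. f z * g z)"
  by (rule smooth_gen_alg[of "{}"]) (simp_all add: gen_alg.mult gen_alg.smooth)

lemma smooth_comp_inner_pderiv:
  fixes g :: "real \<Rightarrow> complex"
  assumes "smooth g"
  shows "((\<lambda>z. g (z \<bullet> v)) has_derivative (\<lambda>b. (b \<bullet> v) * pderiv_dir 1 g (z \<bullet> v))) (at z)"
proof -
  have lin: "linear (\<lambda>h. pderiv_dir h g (z \<bullet> v))"
    using differentiable_has_pderiv[OF smooth_differentiable[OF assms], of "z \<bullet> v"]
    by (rule bounded_linear.linear[OF has_derivative_bounded_linear])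
  have eq: "pderiv_dir h g (z \<bullet> v) = h * pderiv_dir 1 g (z \<bullet> v)" for h
    using linear_cmul[OF lin, of h 1] by (simp add: scaleR_conv_of_real)
  have "(g has_derivative (\<lambda>h. h * pderiv_dir 1 g (z \<bullet> v))) (at (z \<bullet> v))"
    by (rule has_derivative_eq_rhs[OF differentiable_has_pderiv[OF smooth_differentiable[OF assms]]])
       (use eq in blast)
  from has_derivative_compose[OF has_derivative_inner_left[OF has_derivative_ident] this]
  show ?thesis by simp
qed

text \<open>
  The generators are all functions of this form at once: the derivative of one of them is a multiple
  of another.
\<close>

lemma smooth_comp_inner:
  fixes g :: "real \<Rightarrow> complex"
  assumes "smooth g"
  shows "smooth (\<lambda>z. g (z \<bullet> v))"
proof (rule smooth_gen_alg[where G = "{\<lambda>z. g (z \<bullet> v) |g. smooth g}"])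
  show "gen_alg {\<lambda>z. g (z \<bullet> v) |g. smooth g} (\<lambda>z. g (z \<bullet> v))"
    using assms by (auto intro: gen_alg.gen)
  fix h :: "'a \<Rightarrow> complex" and z b :: 'a
  assume "h \<in> {\<lambda>z. g (z \<bullet> v) |g. smooth g}"
  then obtain g where g: "smooth g" "h = (\<lambda>z. g (z \<bullet> v))" by auto
  show "h differentiable (at z)"
    using smooth_comp_inner_pderiv[OF g(1)] g(2) by (auto simp: differentiable_def)
  have "pderiv_dir b h = (\<lambda>z. of_real (b \<bullet> v) * pderiv_dir 1 g (z \<bullet> v))"
    unfolding g(2) by (rule ext) (rule pderiv_dir_eq[OF smooth_comp_inner_pderiv[OF g(1)]])
  moreover have "(\<lambda>z. pderiv_dir 1 g (z \<bullet> v)) \<in> {\<lambda>z. g (z \<bullet> v) |g. smooth g}"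
    using smooth_pderiv[OF g(1), of 1] by auto
  ultimately show "gen_alg {\<lambda>z. g (z \<bullet> v) |g. smooth g} (pderiv_dir b h)"
    by (simp add: gen_alg.mult gen_alg.smooth gen_alg.gen)
qed

text \<open>
  Frequencies are taken in the Euclidean space itself rather than in a type of integer vectors, so
  that one theory covers all the tori \<open>\<T>\<^sup>n\<^sup>+\<^sup>N\<close>, \<open>\<T>\<^sup>1\<^sup>+\<^sup>N\<close>, \<open>\<T>\<^sup>N\<close> and \<open>\<T>\<^sup>1\<close>.
\<close>

definition tchar :: "'a::euclidean_space \<Rightarrow> 'a \<Rightarrow> complex" where
  "tchar \<zeta> z = exp (\<i> * of_real (z \<bullet> \<zeta>))"

definition int_lattice :: "'a::euclidean_space set" where
  "int_lattice = {\<zeta>. \<forall>b\<in>Basis. \<zeta> \<bullet> b \<in> \<int>}"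

lemma tchar_has_derivative:
  "(tchar \<zeta> has_derivative (\<lambda>b. \<i> * of_real (b \<bullet> \<zeta>) * tchar \<zeta> z)) (at z)"
proof -
  have lin: "((\<lambda>z. \<i> * of_real (z \<bullet> \<zeta>)) has_derivative (\<lambda>b. \<i> * of_real (b \<bullet> \<zeta>))) (at z)"
    by (rule bounded_linear_imp_has_derivative)
       (intro bounded_linear_const_mult bounded_linear_compose[OF bounded_linear_of_real] bounded_linear_inner_left)
  from DERIV_exp[of "\<i> * of_real (z \<bullet> \<zeta>)"]
  have "(exp has_derivative (*) (exp (\<i> * of_real (z \<bullet> \<zeta>)))) (at (\<i> * of_real (z \<bullet> \<zeta>)))"
    by (simp add: has_field_derivative_def)
  from has_derivative_compose[OF lin this] show ?thesis
    by (simp add: tchar_def[abs_def] mult_ac)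
qed

lemma pderiv_dir_tchar: "pderiv_dir b (tchar \<zeta>) = (\<lambda>z. \<i> * of_real (b \<bullet> \<zeta>) * tchar \<zeta> z)"
  by (rule ext) (rule pderiv_dir_eq[OF tchar_has_derivative])

lemma tchar_differentiable [simp]: "tchar \<zeta> differentiable (at z)"
  using tchar_has_derivative by (auto simp: differentiable_def)

lemma smooth_tchar: "smooth (tchar \<zeta>)"
proof (rule smooth_gen_alg[where G = "{tchar \<zeta>}"])
  fix g b
  assume "g \<in> {tchar \<zeta>}"
  then show "gen_alg {tchar \<zeta>} (pderiv_dir b g)"
    by (simp add: pderiv_dir_tchar gen_alg.mult gen_alg.gen gen_alg.smooth)
qed (auto intro: gen_alg.gen)

lemma norm_tchar [simp]: "norm (tchar \<zeta> z) = 1"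
  by (simp add: tchar_def)

lemma tchar_0 [simp]: "tchar 0 = (\<lambda>z. 1)"
  by (simp add: tchar_def fun_eq_iff)

lemma tchar_add: "tchar (\<zeta> + \<eta>) z = tchar \<zeta> z * tchar \<eta> z"
  by (simp add: tchar_def exp_add inner_add_right ring_distribs)

lemma tchar_shift: "tchar \<zeta> (z + w) = tchar \<zeta> z * tchar \<zeta> w"
  by (simp add: tchar_def exp_add inner_add_left ring_distribs)

lemma tchar_minus: "tchar (- \<zeta>) z = exp (- \<i> * of_real (z \<bullet> \<zeta>))"
  by (simp add: tchar_def)

lemma tchar_Pair: "tchar (\<zeta>, \<eta>) (t, x) = tchar \<zeta> t * tchar \<eta> x"
  by (simp add: tchar_def exp_add ring_distribs)

lemma tchar_period:
  assumes "\<zeta> \<in> int_lattice" "b \<in> Basis"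
  shows "tchar \<zeta> ((2 * pi) *\<^sub>R b) = 1"
proof -
  obtain n where "\<zeta> \<bullet> b = of_int n"
    using assms by (auto simp: int_lattice_def elim!: Ints_cases)
  then show ?thesis
    by (auto simp: tchar_def exp_eq_1 inner_commute mult_ac intro!: exI[of _ n])
qed

lemma int_lattice_closed [intro]:
  "0 \<in> int_lattice"
  "\<zeta> \<in> int_lattice \<Longrightarrow> - \<zeta> \<in> int_lattice"
  "\<zeta> \<in> int_lattice \<Longrightarrow> \<eta> \<in> int_lattice \<Longrightarrow> \<zeta> + \<eta> \<in> int_lattice"
  "\<zeta> \<in> int_lattice \<Longrightarrow> \<eta> \<in> int_lattice \<Longrightarrow> \<zeta> - \<eta> \<in> int_lattice"
  by (auto simp: int_lattice_def inner_add_left inner_diff_left)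

lemma int_lattice_minus [simp]: "- \<zeta> \<in> int_lattice \<longleftrightarrow> \<zeta> \<in> int_lattice"
  using int_lattice_closed(2)[of "- \<zeta>"] by auto

lemma int_lattice_Pair [simp]: "(\<zeta>, \<eta>) \<in> int_lattice \<longleftrightarrow> \<zeta> \<in> int_lattice \<and> \<eta> \<in> int_lattice"
  by (simp add: int_lattice_def Basis_prod_def ball_Un)

lemma torus_smoothD:
  assumes "f \<in> torus_smooth"
  shows "smooth f" "b \<in> Basis \<Longrightarrow> f (z + (2 * pi) *\<^sub>R b) = f z"
  using assms by (auto simp: torus_smooth_def)

lemma torus_smooth_const [simp]: "(\<lambda>z. c) \<in> torus_smooth"
  by (simp add: torus_smooth_def)

lemma torus_smooth_add:
  "f \<in> torus_smooth \<Longrightarrow> g \<in> torus_smooth \<Longrightarrow> (\<lambda>z. f z + g z) \<in> torus_smooth"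
  by (simp add: torus_smooth_def smooth_add)

lemma torus_smooth_mult:
  "f \<in> torus_smooth \<Longrightarrow> g \<in> torus_smooth \<Longrightarrow> (\<lambda>z. f z * g z) \<in> torus_smooth"
  by (simp add: torus_smooth_def smooth_mult)

lemma torus_smooth_cmult: "f \<in> torus_smooth \<Longrightarrow> (\<lambda>z. c * f z) \<in> torus_smooth"
  using torus_smooth_mult[of "\<lambda>z. c"] by simp

lemma torus_smooth_diff:
  "f \<in> torus_smooth \<Longrightarrow> g \<in> torus_smooth \<Longrightarrow> (\<lambda>z. f z - g z) \<in> torus_smooth"
  using torus_smooth_add[of f "\<lambda>z. -1 * g z"] torus_smooth_cmult[of g "-1"] by simp

lemma torus_smooth_prod:
  "(\<And>i. i \<in> I \<Longrightarrow> f i \<in> torus_smooth) \<Longrightarrow> (\<lambda>z. \<Prod>i\<in>I. f i z) \<in> torus_smooth"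
  by (induction I rule: infinite_finite_induct) (auto intro: torus_smooth_mult)

lemma torus_smooth_sum:
  "(\<And>i. i \<in> I \<Longrightarrow> f i \<in> torus_smooth) \<Longrightarrow> (\<lambda>z. \<Sum>i\<in>I. f i z) \<in> torus_smooth"
  by (induction I rule: infinite_finite_induct) (auto intro: torus_smooth_add)

lemma torus_smooth_tchar: "\<zeta> \<in> int_lattice \<Longrightarrow> tchar \<zeta> \<in> torus_smooth"
  by (simp add: torus_smooth_def smooth_tchar tchar_shift tchar_period)

lemma torus_smooth_pderiv:
  assumes f: "f \<in> torus_smooth" and b: "b \<in> Basis"
  shows "pderiv_dir b f \<in> torus_smooth"
proof -
  have "pderiv_dir b f (z + (2 * pi) *\<^sub>R c) = pderiv_dir b f z" if c: "c \<in> Basis" for z c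
  proof -
    have "(f has_derivative (\<lambda>h. pderiv_dir h f (z + (2 * pi) *\<^sub>R c))) (at (z + (2 * pi) *\<^sub>R c))"
      using f by (intro differentiable_has_pderiv smooth_differentiable torus_smoothD)
    moreover have "((\<lambda>z. z + (2 * pi) *\<^sub>R c) has_derivative (\<lambda>h. h)) (at z)"
      by (auto intro!: derivative_eq_intros)
    ultimately have "((\<lambda>z. f (z + (2 * pi) *\<^sub>R c)) has_derivative
        (\<lambda>h. pderiv_dir h f (z + (2 * pi) *\<^sub>R c))) (at z)"
      using has_derivative_compose by blast
    moreover have "(\<lambda>z. f (z + (2 * pi) *\<^sub>R c)) = f"
      using torus_smoothD(2)[OF f c] by auto
    ultimately show ?thesis
      using pderiv_dir_eq by metis
  qed
  then show ?thesis
    using f b by (auto simp: torus_smooth_def smooth_pderiv)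
qed

lemma torus_smooth_iter_pderiv:
  "f \<in> torus_smooth \<Longrightarrow> set bs \<subseteq> Basis \<Longrightarrow> iter_pderiv bs f \<in> torus_smooth"
  by (induction bs) (auto simp: iter_pderiv_Cons torus_smooth_pderiv)

lemma torus_smooth_differentiable: "f \<in> torus_smooth \<Longrightarrow> f differentiable (at z)"
  by (simp add: smooth_differentiable torus_smoothD)

lemma torus_smooth_continuous_on: "f \<in> torus_smooth \<Longrightarrow> continuous_on S f"
  by (simp add: smooth_continuous_on torus_smoothD)

lemma torus_smooth_comp_inner:
  fixes g :: "real \<Rightarrow> complex"
  assumes g: "g \<in> torus_smooth" and v: "v \<in> Basis"
  shows "(\<lambda>z. g (z \<bullet> v)) \<in> torus_smooth"
  using torus_smoothD[OF g] v
  by (auto simp: torus_smooth_def smooth_comp_inner inner_add_left inner_Basis)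

lemma iter_pderiv_add:
  assumes "smooth f" "smooth g" "set bs \<subseteq> Basis"
  shows "iter_pderiv bs (\<lambda>z. f z + g z) = (\<lambda>z. iter_pderiv bs f z + iter_pderiv bs g z)"
  using assms(3)
  by (induction bs)
     (auto simp: iter_pderiv_Cons pderiv_dir_add smooth_differentiable smooth_iter_pderiv assms)

lemma iter_pderiv_cmult:
  assumes "smooth f" "set bs \<subseteq> Basis"
  shows "iter_pderiv bs (\<lambda>z. c * f z) = (\<lambda>z. c * iter_pderiv bs f z)"
  using assms(2)
  by (induction bs)
     (auto simp: iter_pderiv_Cons pderiv_dir_cmult smooth_differentiable smooth_iter_pderiv assms)

section \<open>Periodic functions and integration over the torus\<close>

definition torus_periodic :: "('a::euclidean_space \<Rightarrow> 'b) \<Rightarrow> bool" where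
  "torus_periodic f \<longleftrightarrow> (\<forall>b\<in>Basis. \<forall>z. f (z + (2 * pi) *\<^sub>R b) = f z)"

lemma torus_smooth_iff: "f \<in> torus_smooth \<longleftrightarrow> smooth f \<and> torus_periodic f"
  by (simp add: torus_smooth_def torus_periodic_def)

lemma torus_periodic_int:
  assumes f: "torus_periodic f" and b: "b \<in> Basis"
  shows "f (z + (2 * pi * of_int n) *\<^sub>R b) = f z"
proof -
  have nat: "f (z + (2 * pi * real k) *\<^sub>R b) = f z" for k z
  proof (induction k arbitrary: z)
    case (Suc k)
    have "f (z + (2 * pi * real (Suc k)) *\<^sub>R b)
        = f ((z + (2 * pi * real k) *\<^sub>R b) + (2 * pi) *\<^sub>R b)"
      by (simp add: algebra_simps)
    with Suc show ?case using f b by (simp add: torus_periodic_def)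
  qed simp
  show ?thesis
  proof (cases "n \<ge> 0")
    case True
    then show ?thesis using nat[of z "nat n"] by simp
  next
    case False
    then show ?thesis
      using nat[of "z + (2 * pi * of_int n) *\<^sub>R b" "nat (- n)"] by simp
  qed
qed

lemma torus_periodic_lattice:
  assumes f: "torus_periodic f" and \<zeta>: "\<zeta> \<in> int_lattice"
  shows "f (z + (2 * pi) *\<^sub>R \<zeta>) = f z"
proof -
  have "f (z + (\<Sum>b\<in>B. (2 * pi * (\<zeta> \<bullet> b)) *\<^sub>R b)) = f z" if "finite B" "B \<subseteq> Basis" for B
    using that
  proof (induction B arbitrary: z)
    case (insert b B)
    obtain n where n: "\<zeta> \<bullet> b = of_int n"
      using \<zeta> insert.prems by (auto simp: int_lattice_def elim!: Ints_cases)
    have "f (z + (\<Sum>b\<in>insert b B. (2 * pi * (\<zeta> \<bullet> b)) *\<^sub>R b))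
        = f ((z + (2 * pi * (\<zeta> \<bullet> b)) *\<^sub>R b) + (\<Sum>b\<in>B. (2 * pi * (\<zeta> \<bullet> b)) *\<^sub>R b))"
      using insert by (simp add: add.assoc)
    also have "\<dots> = f (z + (2 * pi * (\<zeta> \<bullet> b)) *\<^sub>R b)"
      using insert by auto
    finally show ?case
      using torus_periodic_int[OF f, of b z n] insert.prems n by simp
  qed simp
  from this[of Basis] have "f (z + (\<Sum>b\<in>Basis. (2 * pi * (\<zeta> \<bullet> b)) *\<^sub>R b)) = f z" by simp
  moreover have "(\<Sum>b\<in>Basis. (2 * pi * (\<zeta> \<bullet> b)) *\<^sub>R b) = (2 * pi) *\<^sub>R \<zeta>"
    by (rule euclidean_eqI) (simp add: inner_sum_left_Basis)
  ultimately show ?thesis by simp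
qed

lemma mem_torus_cell: "z \<in> torus_cell \<longleftrightarrow> (\<forall>b\<in>Basis. 0 \<le> z \<bullet> b \<and> z \<bullet> b \<le> 2 * pi)"
  by (simp add: torus_cell_def mem_box)

lemma torus_cell_representative:
  obtains w \<zeta> where "w \<in> torus_cell" "\<zeta> \<in> int_lattice" "z = w + (2 * pi) *\<^sub>R \<zeta>"
proof
  define \<zeta> where "\<zeta> = (\<Sum>b\<in>Basis. of_int \<lfloor>z \<bullet> b / (2 * pi)\<rfloor> *\<^sub>R b)"
  have \<zeta>: "\<zeta> \<bullet> b = of_int \<lfloor>z \<bullet> b / (2 * pi)\<rfloor>" if "b \<in> Basis" for b
    using that by (simp add: \<zeta>_def inner_sum_left_Basis)
  show "\<zeta> \<in> int_lattice" by (simp add: int_lattice_def \<zeta>)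
  have "0 \<le> z \<bullet> b - 2 * pi * of_int \<lfloor>z \<bullet> b / (2 * pi)\<rfloor> \<and>
      z \<bullet> b - 2 * pi * of_int \<lfloor>z \<bullet> b / (2 * pi)\<rfloor> \<le> 2 * pi" for b
  proof -
    have "of_int \<lfloor>z \<bullet> b / (2 * pi)\<rfloor> * (2 * pi) \<le> z \<bullet> b"
      using of_int_floor_le[of "z \<bullet> b / (2 * pi)"] by (simp add: pos_le_divide_eq del: of_int_floor_le)
    moreover have "z \<bullet> b \<le> (of_int \<lfloor>z \<bullet> b / (2 * pi)\<rfloor> + 1) * (2 * pi)"
      using real_of_int_floor_add_one_ge[of "z \<bullet> b / (2 * pi)"]
      by (simp add: pos_divide_le_eq del: real_of_int_floor_add_one_ge)
    ultimately show ?thesis by (simp add: algebra_simps)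
  qed
  then show "z - (2 * pi) *\<^sub>R \<zeta> \<in> torus_cell"
    by (simp add: mem_torus_cell inner_diff_left \<zeta>)
qed simp

lemma torus_smooth_bounded:
  fixes f :: "'a::euclidean_space \<Rightarrow> complex"
  assumes "f \<in> torus_smooth"
  obtains B where "B \<ge> 0" "\<And>z. norm (f z) \<le> B"
proof -
  have "compact (torus_cell :: 'a set)"
    by (simp add: torus_cell_def)
  then have "bounded (f ` torus_cell)"
    using assms by (intro compact_imp_bounded compact_continuous_image torus_smooth_continuous_on)
  then obtain B where B: "\<And>z. z \<in> torus_cell \<Longrightarrow> norm (f z) \<le> B"
    by (auto simp: bounded_iff)
  have "norm (f z) \<le> B" for z
    using torus_cell_representative[of z] torus_periodic_lattice[of f] B assms
    by (metis torus_smooth_iff)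
  moreover from this have "0 \<le> B" using norm_ge_zero order_trans by blast
  ultimately show ?thesis using that by blast
qed

lemma finite_Ck_index: "finite {bs::'a::euclidean_space list. set bs \<subseteq> Basis \<and> length bs \<le> k}"
  by (rule finite_lists_length_le) simp

lemma iter_pderiv_bdd:
  assumes "f \<in> torus_smooth" "set bs \<subseteq> Basis"
  shows "bdd_above (range (\<lambda>z. norm (iter_pderiv bs f z)))"
  using torus_smooth_bounded[OF torus_smooth_iter_pderiv[OF assms]]
  by (metis bdd_above.I2)

lemma norm_iter_pderiv_le_Ck_norm:
  assumes f: "f \<in> torus_smooth" and bs: "set bs \<subseteq> Basis" "length bs \<le> k"
  shows "norm (iter_pderiv bs f z) \<le> Ck_norm k f"
proof -
  have "norm (iter_pderiv bs f z) \<le> (SUP z. norm (iter_pderiv bs f z))"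
    by (rule cSUP_upper[OF _ iter_pderiv_bdd[OF f bs(1)]]) simp
  also have "\<dots> \<le> Ck_norm k f"
    unfolding Ck_norm_def
  proof (rule member_le_sum[OF _ _ finite_Ck_index])
    fix as assume "as \<in> {bs. set bs \<subseteq> Basis \<and> length bs \<le> k} - {bs}"
    then have "norm (iter_pderiv as f 0) \<le> (SUP z. norm (iter_pderiv as f z))"
      by (intro cSUP_upper[OF _ iter_pderiv_bdd[OF f]]) auto
    then show "0 \<le> (SUP z. norm (iter_pderiv as f z))"
      by (meson norm_ge_zero order_trans)
  qed (use bs in auto)
  finally show ?thesis .
qed

lemma Ck_norm_nonneg: "f \<in> torus_smooth \<Longrightarrow> 0 \<le> Ck_norm k f"
  using norm_iter_pderiv_le_Ck_norm[of f "[]" k 0] by (simp add: order_trans[OF norm_ge_zero])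

lemma norm_le_Ck_norm: "f \<in> torus_smooth \<Longrightarrow> norm (f z) \<le> Ck_norm k f"
  using norm_iter_pderiv_le_Ck_norm[of f "[]" k z] by simp

definition Ck_count :: "'a::euclidean_space itself \<Rightarrow> nat \<Rightarrow> nat" where
  "Ck_count _ k = card {bs::'a list. set bs \<subseteq> Basis \<and> length bs \<le> k}"

lemma Ck_norm_le:
  fixes f :: "'a::euclidean_space \<Rightarrow> complex"
  assumes "\<And>bs z. set bs \<subseteq> Basis \<Longrightarrow> length bs \<le> k \<Longrightarrow> norm (iter_pderiv bs f z) \<le> B"
  shows "Ck_norm k f \<le> real (Ck_count TYPE('a) k) * B"
  unfolding Ck_norm_def Ck_count_def
  by (rule sum_bounded_above) (auto intro!: cSUP_least assms)

lemma torus_cell_content: "measure lborel (torus_cell :: 'a::euclidean_space set) = (2 * pi) ^ DIM('a)"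
  unfolding torus_cell_def by (subst content_cbox) auto

lemma norm_integral_torus_cell_le:
  fixes f :: "'a::euclidean_space \<Rightarrow> complex"
  assumes "continuous_on UNIV f" "\<And>z. norm (f z) \<le> B"
  shows "norm (integral torus_cell f) \<le> B * (2 * pi) ^ DIM('a)"
proof -
  have "0 \<le> B" using assms(2) norm_ge_zero order_trans by blast
  moreover have "(f has_integral integral torus_cell f) torus_cell"
    unfolding torus_cell_def
    by (intro integrable_integral integrable_continuous continuous_on_subset[OF assms(1)]) auto
  ultimately have "norm (integral torus_cell f) \<le> B * measure lborel (torus_cell :: 'a set)"
    unfolding torus_cell_def by (rule has_integral_bound) (rule assms(2))
  then show ?thesis by (simp only: torus_cell_content)
qed

lemma integrable_torus_cell:
  fixes f :: "'a::euclidean_space \<Rightarrow> complex"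
  shows "f \<in> torus_smooth \<Longrightarrow> f integrable_on torus_cell"
  unfolding torus_cell_def by (intro integrable_continuous torus_smooth_continuous_on)

lemma integral_torus_cell_translate:
  fixes f :: "'a::euclidean_space \<Rightarrow> complex"
  assumes cont: "continuous_on UNIV f" and per: "torus_periodic f" and b: "b \<in> Basis"
    and h: "0 \<le> h" "h \<le> 2 * pi"
  shows "integral torus_cell (\<lambda>z. f (z + h *\<^sub>R b)) = integral torus_cell f"
proof -
  define T :: 'a where "T = (\<Sum>b\<in>Basis. (2 * pi) *\<^sub>R b)"
  define M where "M = T - (2 * pi - h) *\<^sub>R b"
  have T: "T \<bullet> i = 2 * pi" if "i \<in> Basis" for i using that by (simp add: T_def)
  have int: "f integrable_on cbox u v" for u v
    by (intro integrable_continuous continuous_on_subset[OF cont]) auto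
  \<comment> \<open>The slab cut off at the top of the shifted cell is the translate of the slab missing at the bottom.\<close>
  have low: "cbox 0 T \<inter> {x. x \<bullet> b \<le> h} = cbox 0 M" and up: "cbox 0 T \<inter> {x. x \<bullet> b \<ge> h} = cbox (h *\<^sub>R b) T"
    and low': "cbox (h *\<^sub>R b) (T + h *\<^sub>R b) \<inter> {x. x \<bullet> b \<le> 2 * pi} = cbox (h *\<^sub>R b) T"
    and up': "cbox (h *\<^sub>R b) (T + h *\<^sub>R b) \<inter> {x. x \<bullet> b \<ge> 2 * pi} = cbox ((2 * pi) *\<^sub>R b) (M + (2 * pi) *\<^sub>R b)"
    unfolding set_eq_iff Int_iff mem_box mem_Collect_eq M_def
    using b h T
    by (auto simp: inner_add_left inner_diff_left inner_Basis; 
        metis (full_types) diff_zero add.right_neutral order_trans mult_zero_right add_le_cancel_left add_increasing2)+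
  have shift: "integral (cbox ((2 * pi) *\<^sub>R b) (M + (2 * pi) *\<^sub>R b)) f = integral (cbox 0 M) f"
  proof -
    have "integral (cbox ((2 * pi) *\<^sub>R b - (2 * pi) *\<^sub>R b) (M + (2 * pi) *\<^sub>R b - (2 * pi) *\<^sub>R b))
        (\<lambda>x. f (x + (2 * pi) *\<^sub>R b)) = integral (cbox ((2 * pi) *\<^sub>R b) (M + (2 * pi) *\<^sub>R b)) f"
      by (rule integral_shift_cbox)
    then show ?thesis using per b by (simp add: torus_periodic_def)
  qed
  have "integral torus_cell (\<lambda>z. f (z + h *\<^sub>R b)) = integral (cbox (h *\<^sub>R b) (T + h *\<^sub>R b)) f"
    using integral_shift_cbox[of "h *\<^sub>R b" "h *\<^sub>R b" "T + h *\<^sub>R b" f]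
    by (simp add: torus_cell_def flip: T_def)
  also have "\<dots> = integral (cbox (h *\<^sub>R b) T) f + integral (cbox 0 M) f"
    by (subst integral_split[OF int b, of _ _ "2 * pi"]) (simp add: low' up' shift)
  also have "\<dots> = integral (cbox 0 T) f"
    by (subst (3) integral_split[OF int b, of _ _ h]) (simp add: low up)
  finally show ?thesis by (simp add: torus_cell_def T_def)
qed

text \<open>
  The integral over the cell does not change when a periodic function is translated;
  differentiating this in the translation parameter gives the vanishing of the integral of a
  derivative, hence integration by parts without boundary terms.
\<close>

lemma integral_pderiv_torus_cell:
  fixes f :: "'a::euclidean_space \<Rightarrow> complex"
  assumes f: "f \<in> torus_smooth" and b: "b \<in> Basis"
  shows "integral torus_cell (pderiv_dir b f) = 0"
proof -
  define T :: 'a where "T = (\<Sum>b\<in>Basis. (2 * pi) *\<^sub>R b)"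
  define I where "I h = integral (cbox 0 T) (\<lambda>z. f (z + h *\<^sub>R b))" for h
  have shift: "((\<lambda>h. f (z + h *\<^sub>R b)) has_vector_derivative pderiv_dir b f (z + h *\<^sub>R b)) (at h within U)"
    for z h U
  proof -
    have "((\<lambda>h. z + h *\<^sub>R b) has_derivative (\<lambda>k. k *\<^sub>R b)) (at h)"
      by (auto intro!: derivative_eq_intros)
    moreover have D: "(f has_derivative (\<lambda>k. pderiv_dir k f (z + h *\<^sub>R b))) (at (z + h *\<^sub>R b))"
      by (rule differentiable_has_pderiv[OF torus_smooth_differentiable[OF f]])
    ultimately have "((\<lambda>h. f (z + h *\<^sub>R b)) has_derivative (\<lambda>k. pderiv_dir (k *\<^sub>R b) f (z + h *\<^sub>R b))) (at h)"
      by (rule has_derivative_compose)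
    moreover have "pderiv_dir (k *\<^sub>R b) f (z + h *\<^sub>R b) = k *\<^sub>R pderiv_dir b f (z + h *\<^sub>R b)" for k
      using linear_cmul[OF bounded_linear.linear[OF has_derivative_bounded_linear[OF D]]] .
    ultimately have "((\<lambda>h. f (z + h *\<^sub>R b)) has_vector_derivative pderiv_dir b f (z + h *\<^sub>R b)) (at h)"
      by (simp add: has_vector_derivative_def)
    then show ?thesis by (rule has_vector_derivative_at_within)
  qed
  have "(I has_vector_derivative integral (cbox 0 T) (\<lambda>z. pderiv_dir b f (z + 0 *\<^sub>R b)))
      (at 0 within {0..2 * pi})"
    unfolding I_def
  proof (rule leibniz_rule_vector_derivative[OF shift])
    show "(\<lambda>z. f (z + h *\<^sub>R b)) integrable_on cbox 0 T" for h
      by (intro integrable_continuous continuous_on_compose2[OF torus_smooth_continuous_on[OF f, of UNIV]]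
          continuous_intros) auto
    show "continuous_on ({0..2 * pi} \<times> cbox 0 T) (\<lambda>(h, z). pderiv_dir b f (z + h *\<^sub>R b))"
      unfolding split_beta
      by (intro continuous_on_compose2[OF torus_smooth_continuous_on[OF torus_smooth_pderiv[OF f b], of UNIV]]
          continuous_intros) auto
  qed auto
  moreover have "(I has_vector_derivative 0) (at 0 within {0..2 * pi})"
  proof (rule has_vector_derivative_transform[where f = "\<lambda>_. I 0"])
    fix h assume "h \<in> {0..2 * pi}"
    then show "I h = I 0"
      using integral_torus_cell_translate[of f b h] torus_smooth_continuous_on[OF f] f b
      by (auto simp: I_def T_def torus_smooth_iff torus_cell_def)
  qed auto
  ultimately have "integral (cbox 0 T) (\<lambda>z. pderiv_dir b f (z + 0 *\<^sub>R b)) = 0"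
    by (rule vector_derivative_unique_within[rotated]) (simp add: trivial_limit_within islimpt_Icc)
  then show ?thesis by (simp add: torus_cell_def T_def)
qed

lemma integral_by_parts_torus_cell:
  fixes f :: "'a::euclidean_space \<Rightarrow> complex"
  assumes f: "f \<in> torus_smooth" and g: "g \<in> torus_smooth" and b: "b \<in> Basis"
  shows "integral torus_cell (\<lambda>z. pderiv_dir b f z * g z) = - integral torus_cell (\<lambda>z. f z * pderiv_dir b g z)"
proof -
  have "pderiv_dir b (\<lambda>z. f z * g z) = (\<lambda>z. f z * pderiv_dir b g z + pderiv_dir b f z * g z)"
    by (simp add: fun_eq_iff pderiv_dir_mult torus_smooth_differentiable f g)
  then have "0 = integral torus_cell (\<lambda>z. f z * pderiv_dir b g z + pderiv_dir b f z * g z)"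
    using integral_pderiv_torus_cell[OF torus_smooth_mult[OF f g] b] by simp
  also have "\<dots> = integral torus_cell (\<lambda>z. f z * pderiv_dir b g z) + integral torus_cell (\<lambda>z. pderiv_dir b f z * g z)"
    by (intro integral_add integrable_torus_cell torus_smooth_mult f g torus_smooth_pderiv b)
  finally show ?thesis by (simp add: eq_neg_iff_add_eq_0 add.commute)
qed

lemma integral_pderiv_tchar:
  fixes f :: "'a::euclidean_space \<Rightarrow> complex"
  assumes f: "f \<in> torus_smooth" and \<zeta>: "\<zeta> \<in> int_lattice" and b: "b \<in> Basis"
  shows "integral torus_cell (\<lambda>z. pderiv_dir b f z * tchar \<zeta> z)
       = - \<i> * of_real (b \<bullet> \<zeta>) * integral torus_cell (\<lambda>z. f z * tchar \<zeta> z)"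
proof -
  have "integral torus_cell (\<lambda>z. pderiv_dir b f z * tchar \<zeta> z)
      = - integral torus_cell (\<lambda>z. \<i> * of_real (b \<bullet> \<zeta>) * (f z * tchar \<zeta> z))"
    using integral_by_parts_torus_cell[OF f torus_smooth_tchar[OF \<zeta>] b]
    by (simp add: pderiv_dir_tchar mult_ac)
  then show ?thesis by simp
qed

lemma integral_tchar:
  fixes \<zeta> :: "'a::euclidean_space"
  assumes \<zeta>: "\<zeta> \<in> int_lattice"
  shows "integral torus_cell (tchar \<zeta>) = (if \<zeta> = 0 then (2 * of_real pi) ^ DIM('a) else 0)"
proof (cases "\<zeta> = 0")
  case True
  have "integral torus_cell (\<lambda>z::'a. 1::complex) = of_real (measure lborel (torus_cell::'a set))"
    unfolding torus_cell_def by (subst integral_const) (simp add: scaleR_conv_of_real)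
  with True show ?thesis by (simp add: torus_cell_content)
next
  case False
  then obtain b where b: "b \<in> Basis" "\<zeta> \<bullet> b \<noteq> 0"
    by (meson euclidean_all_zero_iff)
  with integral_pderiv_tchar[OF torus_smooth_const \<zeta>, of b 1] False show ?thesis
    by (simp add: inner_commute)
qed

text \<open>
  Integrating by parts in the direction of the largest coordinate of the frequency turns
  regularity into decay of oscillatory integrals. The second factor \<open>h\<close> need not be a character:
  it suffices that it oscillates like one in the directions in which the frequency is not zero, and
  only its size enters the estimate.
\<close>

lemma oscillatory_decay:
  fixes f h :: "'a::euclidean_space \<Rightarrow> complex"
  assumes f: "f \<in> torus_smooth" and h: "h \<in> torus_smooth" "\<And>z. norm (h z) \<le> H"
    and osc: "\<And>b. b \<in> Basis \<Longrightarrow> \<zeta> \<bullet> b \<noteq> 0 \<Longrightarrow> pderiv_dir b h = (\<lambda>z. \<i> * of_real (b \<bullet> \<zeta>) * h z)"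
  shows "(1 + norm \<zeta>) ^ K * norm (integral torus_cell (\<lambda>z. f z * h z))
       \<le> (1 + real DIM('a)) ^ K * (2 * pi) ^ DIM('a) * Ck_norm K f * H"
proof -
  define I where "I = norm (integral torus_cell (\<lambda>z. f z * h z))"
  define A where "A = (2 * pi) ^ DIM('a) * Ck_norm K f * H"
  have H: "H \<ge> 0" using h(2) norm_ge_zero order_trans by blast
  have bnd: "norm (integral torus_cell (\<lambda>z. iter_pderiv bs f z * h z)) \<le> A"
    if bs: "set bs \<subseteq> Basis" "length bs \<le> K" for bs
  proof -
    have "norm (integral torus_cell (\<lambda>z. iter_pderiv bs f z * h z)) \<le> (Ck_norm K f * H) * (2 * pi) ^ DIM('a)"
    proof (rule norm_integral_torus_cell_le)
      show "continuous_on UNIV (\<lambda>z. iter_pderiv bs f z * h z)"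
        by (intro torus_smooth_continuous_on torus_smooth_mult torus_smooth_iter_pderiv f h bs)
      show "norm (iter_pderiv bs f z * h z) \<le> Ck_norm K f * H" for z
        unfolding norm_mult
        by (intro mult_mono norm_iter_pderiv_le_Ck_norm f bs h Ck_norm_nonneg) auto
    qed
    then show ?thesis by (simp add: A_def mult_ac)
  qed
  have I0: "I \<le> A" using bnd[of "[]"] by (simp add: I_def)
  have IK: "\<bar>b \<bullet> \<zeta>\<bar> ^ K * I \<le> A" if b: "b \<in> Basis" for b
  proof (cases "\<zeta> \<bullet> b = 0")
    case True
    have "A \<ge> 0" using I0 by (simp add: I_def order_trans[OF norm_ge_zero])
    with True I0 show ?thesis by (cases K) (auto simp: inner_commute)
  next
    case False
    have bs: "set (replicate k b) \<subseteq> Basis" for k using b by auto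
    have "integral torus_cell (\<lambda>z. iter_pderiv (replicate k b) f z * h z)
        = (- \<i> * of_real (b \<bullet> \<zeta>)) ^ k * integral torus_cell (\<lambda>z. f z * h z)" for k
    proof (induction k)
      case (Suc k)
      have "integral torus_cell (\<lambda>z. pderiv_dir b (iter_pderiv (replicate k b) f) z * h z)
          = - integral torus_cell (\<lambda>z. \<i> * of_real (b \<bullet> \<zeta>) * (iter_pderiv (replicate k b) f z * h z))"
        using integral_by_parts_torus_cell[OF torus_smooth_iter_pderiv[OF f bs] h(1) b]
        by (simp add: osc[OF b False] mult_ac)
      then show ?case
        using Suc by (simp add: iter_pderiv_Cons mult.assoc)
    qed simp
    then show ?thesis
      using bnd[OF bs, of K] by (simp add: norm_mult norm_power I_def)
  qed
  define M where "M = Max ((\<lambda>b. \<bar>\<zeta> \<bullet> b\<bar>) ` Basis)"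
  have "M \<in> (\<lambda>b. \<bar>\<zeta> \<bullet> b\<bar>) ` Basis" unfolding M_def by (rule Max_in) auto
  then obtain b where b: "b \<in> Basis" "M = \<bar>\<zeta> \<bullet> b\<bar>" by auto
  have "norm \<zeta> \<le> (\<Sum>b\<in>Basis. \<bar>\<zeta> \<bullet> b\<bar>)" by (rule norm_le_l1)
  also have "\<dots> \<le> real DIM('a) * M" by (rule sum_bounded_above) (simp add: M_def)
  finally have le: "norm \<zeta> \<le> real DIM('a) * M" .
  have max: "max 1 M ^ K * I \<le> A"
    using I0 IK[OF b(1)] b(2) by (auto simp: max_def inner_commute)
  have "(1 + norm \<zeta>) \<le> (1 + real DIM('a)) * max 1 M"
  proof -
    have "real DIM('a) * M \<le> real DIM('a) * max 1 M" by (intro mult_left_mono) auto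
    then show ?thesis using le max.cobounded1[of 1 M] unfolding distrib_right by linarith
  qed
  then have "(1 + norm \<zeta>) ^ K \<le> ((1 + real DIM('a)) * max 1 M) ^ K"
    by (intro power_mono) auto
  then have "(1 + norm \<zeta>) ^ K * I \<le> ((1 + real DIM('a)) * max 1 M) ^ K * I"
    by (intro mult_right_mono) (auto simp: I_def)
  also have "\<dots> = (1 + real DIM('a)) ^ K * (max 1 M ^ K * I)"
    by (simp add: power_mult_distrib mult.assoc)
  also have "\<dots> \<le> (1 + real DIM('a)) ^ K * A"
    by (intro mult_left_mono max) auto
  finally show ?thesis by (simp add: I_def A_def mult.assoc)
qed

lemma fourier_decay:
  fixes f :: "'a::euclidean_space \<Rightarrow> complex"
  assumes f: "f \<in> torus_smooth" and \<zeta>: "\<zeta> \<in> int_lattice"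
  shows "(1 + norm \<zeta>) ^ K * norm (integral torus_cell (\<lambda>z. f z * tchar \<zeta> z))
       \<le> (1 + real DIM('a)) ^ K * (2 * pi) ^ DIM('a) * Ck_norm K f"
  using oscillatory_decay[OF f torus_smooth_tchar[OF \<zeta>], of 1 \<zeta> K]
  by (simp add: pderiv_dir_tchar)

section \<open>Trigonometric series\<close>

text \<open>
  Series are indexed by an arbitrary set with a frequency map, because they occur with the lattice
  itself, with the lattice reflected at the origin, and with a sparse set of frequencies.
\<close>

definition rapid :: "'i set \<Rightarrow> ('i \<Rightarrow> 'a::euclidean_space) \<Rightarrow> ('i \<Rightarrow> complex) \<Rightarrow> bool" where
  "rapid I \<nu> a \<longleftrightarrow> (\<forall>K. (\<lambda>i. norm (a i) * (1 + norm (\<nu> i)) ^ K) summable_on I)"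

definition trig_series :: "'i set \<Rightarrow> ('i \<Rightarrow> 'a::euclidean_space) \<Rightarrow> ('i \<Rightarrow> complex) \<Rightarrow> 'a \<Rightarrow> complex" where
  "trig_series I \<nu> a z = (\<Sum>\<^sub>\<infinity>i\<in>I. a i * tchar (\<nu> i) z)"

lemma rapid_dominated:
  assumes "rapid I \<nu> a" and "\<And>i. i \<in> I \<Longrightarrow> norm (b i) \<le> norm (a i) * (1 + norm (\<nu> i)) ^ m"
  shows "rapid I \<nu> b"
  unfolding rapid_def
proof
  fix K
  have "(\<lambda>i. norm (a i) * (1 + norm (\<nu> i)) ^ (m + K)) summable_on I"
    using assms(1) unfolding rapid_def by blast
  then show "(\<lambda>i. norm (b i) * (1 + norm (\<nu> i)) ^ K) summable_on I"
  proof (rule summable_on_comparison_test)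
    fix i assume i: "i \<in> I"
    have "norm (b i) * (1 + norm (\<nu> i)) ^ K \<le> (norm (a i) * (1 + norm (\<nu> i)) ^ m) * (1 + norm (\<nu> i)) ^ K"
      using assms(2)[OF i] by (intro mult_right_mono) auto
    then show "norm (b i) * (1 + norm (\<nu> i)) ^ K \<le> norm (a i) * (1 + norm (\<nu> i)) ^ (m + K)"
      by (simp add: power_add mult.assoc)
  qed auto
qed

lemma rapid_norm_summable: "rapid I \<nu> a \<Longrightarrow> (\<lambda>i. norm (a i)) summable_on I"
  unfolding rapid_def by (drule spec[of _ 0]) simp

lemma rapid_subset: "rapid I \<nu> a \<Longrightarrow> J \<subseteq> I \<Longrightarrow> rapid J \<nu> a"
  unfolding rapid_def using summable_on_subset_banach by blast

lemma trig_series_summable: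
  "rapid I \<nu> a \<Longrightarrow> (\<lambda>i. a i * tchar (\<nu> i) z) summable_on I"
  by (rule abs_summable_summable) (simp add: norm_mult rapid_norm_summable)

lemma norm_infsum_dominated:
  fixes f :: "'i \<Rightarrow> complex"
  assumes "g summable_on I" "\<And>i. i \<in> I \<Longrightarrow> norm (f i) \<le> g i"
  shows "norm (infsum f I) \<le> infsum g I" "f summable_on I"
proof -
  have n: "(\<lambda>i. norm (f i)) summable_on I"
    using assms by (intro summable_on_comparison_test[OF assms(1)]) auto
  then show "f summable_on I" by (rule abs_summable_summable)
  show "norm (infsum f I) \<le> infsum g I"
    using norm_infsum_bound[OF n] infsum_mono[OF n assms] by linarith
qed

lemma infsum_minus_complex:
  fixes f g :: "'i \<Rightarrow> complex"
  assumes "f summable_on I" "g summable_on I"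
  shows "(\<Sum>\<^sub>\<infinity>i\<in>I. f i - g i) = infsum f I - infsum g I"
    and "(\<lambda>i. f i - g i) summable_on I"
  using infsum_add[OF assms(1), of "\<lambda>i. - g i"] summable_on_add[OF assms(1), of "\<lambda>i. - g i"] assms(2)
  by (simp_all add: infsum_uminus summable_on_uminus)

lemma norm_trig_series_le:
  assumes "rapid I \<nu> a"
  shows "norm (trig_series I \<nu> a z) \<le> (\<Sum>\<^sub>\<infinity>i\<in>I. norm (a i))"
  unfolding trig_series_def
  by (rule norm_infsum_dominated(1)[OF rapid_norm_summable[OF assms]]) (simp add: norm_mult)

lemma norm_tchar_remainder:
  "norm (tchar \<zeta> (z + h) - tchar \<zeta> z - \<i> * of_real (h \<bullet> \<zeta>) * tchar \<zeta> z) \<le> (norm \<zeta>)\<^sup>2 * (norm h)\<^sup>2"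
proof -
  have "norm (exp (\<i> * of_real (h \<bullet> \<zeta>)) - (\<Sum>i\<le>1. (\<i> * of_real (h \<bullet> \<zeta>)) ^ i / fact i))
      \<le> exp \<bar>Re (\<i> * of_real (h \<bullet> \<zeta>))\<bar> * (norm (\<i> * complex_of_real (h \<bullet> \<zeta>)) ^ Suc 1) / fact 1"
    by (rule Taylor_exp)
  then have 1: "norm (tchar \<zeta> h - 1 - \<i> * of_real (h \<bullet> \<zeta>)) \<le> (h \<bullet> \<zeta>)\<^sup>2"
    by (simp add: tchar_def norm_mult power2_eq_square algebra_simps)
  have "\<bar>h \<bullet> \<zeta>\<bar> \<le> norm h * norm \<zeta>" by (rule Cauchy_Schwarz_ineq2)
  then have "\<bar>h \<bullet> \<zeta>\<bar>\<^sup>2 \<le> (norm h * norm \<zeta>)\<^sup>2" by (intro power_mono) auto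
  moreover have "tchar \<zeta> (z + h) - tchar \<zeta> z - \<i> * of_real (h \<bullet> \<zeta>) * tchar \<zeta> z
      = tchar \<zeta> z * (tchar \<zeta> h - 1 - \<i> * of_real (h \<bullet> \<zeta>))"
    by (simp add: tchar_shift algebra_simps)
  ultimately show ?thesis
    using 1 by (simp add: norm_mult power_mult_distrib mult.commute)
qed

text \<open>
  Termwise differentiation. The remainder of a character of frequency \<open>\<zeta>\<close> is quadratic with
  constant \<open>\<parallel>\<zeta>\<parallel>\<^sup>2\<close>, which the rapidly decreasing coefficients absorb uniformly.
\<close>

lemma trig_series_has_derivative:
  fixes \<nu> :: "'i \<Rightarrow> 'a::euclidean_space"
  assumes r: "rapid I \<nu> a"
  shows "(trig_series I \<nu> a has_derivative
           (\<lambda>h. trig_series I \<nu> (\<lambda>i. \<i> * of_real (h \<bullet> \<nu> i) * a i) z)) (at z)"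
proof -
  define D where "D h = trig_series I \<nu> (\<lambda>i. \<i> * of_real (h \<bullet> \<nu> i) * a i) z" for h
  have g: "(\<lambda>i. norm (a i) * (1 + norm (\<nu> i)) ^ K) summable_on I" for K
    using r by (simp add: rapid_def)
  define S where "S K = (\<Sum>\<^sub>\<infinity>i\<in>I. norm (a i) * (1 + norm (\<nu> i)) ^ K)" for K
  have bnd: "norm (\<i> * of_real (h \<bullet> \<nu> i) * a i * tchar (\<nu> i) z) \<le> norm h * (norm (a i) * (1 + norm (\<nu> i)) ^ 1)" for h i
  proof -
    have "\<bar>h \<bullet> \<nu> i\<bar> \<le> norm h * norm (\<nu> i)" by (rule Cauchy_Schwarz_ineq2)
    also have "\<dots> \<le> norm h * (1 + norm (\<nu> i))" by (intro mult_left_mono) auto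
    finally have "\<bar>h \<bullet> \<nu> i\<bar> * norm (a i) \<le> norm h * (1 + norm (\<nu> i)) * norm (a i)"
      by (rule mult_right_mono) auto
    then show ?thesis by (simp add: norm_mult mult_ac)
  qed
  have Dsum: "(\<lambda>i. \<i> * of_real (h \<bullet> \<nu> i) * a i * tchar (\<nu> i) z) summable_on I"
    and Dbnd: "norm (D h) \<le> norm h * S 1" for h
  proof -
    have s: "(\<lambda>i. norm h * (norm (a i) * (1 + norm (\<nu> i)) ^ 1)) summable_on I"
      by (intro summable_on_cmult_right g)
    show "(\<lambda>i. \<i> * of_real (h \<bullet> \<nu> i) * a i * tchar (\<nu> i) z) summable_on I"
      by (rule norm_infsum_dominated(2)[OF s bnd])
    have "norm (D h) \<le> (\<Sum>\<^sub>\<infinity>i\<in>I. norm h * (norm (a i) * (1 + norm (\<nu> i)) ^ 1))"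
      unfolding D_def trig_series_def by (rule norm_infsum_dominated(1)[OF s bnd])
    also have "\<dots> = norm h * S 1" unfolding S_def by (rule infsum_cmult_right) (rule g)
    finally show "norm (D h) \<le> norm h * S 1" .
  qed
  have "bounded_linear D"
  proof (rule bounded_linear_intro[of D "S 1"])
    show "D (x + y) = D x + D y" for x y
      unfolding D_def trig_series_def
      by (subst infsum_add[symmetric, OF Dsum Dsum]) (simp add: inner_add_left algebra_simps)
    show "D (r *\<^sub>R x) = r *\<^sub>R D x" for r x
      unfolding D_def trig_series_def scaleR_conv_of_real
      by (subst infsum_cmult_right[symmetric, OF Dsum]) (simp add: mult_ac)
  qed (rule Dbnd)
  moreover have "norm (trig_series I \<nu> a (z + h) - trig_series I \<nu> a z - D h) \<le> S 2 * (norm h)\<^sup>2" for h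
  proof -
    have "trig_series I \<nu> a (z + h) - trig_series I \<nu> a z - D h
        = (\<Sum>\<^sub>\<infinity>i\<in>I. a i * tchar (\<nu> i) (z + h) - a i * tchar (\<nu> i) z - \<i> * of_real (h \<bullet> \<nu> i) * a i * tchar (\<nu> i) z)"
      unfolding D_def trig_series_def
      by (subst infsum_minus_complex(1)[symmetric], rule trig_series_summable[OF r], rule trig_series_summable[OF r],
          subst infsum_minus_complex(1)[symmetric], intro infsum_minus_complex(2) trig_series_summable[OF r], rule Dsum, rule refl)
    also have "norm \<dots> \<le> (\<Sum>\<^sub>\<infinity>i\<in>I. (norm h)\<^sup>2 * (norm (a i) * (1 + norm (\<nu> i)) ^ 2))"
    proof (rule norm_infsum_dominated(1)[OF summable_on_cmult_right[OF g]])
      fix i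
      have "a i * tchar (\<nu> i) (z + h) - a i * tchar (\<nu> i) z - \<i> * of_real (h \<bullet> \<nu> i) * a i * tchar (\<nu> i) z
          = a i * (tchar (\<nu> i) (z + h) - tchar (\<nu> i) z - \<i> * of_real (h \<bullet> \<nu> i) * tchar (\<nu> i) z)"
        by (simp add: algebra_simps)
      also have "norm \<dots> \<le> norm (a i) * ((norm (\<nu> i))\<^sup>2 * (norm h)\<^sup>2)"
        unfolding norm_mult[of "a i"] by (intro mult_left_mono norm_tchar_remainder) auto
      also have "\<dots> \<le> norm (a i) * ((1 + norm (\<nu> i))\<^sup>2 * (norm h)\<^sup>2)"
        by (intro mult_left_mono mult_right_mono power_mono) auto
      finally show "norm (a i * tchar (\<nu> i) (z + h) - a i * tchar (\<nu> i) z - \<i> * of_real (h \<bullet> \<nu> i) * a i * tchar (\<nu> i) z)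
          \<le> (norm h)\<^sup>2 * (norm (a i) * (1 + norm (\<nu> i)) ^ 2)"
        by (simp add: mult_ac)
    qed
    also have "\<dots> = S 2 * (norm h)\<^sup>2" unfolding S_def by (subst infsum_cmult_right[OF g]) simp
    finally show ?thesis .
  qed
  then have rem: "norm (trig_series I \<nu> a (z + h) - trig_series I \<nu> a z - D h) / norm h \<le> S 2 * norm h" for h
    by (cases "h = 0") (auto simp: divide_le_eq power2_eq_square mult.assoc)
  have "((\<lambda>h. norm (trig_series I \<nu> a (z + h) - trig_series I \<nu> a z - D h) / norm h) \<longlongrightarrow> 0) (at 0)"
  proof (rule Lim_null_comparison)
    show "\<forall>\<^sub>F h in at 0. norm (norm (trig_series I \<nu> a (z + h) - trig_series I \<nu> a z - D h) / norm h) \<le> S 2 * norm h"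
      using rem by (intro always_eventually) simp
    have "((\<lambda>h::'a. S 2 * norm h) \<longlongrightarrow> S 2 * norm (0::'a)) (at 0)" by (intro tendsto_intros)
    then show "((\<lambda>h::'a. S 2 * norm h) \<longlongrightarrow> 0) (at 0)" by simp
  qed
  ultimately show ?thesis unfolding has_derivative_at D_def by blast
qed

lemma rapid_pderiv:
  assumes "rapid I \<nu> a" "b \<in> Basis"
  shows "rapid I \<nu> (\<lambda>i. \<i> * of_real (b \<bullet> \<nu> i) * a i)"
    and "norm (\<i> * of_real (b \<bullet> \<nu> i) * a i) \<le> norm (a i) * (1 + norm (\<nu> i)) ^ 1"
proof -
  show le: "norm (\<i> * of_real (b \<bullet> \<nu> i) * a i) \<le> norm (a i) * (1 + norm (\<nu> i)) ^ 1" for i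
    using Basis_le_norm[OF assms(2), of "\<nu> i"]
    by (simp add: norm_mult inner_commute mult.commute mult_left_mono)
  show "rapid I \<nu> (\<lambda>i. \<i> * of_real (b \<bullet> \<nu> i) * a i)"
    by (rule rapid_dominated[OF assms(1) le])
qed

text \<open>
  A derivative of such a series is again such a series.
\<close>

lemma smooth_trig_series:
  assumes "rapid I \<nu> a"
  shows "smooth (trig_series I \<nu> a)"
proof (rule smooth_coinduct[where X = "\<lambda>f. \<exists>a. rapid I \<nu> a \<and> f = trig_series I \<nu> a"])
  show "\<exists>b. rapid I \<nu> b \<and> trig_series I \<nu> a = trig_series I \<nu> b" using assms by blast
  fix f :: "'b \<Rightarrow> complex" assume "\<exists>a. rapid I \<nu> a \<and> f = trig_series I \<nu> a"
  then obtain a where a: "rapid I \<nu> a" "f = trig_series I \<nu> a" by blast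
  show "f differentiable (at z)" for z
    using trig_series_has_derivative[OF a(1)] a(2) by (auto simp: differentiable_def)
  show "\<exists>a. rapid I \<nu> a \<and> pderiv_dir b f = trig_series I \<nu> a" if "b \<in> Basis" for b
    using rapid_pderiv(1)[OF a(1) that] pderiv_dir_eq[OF trig_series_has_derivative[OF a(1)]] a(2) by blast
qed

lemma torus_smooth_trig_series:
  assumes "rapid I \<nu> a" "\<And>i. i \<in> I \<Longrightarrow> \<nu> i \<in> int_lattice"
  shows "trig_series I \<nu> a \<in> torus_smooth"
  using smooth_trig_series[OF assms(1)]
  by (auto simp: torus_smooth_def trig_series_def tchar_shift tchar_period assms(2) intro!: infsum_cong)

lemma iter_pderiv_trig_series:
  assumes "rapid I \<nu> a" "set bs \<subseteq> Basis"
  shows "\<exists>a'. rapid I \<nu> a' \<and> iter_pderiv bs (trig_series I \<nu> a) = trig_series I \<nu> a' \<and>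
           (\<forall>i. norm (a' i) \<le> norm (a i) * (1 + norm (\<nu> i)) ^ length bs)"
  using assms(2)
proof (induction bs)
  case Nil
  then show ?case using assms(1) by auto
next
  case (Cons b bs)
  then obtain a' where a': "rapid I \<nu> a'" "iter_pderiv bs (trig_series I \<nu> a) = trig_series I \<nu> a'"
    and le: "\<And>i. norm (a' i) \<le> norm (a i) * (1 + norm (\<nu> i)) ^ length bs" by auto
  have b: "b \<in> Basis" using Cons.prems by simp
  have "norm (\<i> * of_real (b \<bullet> \<nu> i) * a' i) \<le> norm (a i) * (1 + norm (\<nu> i)) ^ length (b # bs)" for i
  proof -
    have "norm (\<i> * of_real (b \<bullet> \<nu> i) * a' i) \<le> norm (a' i) * (1 + norm (\<nu> i))"
      using rapid_pderiv(2)[OF a'(1) b] by simp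
    also have "\<dots> \<le> (norm (a i) * (1 + norm (\<nu> i)) ^ length bs) * (1 + norm (\<nu> i))"
      by (intro mult_right_mono le) auto
    finally show ?thesis by (simp add: mult_ac)
  qed
  moreover have "iter_pderiv (b # bs) (trig_series I \<nu> a) = trig_series I \<nu> (\<lambda>i. \<i> * of_real (b \<bullet> \<nu> i) * a' i)"
    unfolding iter_pderiv_Cons a'(2)
    by (rule ext) (rule pderiv_dir_eq[OF trig_series_has_derivative[OF a'(1)]])
  ultimately show ?case using rapid_pderiv(1)[OF a'(1) b] by blast
qed

lemma Ck_norm_trig_series_le:
  fixes \<nu> :: "'i \<Rightarrow> 'a::euclidean_space"
  assumes r: "rapid I \<nu> a"
  shows "Ck_norm k (trig_series I \<nu> a)
       \<le> real (Ck_count TYPE('a) k) * (\<Sum>\<^sub>\<infinity>i\<in>I. norm (a i) * (1 + norm (\<nu> i)) ^ k)"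
proof (rule Ck_norm_le)
  fix bs :: "'a list" and z assume bs: "set bs \<subseteq> Basis" "length bs \<le> k"
  obtain a' where a': "rapid I \<nu> a'" "iter_pderiv bs (trig_series I \<nu> a) = trig_series I \<nu> a'"
    and le: "\<And>i. norm (a' i) \<le> norm (a i) * (1 + norm (\<nu> i)) ^ length bs"
    using iter_pderiv_trig_series[OF r bs(1)] by blast
  have "norm (iter_pderiv bs (trig_series I \<nu> a) z) \<le> (\<Sum>\<^sub>\<infinity>i\<in>I. norm (a' i))"
    unfolding a'(2) by (rule norm_trig_series_le[OF a'(1)])
  also have "\<dots> \<le> (\<Sum>\<^sub>\<infinity>i\<in>I. norm (a i) * (1 + norm (\<nu> i)) ^ k)"
  proof (rule infsum_mono[OF rapid_norm_summable[OF a'(1)]])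
    show "(\<lambda>i. norm (a i) * (1 + norm (\<nu> i)) ^ k) summable_on I" using r by (simp add: rapid_def)
    fix i
    have "(1 + norm (\<nu> i)) ^ length bs \<le> (1 + norm (\<nu> i)) ^ k"
      using bs(2) by (intro power_increasing) auto
    then show "norm (a' i) \<le> norm (a i) * (1 + norm (\<nu> i)) ^ k"
      using le[of i] by (meson mult_left_mono norm_ge_zero order_trans)
  qed
  finally show "norm (iter_pderiv bs (trig_series I \<nu> a) z) \<le> (\<Sum>\<^sub>\<infinity>i\<in>I. norm (a i) * (1 + norm (\<nu> i)) ^ k)" .
qed

lemma torus_distributionD:
  assumes "u \<in> torus_distribution"
  shows "\<phi> \<in> torus_smooth \<Longrightarrow> \<psi> \<in> torus_smooth \<Longrightarrow> u (\<lambda>z. \<phi> z + \<psi> z) = u \<phi> + u \<psi>"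
    and "\<phi> \<in> torus_smooth \<Longrightarrow> u (\<lambda>z. a * \<phi> z) = a * u \<phi>"
    and "u (\<lambda>z. 0) = 0"
proof -
  show 1: "\<phi> \<in> torus_smooth \<Longrightarrow> u (\<lambda>z. a * \<phi> z) = a * u \<phi>" for a \<phi>
    using assms by (simp add: torus_distribution_def)
  show "u (\<lambda>z. 0) = 0" using 1[of "\<lambda>z. 0" 0] by simp
qed (use assms in \<open>simp add: torus_distribution_def\<close>)

lemma torus_distribution_sum:
  assumes "u \<in> torus_distribution" "\<And>i. i \<in> F \<Longrightarrow> f i \<in> torus_smooth"
  shows "u (\<lambda>z. \<Sum>i\<in>F. f i z) = (\<Sum>i\<in>F. u (f i))"
  using assms(2)
  by (induction F rule: infinite_finite_induct)
     (simp_all add: torus_distributionD[OF assms(1)] torus_smooth_sum)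

lemma torus_distribution_bound:
  assumes "u \<in> torus_distribution"
  obtains C k where "C \<ge> 0" "\<And>\<phi>. \<phi> \<in> torus_smooth \<Longrightarrow> norm (u \<phi>) \<le> C * Ck_norm k \<phi>"
proof -
  obtain C k where C: "\<And>\<phi>. \<phi> \<in> torus_smooth \<Longrightarrow> norm (u \<phi>) \<le> C * Ck_norm k \<phi>"
    using assms unfolding torus_distribution_def by blast
  have "norm (u \<phi>) \<le> \<bar>C\<bar> * Ck_norm k \<phi>" if "\<phi> \<in> torus_smooth" for \<phi>
    using C[OF that] mult_right_mono[OF abs_ge_self, of "Ck_norm k \<phi>" C] Ck_norm_nonneg[OF that] by force
  then show ?thesis using that[of "\<bar>C\<bar>" k] by simp
qed

text \<open>
  The remainders of the series are themselves trigonometric series, and their norms of every order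
  tend to zero; a distribution is continuous for one of these norms.
\<close>

lemma torus_distribution_trig_series:
  fixes \<nu> :: "'i \<Rightarrow> 'a::euclidean_space"
  assumes u: "u \<in> torus_distribution" and r: "rapid I \<nu> a"
    and \<nu>: "\<And>i. i \<in> I \<Longrightarrow> \<nu> i \<in> int_lattice"
  shows "((\<lambda>i. a i * u (tchar (\<nu> i))) has_sum u (trig_series I \<nu> a)) I"
proof -
  obtain C k where C: "C \<ge> 0" "\<And>\<phi>. \<phi> \<in> torus_smooth \<Longrightarrow> norm (u \<phi>) \<le> C * Ck_norm k \<phi>"
    using torus_distribution_bound[OF u] by blast
  define g where "g i = norm (a i) * (1 + norm (\<nu> i)) ^ k" for i
  have g: "g summable_on J" if "J \<subseteq> I" for J
    using rapid_subset[OF r that] by (simp add: rapid_def g_def[abs_def])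
  define C' where "C' = C * real (Ck_count TYPE('a) k)"
  have est: "dist (\<Sum>i\<in>F. a i * u (tchar (\<nu> i))) (u (trig_series I \<nu> a)) \<le> C' * (infsum g I - sum g F)"
    if F: "finite F" "F \<subseteq> I" for F
  proof -
    have split: "trig_series I \<nu> a = (\<lambda>z. (\<Sum>i\<in>F. a i * tchar (\<nu> i) z) + trig_series (I - F) \<nu> a z)"
    proof
      fix z
      have "trig_series I \<nu> a z - infsum (\<lambda>i. a i * tchar (\<nu> i) z) F = trig_series (I - F) \<nu> a z"
        unfolding trig_series_def using F
        by (intro infsum_Diff[symmetric] trig_series_summable[OF r] summable_on_finite) auto
      then show "trig_series I \<nu> a z = (\<Sum>i\<in>F. a i * tchar (\<nu> i) z) + trig_series (I - F) \<nu> a z"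
        using F(1) by (simp add: algebra_simps)
    qed
    have rF: "rapid (I - F) \<nu> a" by (rule rapid_subset[OF r]) auto
    have ts: "trig_series (I - F) \<nu> a \<in> torus_smooth"
      using \<nu> by (intro torus_smooth_trig_series rF) auto
    have tm: "(\<lambda>z. a i * tchar (\<nu> i) z) \<in> torus_smooth" if "i \<in> F" for i
      using that F \<nu> by (intro torus_smooth_cmult torus_smooth_tchar) auto
    have "u (trig_series I \<nu> a) = u (\<lambda>z. \<Sum>i\<in>F. a i * tchar (\<nu> i) z) + u (trig_series (I - F) \<nu> a)"
      unfolding split using tm ts by (intro torus_distributionD(1)[OF u] torus_smooth_sum) auto
    also have "u (\<lambda>z. \<Sum>i\<in>F. a i * tchar (\<nu> i) z) = (\<Sum>i\<in>F. u (\<lambda>z. a i * tchar (\<nu> i) z))"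
      by (rule torus_distribution_sum[OF u tm])
    also have "\<dots> = (\<Sum>i\<in>F. a i * u (tchar (\<nu> i)))"
      using F \<nu> by (intro sum.cong refl torus_distributionD(2)[OF u] torus_smooth_tchar) auto
    finally have "dist (\<Sum>i\<in>F. a i * u (tchar (\<nu> i))) (u (trig_series I \<nu> a)) = norm (u (trig_series (I - F) \<nu> a))"
      by (simp add: dist_norm)
    also have "\<dots> \<le> C * Ck_norm k (trig_series (I - F) \<nu> a)"
      by (rule C(2)[OF ts])
    also have "\<dots> \<le> C * (real (Ck_count TYPE('a) k) * infsum g (I - F))"
      unfolding g_def by (intro mult_left_mono Ck_norm_trig_series_le rF C(1))
    also have "infsum g (I - F) = infsum g I - sum g F"
      using infsum_Diff[of g I F] g[of I] F by (simp add: summable_on_finite)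
    finally show ?thesis by (simp add: C'_def mult.assoc)
  qed
  have "(sum g \<longlongrightarrow> infsum g I) (finite_subsets_at_top I)"
    using infsum_tendsto[OF g[of I]] by simp
  then have lim: "((\<lambda>F. C' * (infsum g I - sum g F)) \<longlongrightarrow> C' * (infsum g I - infsum g I)) (finite_subsets_at_top I)"
    by (intro tendsto_intros)
  have "((\<lambda>F. \<Sum>i\<in>F. a i * u (tchar (\<nu> i))) \<longlongrightarrow> u (trig_series I \<nu> a)) (finite_subsets_at_top I)"
  proof (rule tendsto_dist_iff[THEN iffD2], rule Lim_null_comparison)
    show "\<forall>\<^sub>F F in finite_subsets_at_top I.
        norm (dist (\<Sum>i\<in>F. a i * u (tchar (\<nu> i))) (u (trig_series I \<nu> a))) \<le> C' * (infsum g I - sum g F)"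
      using est by (intro eventually_finite_subsets_at_top_weakI) simp
  qed (use lim in simp)
  then show ?thesis by (simp add: has_sum_def)
qed

section \<open>Fourier inversion\<close>

lemma sum_inverse_square_int_le:
  "(\<Sum>k\<in>{- int n..int n}. inverse ((1 + \<bar>real_of_int k\<bar>)\<^sup>2)) \<le> 4 - 2 / (real n + 1)"
proof (induction n)
  case (Suc n)
  have "{- int (Suc n)..int (Suc n)} = insert (int (Suc n)) (insert (- int (Suc n)) {- int n..int n})"
    by auto
  then have "(\<Sum>k\<in>{- int (Suc n)..int (Suc n)}. inverse ((1 + \<bar>real_of_int k\<bar>)\<^sup>2))
      = 2 * inverse ((2 + real n)\<^sup>2) + (\<Sum>k\<in>{- int n..int n}. inverse ((1 + \<bar>real_of_int k\<bar>)\<^sup>2))"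
    by simp
  also have "\<dots> \<le> 2 * inverse ((2 + real n)\<^sup>2) + (4 - 2 / (real n + 1))"
    using Suc by simp
  also have "2 * inverse ((2 + real n)\<^sup>2) \<le> 2 * inverse ((2 + real n) * (1 + real n))"
    unfolding power2_eq_square by (intro mult_left_mono le_imp_inverse_le mult_left_mono) auto
  also have "2 * inverse ((2 + real n) * (1 + real n)) = 2 / (real n + 1) - 2 / (real (Suc n) + 1)"
    by (simp add: divide_simps)
  finally show ?case by simp
qed simp

text \<open>
  Each factor \<open>1 + \<bar>\<zeta> \<bullet> b\<bar>\<close> is at most \<open>1 + \<parallel>\<zeta>\<parallel>\<close>, so the summand is dominated by a product of
  functions of the single coordinates, whose sum over a box factorises.
\<close>

lemma int_lattice_summable:
  "(\<lambda>\<zeta>. inverse ((1 + norm \<zeta>) ^ (2 * DIM('a)))) summable_on (int_lattice :: 'a::euclidean_space set)"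
proof (rule nonneg_bdd_above_summable_on)
  have "(\<Sum>\<zeta>\<in>F. inverse ((1 + norm \<zeta>) ^ (2 * DIM('a)))) \<le> 4 ^ DIM('a)"
    if F: "F \<subseteq> int_lattice" "finite F" for F :: "'a set"
  proof -
    define N where "N = nat \<lceil>\<Sum>\<zeta>\<in>F. norm \<zeta>\<rceil>"
    define \<kappa> :: "'a \<Rightarrow> 'a \<Rightarrow> int" where "\<kappa> \<zeta> = restrict (\<lambda>b. \<lfloor>\<zeta> \<bullet> b\<rfloor>) Basis" for \<zeta>
    define w where "w k = inverse ((1 + \<bar>real_of_int k\<bar>)\<^sup>2)" for k
    have \<kappa>: "of_int (\<kappa> \<zeta> b) = \<zeta> \<bullet> b" if "\<zeta> \<in> F" "b \<in> Basis" for \<zeta> b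
    proof -
      have "\<zeta> \<bullet> b \<in> \<int>" using that F(1) by (auto simp: int_lattice_def)
      then obtain n where "\<zeta> \<bullet> b = of_int n" by (elim Ints_cases)
      then show ?thesis using that by (simp add: \<kappa>_def)
    qed
    have inj: "inj_on \<kappa> F"
    proof (rule inj_onI, rule euclidean_eqI)
      fix \<zeta> \<eta> b :: 'a assume "\<zeta> \<in> F" "\<eta> \<in> F" "\<kappa> \<zeta> = \<kappa> \<eta>" "b \<in> Basis"
      then show "\<zeta> \<bullet> b = \<eta> \<bullet> b" using \<kappa>[of \<zeta> b] \<kappa>[of \<eta> b] by simp
    qed
    have sub: "\<kappa> ` F \<subseteq> (\<Pi>\<^sub>E b\<in>Basis. {- int N..int N})"
    proof (rule image_subsetI)
      fix \<zeta> assume \<zeta>: "\<zeta> \<in> F"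
      have "\<kappa> \<zeta> \<in> extensional Basis \<and> (\<forall>b\<in>Basis. - int N \<le> \<kappa> \<zeta> b \<and> \<kappa> \<zeta> b \<le> int N)"
      proof (intro conjI ballI)
        show "\<kappa> \<zeta> \<in> extensional Basis" by (simp add: \<kappa>_def)
        fix b :: 'a assume b: "b \<in> Basis"
        have "\<bar>\<zeta> \<bullet> b\<bar> \<le> norm \<zeta>" by (rule Basis_le_norm[OF b])
        also have "\<dots> \<le> (\<Sum>\<zeta>\<in>F. norm \<zeta>)" by (rule member_le_sum[OF \<zeta> _ F(2)]) simp
        also have "\<dots> \<le> real N" unfolding N_def by (rule real_nat_ceiling_ge)
        finally have "\<bar>real_of_int (\<kappa> \<zeta> b)\<bar> \<le> real N" using \<kappa>[OF \<zeta> b] by simp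
        then show "- int N \<le> \<kappa> \<zeta> b" "\<kappa> \<zeta> b \<le> int N" by linarith+
      qed
      then show "\<kappa> \<zeta> \<in> (\<Pi>\<^sub>E b\<in>Basis. {- int N..int N})" by (simp add: PiE_iff)
    qed
    have "(\<Sum>\<zeta>\<in>F. inverse ((1 + norm \<zeta>) ^ (2 * DIM('a)))) \<le> (\<Sum>\<zeta>\<in>F. \<Prod>b\<in>Basis. w (\<kappa> \<zeta> b))"
    proof (rule sum_mono)
      fix \<zeta> assume \<zeta>: "\<zeta> \<in> F"
      have "(\<Prod>b::'a\<in>Basis. inverse ((1 + norm \<zeta>)\<^sup>2)) \<le> (\<Prod>b\<in>Basis. w (\<kappa> \<zeta> b))"
      proof (rule prod_mono, intro conjI)
        fix b :: 'a assume b: "b \<in> Basis"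
        have "(1 + \<bar>\<zeta> \<bullet> b\<bar>)\<^sup>2 \<le> (1 + norm \<zeta>)\<^sup>2"
          using Basis_le_norm[OF b, of \<zeta>] by (intro power_mono) auto
        then have "inverse ((1 + norm \<zeta>)\<^sup>2) \<le> inverse ((1 + \<bar>\<zeta> \<bullet> b\<bar>)\<^sup>2)"
          by (intro le_imp_inverse_le zero_less_power) auto
        then show "inverse ((1 + norm \<zeta>)\<^sup>2) \<le> w (\<kappa> \<zeta> b)"
          by (simp add: w_def \<kappa>[OF \<zeta> b])
      qed simp
      then show "inverse ((1 + norm \<zeta>) ^ (2 * DIM('a))) \<le> (\<Prod>b\<in>Basis. w (\<kappa> \<zeta> b))"
        by (simp add: power_mult power_inverse)
    qed
    also have "\<dots> = (\<Sum>k\<in>\<kappa> ` F. \<Prod>b\<in>Basis. w (k b))"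
      by (simp add: sum.reindex[OF inj])
    also have "\<dots> \<le> (\<Sum>k\<in>(\<Pi>\<^sub>E b::'a\<in>Basis. {- int N..int N}). \<Prod>b\<in>Basis. w (k b))"
      using sub by (rule sum_mono2[rotated]) (auto simp: w_def intro!: prod_nonneg finite_PiE)
    also have "\<dots> = (\<Prod>b::'a\<in>Basis. \<Sum>k\<in>{- int N..int N}. w k)"
      by (rule prod_sum_PiE[symmetric]) auto
    also have "\<dots> \<le> (\<Prod>b::'a\<in>Basis. 4)"
    proof (rule prod_mono, intro conjI)
      have "0 \<le> 2 / (real N + 1)" by simp
      then show "(\<Sum>k\<in>{- int N..int N}. w k) \<le> 4"
        using sum_inverse_square_int_le[of N] unfolding w_def by linarith
    qed (auto simp: w_def intro: sum_nonneg)
    finally show ?thesis by simp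
  qed
  then show "bdd_above (sum (\<lambda>\<zeta>. inverse ((1 + norm \<zeta>) ^ (2 * DIM('a)))) ` {F. F \<subseteq> (int_lattice :: 'a set) \<and> finite F})"
    by (auto intro!: bdd_aboveI)
qed simp

text \<open>
  A bound of order \<open>K + 2d\<close>, where \<open>d\<close> is the dimension, makes the sum with weight of order \<open>K\<close>
  converge.
\<close>

lemma rapidI:
  fixes \<nu> :: "'i \<Rightarrow> 'a::euclidean_space"
  assumes \<nu>: "inj_on \<nu> I" "\<nu> ` I \<subseteq> int_lattice"
    and bnd: "\<And>K. \<exists>C. \<forall>i\<in>I. norm (a i) * (1 + norm (\<nu> i)) ^ K \<le> C"
  shows "rapid I \<nu> a"
  unfolding rapid_def
proof
  fix K
  obtain C where C: "\<And>i. i \<in> I \<Longrightarrow> norm (a i) * (1 + norm (\<nu> i)) ^ (K + 2 * DIM('a)) \<le> C"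
    using bnd by blast
  have "(\<lambda>\<zeta>. inverse ((1 + norm \<zeta>) ^ (2 * DIM('a)))) summable_on \<nu> ` I"
    by (rule summable_on_subset_banach[OF int_lattice_summable \<nu>(2)])
  then have "((\<lambda>\<zeta>. inverse ((1 + norm \<zeta>) ^ (2 * DIM('a)))) \<circ> \<nu>) summable_on I"
    using summable_on_reindex[OF \<nu>(1)] by blast
  then have "(\<lambda>i. C * inverse ((1 + norm (\<nu> i)) ^ (2 * DIM('a)))) summable_on I"
    by (intro summable_on_cmult_right) (simp add: o_def)
  then show "(\<lambda>i. norm (a i) * (1 + norm (\<nu> i)) ^ K) summable_on I"
  proof (rule summable_on_comparison_test)
    fix i assume "i \<in> I"
    have pos: "0 < (1 + norm (\<nu> i)) ^ (2 * DIM('a))" by (simp add: add_pos_nonneg)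
    then show "norm (a i) * (1 + norm (\<nu> i)) ^ K \<le> C * inverse ((1 + norm (\<nu> i)) ^ (2 * DIM('a)))"
      using C[OF \<open>i \<in> I\<close>] by (simp add: power_add field_simps)
  qed auto
qed

inductive trig_poly :: "('a::euclidean_space \<Rightarrow> complex) \<Rightarrow> bool" where
  char: "\<zeta> \<in> int_lattice \<Longrightarrow> trig_poly (\<lambda>z. c * tchar \<zeta> z)"
| add: "trig_poly f \<Longrightarrow> trig_poly g \<Longrightarrow> trig_poly (\<lambda>z. f z + g z)"

lemma trig_poly_const: "trig_poly (\<lambda>z. c)"
  using trig_poly.char[of 0 c] int_lattice_closed(1) by simp

lemma trig_poly_mult:
  assumes "trig_poly f" "trig_poly g"
  shows "trig_poly (\<lambda>z. f z * g z)"
  using assms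
proof (induction f)
  case (char \<zeta> c)
  from char(2) show ?case
  proof (induction g)
    case (char \<eta> d)
    have "trig_poly (\<lambda>z. (c * d) * tchar (\<zeta> + \<eta>) z)"
      using char \<open>\<zeta> \<in> int_lattice\<close> by (intro trig_poly.char) auto
    then show ?case by (simp add: tchar_add mult_ac)
  next
    case (add f g)
    from trig_poly.add[OF add.IH] show ?case by (simp add: ring_distribs)
  qed
next
  case (add f1 f2)
  then have "trig_poly (\<lambda>z. f1 z * g z)" "trig_poly (\<lambda>z. f2 z * g z)" by blast+
  from trig_poly.add[OF this] show ?case by (simp add: ring_distribs)
qed

lemma trig_poly_cmult: "trig_poly f \<Longrightarrow> trig_poly (\<lambda>z. c * f z)"
  using trig_poly_mult[OF trig_poly_const] .

lemma trig_poly_sum: "(\<And>i. i \<in> F \<Longrightarrow> trig_poly (f i)) \<Longrightarrow> trig_poly (\<lambda>z. \<Sum>i\<in>F. f i z)"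
  by (induction F rule: infinite_finite_induct) (auto intro: trig_poly.add trig_poly_const)

lemma trig_poly_torus_smooth: "trig_poly f \<Longrightarrow> f \<in> torus_smooth"
  by (induction rule: trig_poly.induct)
     (auto intro: torus_smooth_add torus_smooth_cmult torus_smooth_tchar)

lemma Basis_int_lattice: "b \<in> Basis \<Longrightarrow> b \<in> int_lattice"
  by (auto simp: int_lattice_def inner_Basis)

lemma trig_poly_cos_sin:
  fixes b :: "'a::euclidean_space"
  assumes b: "b \<in> Basis"
  shows "trig_poly (\<lambda>z. of_real (cos (z \<bullet> b)))" "trig_poly (\<lambda>z. of_real (sin (z \<bullet> b)))"
proof -
  have "(\<lambda>z. complex_of_real (cos (z \<bullet> b))) = (\<lambda>z. 1 / 2 * tchar b z + 1 / 2 * tchar (- b) z)"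
    by (simp add: fun_eq_iff tchar_def cos_of_real[symmetric] cos_exp_eq add_divide_distrib)
  then show "trig_poly (\<lambda>z. of_real (cos (z \<bullet> b)))"
    using b by (simp only:) (intro trig_poly.intros, auto intro: Basis_int_lattice)
  have "(\<lambda>z. complex_of_real (sin (z \<bullet> b))) = (\<lambda>z. 1 / (2 * \<i>) * tchar b z + (- 1 / (2 * \<i>)) * tchar (- b) z)"
    by (simp add: fun_eq_iff tchar_def sin_of_real[symmetric] sin_exp_eq field_simps)
  then show "trig_poly (\<lambda>z. of_real (sin (z \<bullet> b)))"
    using b by (simp only:) (intro trig_poly.intros, auto intro: Basis_int_lattice)
qed

text \<open>
  The circles \<open>(cos z\<^sub>b, sin z\<^sub>b)\<close> together realise the torus of dimension \<open>d\<close> as a compact subset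
  of \<open>\<real>\<^sup>2\<^sup>d\<close>.
\<close>

definition torus_embed :: "'a::euclidean_space \<Rightarrow> 'a \<times> 'a" where
  "torus_embed z = ((\<Sum>b\<in>Basis. cos (z \<bullet> b) *\<^sub>R b), (\<Sum>b\<in>Basis. sin (z \<bullet> b) *\<^sub>R b))"

lemma trig_poly_polynomial_embed:
  fixes r :: "'a::euclidean_space \<times> 'a \<Rightarrow> real"
  assumes "real_polynomial_function r"
  shows "trig_poly (\<lambda>z. of_real (r (torus_embed z)))"
  using assms
proof induction
  case (linear r)
  then have lin: "linear r" by (rule bounded_linear.linear)
  have "r (torus_embed z) = (\<Sum>b\<in>Basis. cos (z \<bullet> b) * r (b, 0)) + (\<Sum>b\<in>Basis. sin (z \<bullet> b) * r (0, b))" for z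
  proof -
    have "torus_embed z = (\<Sum>b\<in>Basis. cos (z \<bullet> b) *\<^sub>R (b, 0)) + (\<Sum>b\<in>Basis. sin (z \<bullet> b) *\<^sub>R (0, b))"
      by (simp add: torus_embed_def prod_eq_iff fst_sum snd_sum)
    then show ?thesis
      by (simp only: linear_add[OF lin] linear_sum[OF lin] linear_cmul[OF lin] real_scaleR_def)
  qed
  then have "(\<lambda>z. complex_of_real (r (torus_embed z))) = 
     (\<lambda>z. (\<Sum>b\<in>Basis. of_real (r (b, 0)) * of_real (cos (z \<bullet> b))) + (\<Sum>b\<in>Basis. of_real (r (0, b)) * of_real (sin (z \<bullet> b))))"
    by (simp add: fun_eq_iff mult.commute)
  then show ?case
    by (simp only:) (intro trig_poly.add trig_poly_sum trig_poly_cmult trig_poly_cos_sin)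
qed (auto intro: trig_poly_const trig_poly.add trig_poly_mult)

text \<open>
  A continuous periodic function factors through the embedded torus, where the theorem of Stone
  and Weierstrass applies.
\<close>

lemma trig_poly_dense:
  fixes f :: "'a::euclidean_space \<Rightarrow> complex"
  assumes cont: "continuous_on UNIV f" and per: "torus_periodic f" and e: "e > 0"
  obtains q where "trig_poly q" "\<And>z. norm (f z - q z) < e"
proof -
  have eq: "f z = f z'" if "torus_embed z = torus_embed z'" for z z'
  proof -
    have "cos (z \<bullet> b) = cos (z' \<bullet> b)" "sin (z \<bullet> b) = sin (z' \<bullet> b)" if "b \<in> Basis" for b
    proof -
      have "fst (torus_embed z) \<bullet> b = fst (torus_embed z') \<bullet> b" "snd (torus_embed z) \<bullet> b = snd (torus_embed z') \<bullet> b"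
        using \<open>torus_embed z = torus_embed z'\<close> by simp_all
      then show "cos (z \<bullet> b) = cos (z' \<bullet> b)" "sin (z \<bullet> b) = sin (z' \<bullet> b)"
        using that by (simp_all add: torus_embed_def)
    qed
    then have "\<exists>n::int. z \<bullet> b = z' \<bullet> b + 2 * pi * n" if "b \<in> Basis" for b
      using sin_cos_eq_iff that by blast
    then obtain n :: "'a \<Rightarrow> int" where n: "\<And>b. b \<in> Basis \<Longrightarrow> z \<bullet> b = z' \<bullet> b + 2 * pi * n b"
      by metis
    define \<zeta> where "\<zeta> = (\<Sum>b\<in>Basis. of_int (n b) *\<^sub>R b)"
    have "\<zeta> \<in> int_lattice" by (simp add: \<zeta>_def int_lattice_def)
    moreover have "z = z' + (2 * pi) *\<^sub>R \<zeta>"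
      by (rule euclidean_eqI) (simp add: n \<zeta>_def inner_add_left)
    ultimately show ?thesis using torus_periodic_lattice[OF per] by simp
  qed
  have embed_cont: "continuous_on A torus_embed" for A :: "'a set"
    unfolding torus_embed_def by (intro continuous_intros)
  define S where "S = torus_embed ` (torus_cell :: 'a set)"
  have cell: "compact (torus_cell :: 'a set)" by (simp add: torus_cell_def)
  have S: "compact S" unfolding S_def by (intro compact_continuous_image embed_cont cell)
  define g where "g y = f (SOME z. torus_embed z = y)" for y
  have g: "g (torus_embed z) = f z" for z
    unfolding g_def by (rule eq, rule someI) (rule refl)
  have "continuous_on S g"
    unfolding continuous_on_closed_vimage[OF compact_imp_closed[OF S]]
  proof (intro allI impI)
    fix B :: "complex set" assume B: "closed B"
    have "g -` B \<inter> S = torus_embed ` (torus_cell \<inter> f -` B)"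
      by (auto simp: S_def g)
    moreover have "closed (f -` B)"
      using continuous_closed_preimage[OF cont _ B] by simp
    ultimately show "closed (g -` B \<inter> S)"
      using compact_imp_closed[OF compact_continuous_image[OF embed_cont compact_Int_closed[OF cell]]]
      by simp
  qed
  from Stone_Weierstrass_polynomial_function[OF S this e]
  obtain p where p: "polynomial_function p" "\<And>y. y \<in> S \<Longrightarrow> norm (g y - p y) < e" by blast
  define q where "q z = p (torus_embed z)" for z
  have pp: "real_polynomial_function (\<lambda>y. Re (p y))" "real_polynomial_function (\<lambda>y. Im (p y))"
    using p(1) bounded_linear_Re bounded_linear_Im unfolding polynomial_function_def o_def by blast+
  have "q = (\<lambda>z. of_real (Re (p (torus_embed z))) + \<i> * of_real (Im (p (torus_embed z))))"
    by (simp add: fun_eq_iff q_def complex_eq[symmetric])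
  then have q: "trig_poly q"
    by (simp only:) (intro trig_poly.add trig_poly_cmult trig_poly_polynomial_embed pp)
  have "norm (f z - q z) < e" for z
  proof -
    obtain w \<zeta> where w: "w \<in> torus_cell" "\<zeta> \<in> int_lattice" "z = w + (2 * pi) *\<^sub>R \<zeta>"
      by (rule torus_cell_representative)
    then have "f z = f w" "q z = q w"
      using torus_periodic_lattice[OF per w(2)] 
        torus_periodic_lattice[OF _ w(2), of q] trig_poly_torus_smooth[OF q]
      by (auto simp: torus_smooth_iff)
    then show ?thesis using p(2)[of "torus_embed w"] w(1) g by (auto simp: q_def S_def)
  qed
  with q that show thesis by blast
qed

text \<open>
  Such a function is orthogonal to all trigonometric polynomials, in particular to approximations of
  its own complex conjugate, so the integral of its squared modulus vanishes.
\<close>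

lemma fourier_unique:
  fixes f :: "'a::euclidean_space \<Rightarrow> complex"
  assumes f: "f \<in> torus_smooth"
    and 0: "\<And>\<zeta>. \<zeta> \<in> int_lattice \<Longrightarrow> integral torus_cell (\<lambda>z. f z * tchar \<zeta> z) = 0"
  shows "f z = 0"
proof -
  have orth: "integral torus_cell (\<lambda>z. f z * q z) = 0" if "trig_poly q" for q
    using that
  proof induction
    case (char \<zeta> c)
    have "integral torus_cell (\<lambda>z. c * (f z * tchar \<zeta> z)) = 0"
      using 0[OF char] by simp
    then show ?case by (simp add: mult_ac)
  next
    case (add q1 q2)
    have "integral torus_cell (\<lambda>z. f z * q1 z + f z * q2 z) = 0"
      using add
      by (subst integral_add)
         (auto intro!: integrable_torus_cell torus_smooth_mult[OF f] dest: trig_poly_torus_smooth)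
    then show ?case by (simp add: ring_distribs)
  qed
  obtain B where B: "B \<ge> 0" "\<And>z. norm (f z) \<le> B"
    using torus_smooth_bounded[OF f] by blast
  have contf: "continuous_on A f" for A by (rule torus_smooth_continuous_on[OF f])
  have le: "norm (integral torus_cell (\<lambda>z. f z * cnj (f z))) \<le> e * (B * (2 * pi) ^ DIM('a))" if "e > 0" for e
  proof -
    obtain q where q: "trig_poly q" "\<And>z. norm (cnj (f z) - q z) < e"
      using trig_poly_dense[of "\<lambda>z. cnj (f z)" e] contf f \<open>e > 0\<close>
      by (auto simp: torus_smooth_iff torus_periodic_def intro: continuous_intros)
    have contq: "continuous_on A q" for A
      by (rule torus_smooth_continuous_on[OF trig_poly_torus_smooth[OF q(1)]])
    have "integral torus_cell (\<lambda>z. f z * cnj (f z)) = integral torus_cell (\<lambda>z. f z * (cnj (f z) - q z) + f z * q z)"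
      by (simp add: algebra_simps)
    also have "\<dots> = integral torus_cell (\<lambda>z. f z * (cnj (f z) - q z))"
      unfolding torus_cell_def
      by (subst integral_add) (auto intro!: integrable_continuous continuous_intros contf contq 
          simp: orth[OF q(1), unfolded torus_cell_def])
    also have "norm \<dots> \<le> (B * e) * (2 * pi) ^ DIM('a)"
    proof (rule norm_integral_torus_cell_le)
      show "continuous_on UNIV (\<lambda>z. f z * (cnj (f z) - q z))"
        by (intro continuous_intros contf contq)
      show "norm (f z * (cnj (f z) - q z)) \<le> B * e" for z
        unfolding norm_mult using B q(2)[of z] by (intro mult_mono) auto
    qed
    finally show ?thesis by (simp add: mult_ac)
  qed
  have "norm (integral torus_cell (\<lambda>z. f z * cnj (f z))) \<le> 0"
  proof (rule field_le_epsilon)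
    fix e :: real assume "e > 0"
    define M where "M = B * (2 * pi) ^ DIM('a) + 1"
    have M: "M > 0" using B(1) by (simp add: M_def add_nonneg_pos)
    have "norm (integral torus_cell (\<lambda>z. f z * cnj (f z))) \<le> e / M * (B * (2 * pi) ^ DIM('a))"
      using le[of "e / M"] \<open>e > 0\<close> M by simp
    also have "\<dots> \<le> e / M * M" using \<open>e > 0\<close> M by (intro mult_left_mono) (auto simp: M_def)
    finally show "norm (integral torus_cell (\<lambda>z. f z * cnj (f z))) \<le> 0 + e" using M by simp
  qed
  then have "integral torus_cell (\<lambda>z. f z * cnj (f z)) = 0" by simp
  moreover have "integral torus_cell (\<lambda>z. f z * cnj (f z)) = of_real (integral torus_cell (\<lambda>z. (norm (f z))\<^sup>2))"
  proof -
    have "(\<lambda>z. (norm (f z))\<^sup>2) integrable_on torus_cell"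
      unfolding torus_cell_def by (intro integrable_continuous continuous_intros contf)
    from integral_linear[OF this bounded_linear_of_real[where 'a = complex]] show ?thesis
      by (simp add: o_def flip: complex_norm_square)
  qed
  ultimately have int0: "integral torus_cell (\<lambda>z. (norm (f z))\<^sup>2) = 0" by simp
  have "box (0::'a) (\<Sum>b\<in>Basis. (2 * pi) *\<^sub>R b) \<noteq> {}"
    by (simp add: box_ne_empty)
  moreover have "continuous_on (cbox 0 (\<Sum>b\<in>Basis. (2 * pi) *\<^sub>R b)) (\<lambda>z. (norm (f z))\<^sup>2)"
    by (intro continuous_intros contf)
  ultimately have "\<forall>w\<in>torus_cell. (norm (f w))\<^sup>2 = 0"
    using integral_cbox_eq_0_iff[of 0 "\<Sum>b\<in>Basis. (2 * pi) *\<^sub>R b" "\<lambda>z. (norm (f z))\<^sup>2"] int0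
    unfolding torus_cell_def[symmetric] by simp
  then have cell0: "f w = 0" if "w \<in> torus_cell" for w using that by simp
  obtain w \<zeta> where "w \<in> torus_cell" "\<zeta> \<in> int_lattice" "z = w + (2 * pi) *\<^sub>R \<zeta>"
    by (rule torus_cell_representative)
  then show ?thesis
    using torus_periodic_lattice[of f \<zeta> w] f cell0 by (simp add: torus_smooth_iff)
qed

lemma integral_torus_distribution:
  fixes g :: "'a::euclidean_space \<Rightarrow> complex"
  assumes g: "g \<in> torus_smooth"
  shows "(\<lambda>\<phi>. integral torus_cell (\<lambda>z. \<phi> z * g z)) \<in> torus_distribution"
proof -
  obtain B where B: "B \<ge> 0" "\<And>z. norm (g z) \<le> B"
    using torus_smooth_bounded[OF g] by blast
  have "norm (integral torus_cell (\<lambda>z. \<phi> z * g z)) \<le> (B * (2 * pi) ^ DIM('a)) * Ck_norm 0 \<phi>"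
    if \<phi>: "\<phi> \<in> torus_smooth" for \<phi>
  proof -
    have "norm (integral torus_cell (\<lambda>z. \<phi> z * g z)) \<le> (Ck_norm 0 \<phi> * B) * (2 * pi) ^ DIM('a)"
      unfolding norm_mult using B
      by (intro norm_integral_torus_cell_le torus_smooth_continuous_on torus_smooth_mult \<phi> g)
         (auto simp: norm_mult intro!: mult_mono norm_le_Ck_norm[OF \<phi>] Ck_norm_nonneg[OF \<phi>])
    then show ?thesis by (simp add: mult_ac)
  qed
  moreover have "integral torus_cell (\<lambda>z. (\<phi> z + \<psi> z) * g z)
      = integral torus_cell (\<lambda>z. \<phi> z * g z) + integral torus_cell (\<lambda>z. \<psi> z * g z)"
    if "\<phi> \<in> torus_smooth" "\<psi> \<in> torus_smooth" for \<phi> \<psi>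
    using that g unfolding distrib_right
    by (intro integral_add integrable_torus_cell torus_smooth_mult)
  moreover have "integral torus_cell (\<lambda>z. c * \<phi> z * g z) = c * integral torus_cell (\<lambda>z. \<phi> z * g z)" for c \<phi>
    by (simp add: mult.assoc)
  ultimately show ?thesis
    unfolding torus_distribution_def by blast
qed

lemma rapid_fourier_coefficients:
  fixes f :: "'a::euclidean_space \<Rightarrow> complex"
  assumes f: "f \<in> torus_smooth"
  shows "rapid int_lattice (\<lambda>\<zeta>. \<zeta>) (\<lambda>\<zeta>. c * integral torus_cell (\<lambda>z. f z * tchar (- \<zeta>) z))"
proof (rule rapidI)
  fix K
  show "\<exists>C. \<forall>\<zeta>\<in>int_lattice. norm (c * integral torus_cell (\<lambda>z. f z * tchar (- \<zeta>) z)) * (1 + norm \<zeta>) ^ K \<le> C"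
  proof (intro exI ballI)
    fix \<zeta> :: 'a assume "\<zeta> \<in> int_lattice"
    then have "(1 + norm \<zeta>) ^ K * norm (integral torus_cell (\<lambda>z. f z * tchar (- \<zeta>) z))
        \<le> (1 + real DIM('a)) ^ K * (2 * pi) ^ DIM('a) * Ck_norm K f"
      using fourier_decay[OF f, of "- \<zeta>" K] by simp
    from mult_left_mono[OF this, of "norm c"]
    show "norm (c * integral torus_cell (\<lambda>z. f z * tchar (- \<zeta>) z)) * (1 + norm \<zeta>) ^ K
        \<le> norm c * ((1 + real DIM('a)) ^ K * (2 * pi) ^ DIM('a) * Ck_norm K f)"
      by (simp add: norm_mult mult_ac)
  qed
qed auto

text \<open>
  The Fourier series converges to a smooth function with the same coefficients, so the uniqueness
  theorem applies to the difference.
\<close>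

theorem fourier_inversion:
  fixes f :: "'a::euclidean_space \<Rightarrow> complex"
  assumes f: "f \<in> torus_smooth"
  defines "a \<equiv> \<lambda>\<zeta>. inverse ((2 * of_real pi) ^ DIM('a)) * integral torus_cell (\<lambda>z. f z * tchar (- \<zeta>) z)"
  shows "f = trig_series int_lattice (\<lambda>\<zeta>. \<zeta>) a"
proof -
  define s where "s = trig_series int_lattice (\<lambda>\<zeta>::'a. \<zeta>) a"
  have r: "rapid int_lattice (\<lambda>\<zeta>. \<zeta>) a"
    unfolding a_def by (rule rapid_fourier_coefficients[OF f])
  have s: "s \<in> torus_smooth"
    unfolding s_def by (rule torus_smooth_trig_series[OF r])
  have coef: "integral torus_cell (\<lambda>z. s z * tchar \<eta> z) = integral torus_cell (\<lambda>z. f z * tchar \<eta> z)"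
    if \<eta>: "\<eta> \<in> int_lattice" for \<eta>
  proof -
    have "((\<lambda>\<zeta>. a \<zeta> * integral torus_cell (\<lambda>z. tchar \<zeta> z * tchar \<eta> z)) has_sum
        integral torus_cell (\<lambda>z. s z * tchar \<eta> z)) int_lattice"
      unfolding s_def
      by (rule torus_distribution_trig_series[OF integral_torus_distribution[OF torus_smooth_tchar[OF \<eta>]] r])
    moreover have "((\<lambda>\<zeta>. a \<zeta> * integral torus_cell (\<lambda>z. tchar \<zeta> z * tchar \<eta> z)) has_sum
        integral torus_cell (\<lambda>z. f z * tchar \<eta> z)) int_lattice"
    proof (rule has_sum_finite_neutralI[where B = "{- \<eta>}"])
      fix \<zeta> assume \<zeta>: "\<zeta> \<in> int_lattice - {- \<eta>}"
      then have "integral torus_cell (tchar (\<zeta> + \<eta>)) = 0"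
        using \<eta> by (subst integral_tchar) (auto simp: eq_neg_iff_add_eq_0)
      then show "a \<zeta> * integral torus_cell (\<lambda>z. tchar \<zeta> z * tchar \<eta> z) = 0"
        by (simp flip: tchar_add)
    next
      have "integral torus_cell (tchar (- \<eta> + \<eta>)) = (2 * of_real pi) ^ DIM('a)"
        by (subst integral_tchar) (auto intro: int_lattice_closed)
      then have "integral torus_cell (\<lambda>z. tchar (- \<eta>) z * tchar \<eta> z) = (2 * of_real pi) ^ DIM('a)"
        by (simp flip: tchar_add)
      then show "integral torus_cell (\<lambda>z. f z * tchar \<eta> z)
          = (\<Sum>\<zeta>\<in>{- \<eta>}. a \<zeta> * integral torus_cell (\<lambda>z. tchar \<zeta> z * tchar \<eta> z))"
        by (simp add: a_def field_simps)
    qed (use \<eta> in auto)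
    ultimately show ?thesis by (rule has_sum_unique)
  qed
  have "f z - s z = 0" for z
  proof (rule fourier_unique[OF torus_smooth_diff[OF f s]])
    fix \<zeta> :: 'a assume \<zeta>: "\<zeta> \<in> int_lattice"
    have "integral torus_cell (\<lambda>z. f z * tchar \<zeta> z - s z * tchar \<zeta> z) = 0"
      using coef[OF \<zeta>] f s \<zeta>
      by (subst integral_diff) (auto intro!: integrable_torus_cell torus_smooth_mult torus_smooth_tchar)
    then show "integral torus_cell (\<lambda>z. (f z - s z) * tchar \<zeta> z) = 0"
      by (simp add: left_diff_distrib)
  qed
  then show ?thesis unfolding s_def by (auto simp: fun_eq_iff)
qed

text \<open>
  A distribution whose Fourier coefficients decrease rapidly is the smooth function they
  define: both act on a test function through its Fourier series.
\<close>

theorem smooth_distribution_if_rapid_coefficients: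
  fixes u :: "'a::euclidean_space functional"
  assumes u: "u \<in> torus_distribution"
    and bnd: "\<And>K. \<exists>C. \<forall>\<zeta>\<in>int_lattice. norm (u (tchar \<zeta>)) * (1 + norm \<zeta>) ^ K \<le> C"
  shows "smooth_distribution u"
proof -
  define \<omega> :: complex where "\<omega> = inverse ((2 * of_real pi) ^ DIM('a))"
  define f where "f = trig_series (int_lattice :: 'a set) uminus (\<lambda>\<zeta>. \<omega> * u (tchar \<zeta>))"
  have r: "rapid (int_lattice :: 'a set) uminus (\<lambda>\<zeta>. \<omega> * u (tchar \<zeta>))"
  proof (rule rapidI)
    fix K
    obtain C where C: "\<And>\<zeta>. \<zeta> \<in> int_lattice \<Longrightarrow> norm (u (tchar \<zeta>)) * (1 + norm \<zeta>) ^ K \<le> C"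
      using bnd by blast
    have "norm (\<omega> * u (tchar \<zeta>)) * (1 + norm (- \<zeta>)) ^ K \<le> norm \<omega> * C" if "\<zeta> \<in> int_lattice" for \<zeta>
      using mult_left_mono[OF C[OF that], of "norm \<omega>"] by (simp add: norm_mult mult_ac)
    then show "\<exists>C. \<forall>\<zeta>\<in>int_lattice. norm (\<omega> * u (tchar \<zeta>)) * (1 + norm (- \<zeta>)) ^ K \<le> C" by blast
  qed auto
  have f: "f \<in> torus_smooth"
    unfolding f_def by (rule torus_smooth_trig_series[OF r]) auto
  have "u \<phi> = integral torus_cell (\<lambda>z. f z * \<phi> z)" if \<phi>: "\<phi> \<in> torus_smooth" for \<phi>
  proof -
    have "((\<lambda>\<zeta>. \<omega> * u (tchar \<zeta>) * integral torus_cell (\<lambda>z. tchar (- \<zeta>) z * \<phi> z)) has_sum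
        integral torus_cell (\<lambda>z. f z * \<phi> z)) int_lattice"
      unfolding f_def
      by (rule torus_distribution_trig_series[OF integral_torus_distribution[OF \<phi>] r]) auto
    moreover have "((\<lambda>\<zeta>. \<omega> * integral torus_cell (\<lambda>z. \<phi> z * tchar (- \<zeta>) z) * u (tchar \<zeta>)) has_sum u \<phi>) int_lattice"
      unfolding \<omega>_def
      by (subst (2) fourier_inversion[OF \<phi>])
         (rule torus_distribution_trig_series[OF u rapid_fourier_coefficients[OF \<phi>]])
    ultimately show ?thesis
      using has_sum_unique[of "\<lambda>\<zeta>. \<omega> * u (tchar \<zeta>) * integral torus_cell (\<lambda>z. tchar (- \<zeta>) z * \<phi> z)"
          int_lattice "u \<phi>" "integral torus_cell (\<lambda>z. f z * \<phi> z)"]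
      by (simp add: mult_ac)
  qed
  with f show ?thesis unfolding smooth_distribution_def by blast
qed

section \<open>The operators on exponentials in the space variable\<close>

lemma Basis_vec_cart: "(Basis :: (real ^ 'N::finite) set) = range (\<lambda>i. axis i 1)"
  by (auto simp: Basis_vec_def)

lemma vec_of_int_lattice [simp]: "vec_of_int \<xi> \<in> int_lattice"
  by (auto simp: int_lattice_def Basis_vec_cart inner_axis vec_of_int_def)

lemma vec_of_int_eq_iff [simp]: "vec_of_int \<xi> = vec_of_int \<eta> \<longleftrightarrow> \<xi> = \<eta>"
  by (simp add: vec_of_int_def vec_eq_iff)

lemma axis_in_Basis [simp]: "axis i (1::real) \<in> Basis"
  by (simp add: Basis_vec_cart)

lemma Pair_in_Basis: "b \<in> Basis \<Longrightarrow> (b, 0) \<in> Basis" "b \<in> Basis \<Longrightarrow> (0, b) \<in> Basis"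
  by (auto simp: Basis_prod_def)

lemma torus_cell_Pair:
  "(torus_cell :: ('a::euclidean_space \<times> 'b::euclidean_space) set)
     = cbox (0, 0) (\<Sum>b\<in>Basis. (2 * pi) *\<^sub>R b, \<Sum>b\<in>Basis. (2 * pi) *\<^sub>R b)"
proof -
  have "z \<in> torus_cell \<longleftrightarrow> fst z \<in> torus_cell \<and> snd z \<in> torus_cell" for z :: "'a \<times> 'b"
    by (cases z) (simp add: mem_torus_cell Basis_prod_def ball_Un)
  then show ?thesis
    by (auto simp: cbox_Pair_eq torus_cell_def set_eq_iff)
qed

lemma integral_torus_cell_Pair:
  fixes f :: "'a::euclidean_space \<times> 'b::euclidean_space \<Rightarrow> complex"
  assumes "continuous_on UNIV f"
  shows "integral torus_cell f = integral torus_cell (\<lambda>t. integral torus_cell (\<lambda>x. f (t, x)))"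
  unfolding torus_cell_Pair unfolding torus_cell_def
  by (rule integral_prod_continuous) (rule continuous_on_subset[OF assms], simp)

lemma integral_tchar_vec_of_int:
  fixes \<xi> \<eta> :: "int ^ 'N::finite"
  shows "integral torus_cell (\<lambda>x. tchar (vec_of_int \<eta>) x * tchar (- vec_of_int \<xi>) x)
       = (if \<eta> = \<xi> then (2 * of_real pi) ^ CARD('N) else 0)"
proof -
  have "integral torus_cell (tchar (vec_of_int \<eta> - vec_of_int \<xi>))
      = (if \<eta> = \<xi> then (2 * of_real pi) ^ CARD('N) else 0)"
    by (subst integral_tchar) (auto intro: int_lattice_closed)
  moreover have "tchar (vec_of_int \<eta> - vec_of_int \<xi>) = (\<lambda>x. tchar (vec_of_int \<eta>) x * tchar (- vec_of_int \<xi>) x)"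
    by (simp add: fun_eq_iff flip: tchar_add)
  ultimately show ?thesis by simp
qed

text \<open>
  Orthogonality of the characters leaves a single term of the sum that defines the operator.
\<close>

lemma pseudo_diff_tensor:
  fixes u :: "('a::euclidean_space \<times> (real ^ 'N::finite)) functional"
  assumes u: "u \<in> torus_distribution"
    and smooth: "(\<lambda>(t, x). F t * tchar (- vec_of_int \<xi>) x) \<in> torus_smooth"
  shows "pseudo_diff p u (\<lambda>(t, x). F t * tchar (- vec_of_int \<xi>) x)
       = p \<xi> * u (\<lambda>(t, x). F t * tchar (- vec_of_int \<xi>) x)"
proof -
  let ?\<phi> = "\<lambda>(t, x). F t * tchar (- vec_of_int \<xi>) x"
  define \<pi> :: complex where "\<pi> = (2 * of_real pi) ^ CARD('N)"
  have "\<pi> \<noteq> 0" by (simp add: \<pi>_def)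
  have inner: "integral torus_cell (\<lambda>x. exp (\<i> * of_real (x \<bullet> vec_of_int \<eta>)) * ?\<phi> (t, x))
      = (if \<eta> = \<xi> then \<pi> else 0) * F t" for \<eta> t
  proof -
    have "integral torus_cell (\<lambda>x. exp (\<i> * of_real (x \<bullet> vec_of_int \<eta>)) * ?\<phi> (t, x))
        = integral torus_cell (\<lambda>x. F t * (tchar (vec_of_int \<eta>) x * tchar (- vec_of_int \<xi>) x))"
      by (simp add: tchar_def mult_ac)
    then show ?thesis
      by (simp add: integral_tchar_vec_of_int \<pi>_def)
  qed
  have coeff: "partial_fourier u \<eta> (\<lambda>t. integral torus_cell (\<lambda>x. exp (\<i> * of_real (x \<bullet> vec_of_int \<eta>)) * ?\<phi> (t, x)))
      = (if \<eta> = \<xi> then u ?\<phi> else 0)" for \<eta>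
  proof (cases "\<eta> = \<xi>")
    case True
    have "(\<lambda>(t, x). \<pi> * F t * exp (- \<i> * of_real (x \<bullet> vec_of_int \<xi>))) = (\<lambda>z. \<pi> * ?\<phi> z)"
      by (simp add: fun_eq_iff tchar_minus mult.assoc)
    then have "u (\<lambda>(t, x). \<pi> * F t * exp (- \<i> * of_real (x \<bullet> vec_of_int \<xi>))) = \<pi> * u ?\<phi>"
      using torus_distributionD(2)[OF u smooth, of \<pi>] by simp
    moreover have "complex_of_real (1 / (2 * pi) ^ CARD('N)) * \<pi> = 1"
      by (simp add: \<pi>_def)
    ultimately show ?thesis
      unfolding partial_fourier_def inner using True by (simp add: mult.assoc[symmetric])
  next
    case False
    then have "(\<lambda>(t, x). (if \<eta> = \<xi> then \<pi> else 0) * F t * exp (- \<i> * of_real (x \<bullet> vec_of_int \<eta>))) = (\<lambda>z. 0)"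
      by (auto simp: fun_eq_iff)
    then show ?thesis
      unfolding partial_fourier_def inner using False torus_distributionD(3)[OF u] by simp
  qed
  have "pseudo_diff p u ?\<phi> = (\<Sum>\<^sub>\<infinity>\<eta>. p \<eta> * (if \<eta> = \<xi> then u ?\<phi> else 0))"
    unfolding pseudo_diff_def coeff ..
  also have "\<dots> = (\<Sum>\<^sub>\<infinity>\<eta>\<in>{\<xi>}. p \<eta> * (if \<eta> = \<xi> then u ?\<phi> else 0))"
    by (rule infsum_cong_neutral) auto
  finally show ?thesis by simp
qed

text \<open>
  Tested against \<open>F(t) exp (- i x\<cdot>\<xi>)\<close>, the evolution operator becomes the transpose of an
  ordinary differential operator in the variable \<open>t\<^sub>b\<close>.
\<close>

lemma evol_op_tensor:
  fixes u :: "('a::euclidean_space \<times> (real ^ 'N::finite)) functional"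
  assumes u: "u \<in> torus_distribution" and c: "c \<in> torus_smooth" and b: "b \<in> Basis"
    and \<phi>: "\<phi> \<in> torus_smooth" "\<And>t x. \<phi> (t, x) = F t * tchar (- vec_of_int \<xi>) x"
  shows "evol_op b c p u \<phi> = u (\<lambda>z. \<i> * pderiv_dir (b, 0) \<phi> z + p \<xi> * (c (z \<bullet> (b, 0)) * \<phi> z))"
proof -
  have b': "(b, 0) \<in> Basis" by (rule Pair_in_Basis(1)[OF b])
  have c\<phi>: "(\<lambda>z. c (z \<bullet> (b, 0)) * \<phi> z) \<in> torus_smooth"
    by (intro torus_smooth_mult torus_smooth_comp_inner c \<phi>(1) b')
  have d\<phi>: "pderiv_dir (b, 0) \<phi> \<in> torus_smooth" by (rule torus_smooth_pderiv[OF \<phi>(1) b'])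
  have eq: "(\<lambda>z. c (z \<bullet> (b, 0)) * \<phi> z) = (\<lambda>(t, x). (c (t \<bullet> b) * F t) * tchar (- vec_of_int \<xi>) x)"
    by (simp add: fun_eq_iff \<phi>(2))
  have eq': "(\<lambda>z. (case z of (t, x) \<Rightarrow> c (t \<bullet> b)) * \<phi> z) = (\<lambda>z. c (z \<bullet> (b, 0)) * \<phi> z)"
    by (simp add: fun_eq_iff)
  have "evol_op b c p u \<phi> = - u (\<lambda>z. inverse \<i> * pderiv_dir (b, 0) \<phi> z) + p \<xi> * u (\<lambda>z. c (z \<bullet> (b, 0)) * \<phi> z)"
    using pseudo_diff_tensor[OF u c\<phi>[unfolded eq], of p, folded eq]
    by (simp add: evol_op_def dist_D_def dist_mult_def eq')
  also have "\<dots> = u (\<lambda>z. \<i> * pderiv_dir (b, 0) \<phi> z) + u (\<lambda>z. p \<xi> * (c (z \<bullet> (b, 0)) * \<phi> z))"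
    by (simp only: torus_distributionD(2)[OF u d\<phi>] torus_distributionD(2)[OF u c\<phi>]) simp
  also have "\<dots> = u (\<lambda>z. \<i> * pderiv_dir (b, 0) \<phi> z + p \<xi> * (c (z \<bullet> (b, 0)) * \<phi> z))"
    by (rule torus_distributionD(1)[OF u, symmetric]) (intro torus_smooth_cmult d\<phi> c\<phi>)+
  finally show ?thesis .
qed

section \<open>Sums of characters and the averaged operator\<close>

text \<open>
  The distribution \<open>\<Sum>\<^sub>\<xi> exp (i z\<cdot>\<nu>(\<xi>))\<close>.
\<close>

definition char_sum :: "'i set \<Rightarrow> ('i \<Rightarrow> 'a::euclidean_space) \<Rightarrow> 'a functional" where
  "char_sum E \<nu> \<phi> = (\<Sum>\<^sub>\<infinity>\<xi>\<in>E. integral torus_cell (\<lambda>z. \<phi> z * tchar (\<nu> \<xi>) z))"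

lemma rapid_integral_tchar:
  fixes \<nu> :: "'i \<Rightarrow> 'b::euclidean_space"
  assumes \<nu>: "inj_on \<nu> E" "\<nu> ` E \<subseteq> int_lattice" and \<phi>: "\<phi> \<in> torus_smooth"
  shows "rapid E \<nu> (\<lambda>\<xi>. integral torus_cell (\<lambda>z. \<phi> z * tchar (\<nu> \<xi>) z))"
proof (rule rapidI[OF \<nu>])
  fix K
  have "(1 + norm (\<nu> \<xi>)) ^ K * norm (integral torus_cell (\<lambda>z. \<phi> z * tchar (\<nu> \<xi>) z))
      \<le> (1 + real DIM('b)) ^ K * (2 * pi) ^ DIM('b) * Ck_norm K \<phi>" if "\<xi> \<in> E" for \<xi>
    using that \<nu>(2) by (intro fourier_decay[OF \<phi>]) auto
  then show "\<exists>C. \<forall>\<xi>\<in>E. norm (integral torus_cell (\<lambda>z. \<phi> z * tchar (\<nu> \<xi>) z)) * (1 + norm (\<nu> \<xi>)) ^ K \<le> C"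
    unfolding mult.commute[of "norm (integral _ _)"] by blast
qed

lemma char_sum_distribution:
  fixes \<nu> :: "'i \<Rightarrow> 'a::euclidean_space"
  assumes \<nu>: "inj_on \<nu> E" "\<nu> ` E \<subseteq> int_lattice"
  shows "char_sum E \<nu> \<in> torus_distribution"
proof -
  define K where "K = 2 * DIM('a)"
  define A where "A = (1 + real DIM('a)) ^ K * (2 * pi) ^ DIM('a)"
  have "(\<lambda>\<zeta>. inverse ((1 + norm \<zeta>) ^ K)) summable_on \<nu> ` E"
    unfolding K_def by (rule summable_on_subset_banach[OF int_lattice_summable \<nu>(2)])
  then have S: "(\<lambda>\<xi>. inverse ((1 + norm (\<nu> \<xi>)) ^ K)) summable_on E"
    unfolding summable_on_reindex[OF \<nu>(1)] by (simp add: o_def)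
  have sm: "(\<lambda>\<xi>. integral torus_cell (\<lambda>z. \<phi> z * tchar (\<nu> \<xi>) z)) summable_on E"
    if "\<phi> \<in> torus_smooth" for \<phi>
    by (rule abs_summable_summable[OF rapid_norm_summable[OF rapid_integral_tchar[OF \<nu> that]]])
  have bnd: "norm (char_sum E \<nu> \<phi>) \<le> (A * (\<Sum>\<^sub>\<infinity>\<xi>\<in>E. inverse ((1 + norm (\<nu> \<xi>)) ^ K))) * Ck_norm K \<phi>"
    if \<phi>: "\<phi> \<in> torus_smooth" for \<phi>
  proof -
    have "norm (char_sum E \<nu> \<phi>) \<le> (\<Sum>\<^sub>\<infinity>\<xi>\<in>E. (A * Ck_norm K \<phi>) * inverse ((1 + norm (\<nu> \<xi>)) ^ K))"
      unfolding char_sum_def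
    proof (rule norm_infsum_dominated(1)[OF summable_on_cmult_right[OF S]])
      fix \<xi> assume "\<xi> \<in> E"
      then have "(1 + norm (\<nu> \<xi>)) ^ K * norm (integral torus_cell (\<lambda>z. \<phi> z * tchar (\<nu> \<xi>) z)) \<le> A * Ck_norm K \<phi>"
        using fourier_decay[OF \<phi>, of "\<nu> \<xi>" K] \<nu>(2) by (auto simp: A_def)
      moreover have "(1 + norm (\<nu> \<xi>)) ^ K > 0" by (simp add: add_pos_nonneg)
      ultimately show "norm (integral torus_cell (\<lambda>z. \<phi> z * tchar (\<nu> \<xi>) z))
          \<le> (A * Ck_norm K \<phi>) * inverse ((1 + norm (\<nu> \<xi>)) ^ K)"
        by (simp add: field_simps)
    qed
    also have "\<dots> = (A * Ck_norm K \<phi>) * (\<Sum>\<^sub>\<infinity>\<xi>\<in>E. inverse ((1 + norm (\<nu> \<xi>)) ^ K))"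
      by (rule infsum_cmult_right) (rule S)
    finally show ?thesis by (simp add: mult_ac)
  qed
  have add: "char_sum E \<nu> (\<lambda>z. \<phi> z + \<psi> z) = char_sum E \<nu> \<phi> + char_sum E \<nu> \<psi>"
    if \<phi>: "\<phi> \<in> torus_smooth" and \<psi>: "\<psi> \<in> torus_smooth" for \<phi> \<psi>
  proof -
    have "integral torus_cell (\<lambda>z. (\<phi> z + \<psi> z) * tchar (\<nu> \<xi>) z)
        = integral torus_cell (\<lambda>z. \<phi> z * tchar (\<nu> \<xi>) z) + integral torus_cell (\<lambda>z. \<psi> z * tchar (\<nu> \<xi>) z)"
      if "\<xi> \<in> E" for \<xi>
      unfolding distrib_right using that \<nu>(2)
      by (intro integral_add integrable_torus_cell torus_smooth_mult torus_smooth_tchar \<phi> \<psi>) auto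
    then show ?thesis
      unfolding char_sum_def
      by (subst infsum_add[OF sm[OF \<phi>] sm[OF \<psi>], symmetric]) (rule infsum_cong)
  qed
  have "char_sum E \<nu> (\<lambda>z. a * \<phi> z) = a * char_sum E \<nu> \<phi>" for a \<phi>
    unfolding char_sum_def by (subst infsum_cmult_right'[symmetric]) (simp add: mult.assoc)
  then show ?thesis
    unfolding torus_distribution_def using add bnd by blast
qed

lemma char_sum_tchar:
  fixes \<nu> :: "'i \<Rightarrow> 'a::euclidean_space"
  assumes \<nu>: "inj_on \<nu> E" "\<nu> ` E \<subseteq> int_lattice" and \<eta>: "\<eta> \<in> E"
  shows "char_sum E \<nu> (tchar (- \<nu> \<eta>)) = (2 * of_real pi) ^ DIM('a)"
proof -
  have "integral torus_cell (\<lambda>z. tchar (- \<nu> \<eta>) z * tchar (\<nu> \<xi>) z) = (if \<xi> = \<eta> then (2 * of_real pi) ^ DIM('a) else 0)"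
    if \<xi>: "\<xi> \<in> E" for \<xi>
  proof -
    have "\<nu> \<xi> - \<nu> \<eta> \<in> int_lattice" using \<nu>(2) \<xi> \<eta> by (intro int_lattice_closed) auto
    moreover have "(\<lambda>z. tchar (- \<nu> \<eta>) z * tchar (\<nu> \<xi>) z) = tchar (\<nu> \<xi> - \<nu> \<eta>)"
      by (simp add: fun_eq_iff flip: tchar_add)
    moreover have "\<nu> \<xi> = \<nu> \<eta> \<longleftrightarrow> \<xi> = \<eta>" using \<nu>(1) \<xi> \<eta> by (auto dest: inj_onD)
    ultimately show ?thesis by (simp add: integral_tchar)
  qed
  then have "char_sum E \<nu> (tchar (- \<nu> \<eta>)) = (\<Sum>\<^sub>\<infinity>\<xi>\<in>E. if \<xi> = \<eta> then (2 * of_real pi) ^ DIM('a) else 0)"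
    unfolding char_sum_def by (rule infsum_cong)
  also have "\<dots> = (\<Sum>\<^sub>\<infinity>\<xi>\<in>{\<eta>}. if \<xi> = \<eta> then (2 * of_real pi) ^ DIM('a) else 0)"
    by (rule infsum_cong_neutral) (use \<eta> in auto)
  finally show ?thesis by simp
qed

text \<open>
  The coefficients at the frequencies \<open>\<nu>(\<xi>)\<close> all have the same modulus, whereas those of a smooth
  function tend to zero.
\<close>

lemma char_sum_not_smooth:
  fixes \<nu> :: "'i \<Rightarrow> 'a::euclidean_space"
  assumes \<nu>: "inj_on \<nu> E" "\<nu> ` E \<subseteq> int_lattice"
    and unb: "\<And>r. \<exists>\<xi>\<in>E. norm (\<nu> \<xi>) > r"
  shows "\<not> smooth_distribution (char_sum E \<nu>)"
proof
  assume "smooth_distribution (char_sum E \<nu>)"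
  then obtain f where f: "f \<in> torus_smooth"
    and eq: "\<And>\<phi>. \<phi> \<in> torus_smooth \<Longrightarrow> char_sum E \<nu> \<phi> = integral torus_cell (\<lambda>z. f z * \<phi> z)"
    unfolding smooth_distribution_def by blast
  define B where "B = (1 + real DIM('a)) ^ 1 * (2 * pi) ^ DIM('a) * Ck_norm 1 f"
  define P where "P = (2 * pi) ^ DIM('a)"
  have P: "P > 0" by (simp add: P_def)
  obtain \<eta> where \<eta>: "\<eta> \<in> E" "norm (\<nu> \<eta>) > B / P" using unb by blast
  have "(1 + norm (- \<nu> \<eta>)) ^ 1 * norm (integral torus_cell (\<lambda>z. f z * tchar (- \<nu> \<eta>) z)) \<le> B"
    unfolding B_def using \<eta>(1) \<nu>(2) by (intro fourier_decay f) auto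
  moreover have "integral torus_cell (\<lambda>z. f z * tchar (- \<nu> \<eta>) z) = (2 * of_real pi) ^ DIM('a)"
    using eq[of "tchar (- \<nu> \<eta>)"] char_sum_tchar[OF \<nu> \<eta>(1)] \<eta>(1) \<nu>(2) 
    by (auto simp: torus_smooth_tchar)
  moreover have "norm ((2 * complex_of_real pi) ^ DIM('a)) = P"
    by (simp add: norm_power norm_mult P_def)
  ultimately have "(1 + norm (\<nu> \<eta>)) * P \<le> B" by simp
  then show False
    using \<eta>(2) P by (simp add: field_simps)
qed

lemma char_sum_tensor:
  fixes T :: "int ^ 'N::finite \<Rightarrow> 'a::euclidean_space"
  assumes F: "continuous_on UNIV F"
  shows "char_sum E (\<lambda>\<xi>. (T \<xi>, vec_of_int \<xi>)) (\<lambda>(t, x). F t * exp (- \<i> * of_real (x \<bullet> vec_of_int \<eta>)))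
       = (if \<eta> \<in> E then (2 * of_real pi) ^ CARD('N) * integral torus_cell (\<lambda>t. F t * tchar (T \<eta>) t) else 0)"
proof -
  have "integral torus_cell (\<lambda>z. (\<lambda>(t, x). F t * exp (- \<i> * of_real (x \<bullet> vec_of_int \<eta>))) z * tchar (T \<xi>, vec_of_int \<xi>) z)
      = (if \<xi> = \<eta> then (2 * of_real pi) ^ CARD('N) * integral torus_cell (\<lambda>t. F t * tchar (T \<eta>) t) else 0)"
    (is "integral _ ?f = _") for \<xi>
  proof -
    have f: "?f (t, x) = (F t * tchar (T \<xi>) t) * (tchar (vec_of_int \<xi>) x * tchar (- vec_of_int \<eta>) x)" for t x
      by (simp add: tchar_Pair tchar_minus mult_ac)
    have f': "?f = (\<lambda>z. F (fst z) * tchar (- vec_of_int \<eta>) (snd z) * tchar (T \<xi>, vec_of_int \<xi>) z)"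
      by (simp add: fun_eq_iff tchar_minus)
    have "continuous_on UNIV ?f"
      unfolding f' by (intro continuous_intros continuous_on_compose2[OF F] smooth_continuous_on[OF smooth_tchar]
          continuous_on_compose2[OF smooth_continuous_on[OF smooth_tchar, of UNIV]]) auto
    then have "integral torus_cell ?f = integral torus_cell (\<lambda>t. integral torus_cell (\<lambda>x. ?f (t, x)))"
      by (rule integral_torus_cell_Pair)
    also have "\<dots> = integral torus_cell (\<lambda>t. (F t * tchar (T \<xi>) t) * (if \<xi> = \<eta> then (2 * of_real pi) ^ CARD('N) else 0))"
      unfolding f by (simp add: integral_tchar_vec_of_int)
    finally show ?thesis by (simp add: mult.commute)
  qed
  then have "char_sum E (\<lambda>\<xi>. (T \<xi>, vec_of_int \<xi>)) (\<lambda>(t, x). F t * exp (- \<i> * of_real (x \<bullet> vec_of_int \<eta>)))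
      = (\<Sum>\<^sub>\<infinity>\<xi>\<in>E. if \<xi> = \<eta> then (2 * of_real pi) ^ CARD('N) * integral torus_cell (\<lambda>t. F t * tchar (T \<eta>) t) else 0)"
    unfolding char_sum_def by simp
  also have "\<dots> = (\<Sum>\<^sub>\<infinity>\<xi>\<in>E \<inter> {\<eta>}. if \<xi> = \<eta> then (2 * of_real pi) ^ CARD('N) * integral torus_cell (\<lambda>t. F t * tchar (T \<eta>) t) else 0)"
    by (rule infsum_cong_neutral) auto
  finally show ?thesis by (cases "\<eta> \<in> E") auto
qed

text \<open>
  Each space frequency \<open>\<xi>\<close> occurs at most once in the sum of characters, so the operator multiplies
  the corresponding character by \<open>p(\<xi>)\<close>. The inner integral over \<open>x\<close> and the outer one over \<open>t\<close> are
  put together by the theorem of Fubini.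
\<close>

lemma pseudo_diff_char_sum:
  fixes T :: "int ^ 'N::finite \<Rightarrow> 'a::euclidean_space"
  assumes \<phi>: "\<phi> \<in> torus_smooth"
  shows "pseudo_diff p (char_sum E (\<lambda>\<xi>. (T \<xi>, vec_of_int \<xi>))) \<phi>
       = (\<Sum>\<^sub>\<infinity>\<xi>\<in>E. p \<xi> * integral torus_cell (\<lambda>z. \<phi> z * tchar (T \<xi>, vec_of_int \<xi>) z))"
proof -
  define \<Phi> where "\<Phi> \<eta> t = integral torus_cell (\<lambda>x. exp (\<i> * of_real (x \<bullet> vec_of_int \<eta>)) * \<phi> (t, x))" for \<eta> t
  have cont_\<phi>: "continuous_on A \<phi>" for A by (rule torus_smooth_continuous_on[OF \<phi>])
  have cont: "continuous_on UNIV (\<Phi> \<eta>)" for \<eta>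
    unfolding \<Phi>_def torus_cell_def
    by (rule integral_continuous_on_param)
       (auto simp: split_beta intro!: continuous_intros continuous_on_compose2[OF cont_\<phi>[of UNIV]])
  have \<Phi>: "integral torus_cell (\<lambda>t. \<Phi> \<eta> t * tchar (T \<eta>) t) = integral torus_cell (\<lambda>z. \<phi> z * tchar (T \<eta>, vec_of_int \<eta>) z)" for \<eta>
  proof -
    have iter: "integral torus_cell (\<lambda>z. \<phi> z * tchar (T \<eta>, vec_of_int \<eta>) z)
        = integral torus_cell (\<lambda>t. integral torus_cell (\<lambda>x. \<phi> (t, x) * tchar (T \<eta>, vec_of_int \<eta>) (t, x)))"
      by (intro integral_torus_cell_Pair continuous_intros cont_\<phi> smooth_continuous_on smooth_tchar)
    have "\<phi> (t, x) * tchar (T \<eta>, vec_of_int \<eta>) (t, x)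
        = exp (\<i> * of_real (x \<bullet> vec_of_int \<eta>)) * \<phi> (t, x) * tchar (T \<eta>) t" for t x
      by (simp add: tchar_Pair) (simp add: tchar_def)
    then show ?thesis by (simp only: iter \<Phi>_def integral_mult_left)
  qed
  have "partial_fourier (char_sum E (\<lambda>\<xi>. (T \<xi>, vec_of_int \<xi>))) \<eta> (\<Phi> \<eta>)
      = (if \<eta> \<in> E then integral torus_cell (\<lambda>z. \<phi> z * tchar (T \<eta>, vec_of_int \<eta>) z) else 0)" for \<eta>
    unfolding partial_fourier_def char_sum_tensor[OF cont] \<Phi>
    by (simp add: power_mult_distrib)
  then have "pseudo_diff p (char_sum E (\<lambda>\<xi>. (T \<xi>, vec_of_int \<xi>))) \<phi>
      = (\<Sum>\<^sub>\<infinity>\<eta>. p \<eta> * (if \<eta> \<in> E then integral torus_cell (\<lambda>z. \<phi> z * tchar (T \<eta>, vec_of_int \<eta>) z) else 0))"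
    unfolding pseudo_diff_def \<Phi>_def[symmetric] by simp
  also have "\<dots> = (\<Sum>\<^sub>\<infinity>\<eta>\<in>E. p \<eta> * integral torus_cell (\<lambda>z. \<phi> z * tchar (T \<eta>, vec_of_int \<eta>) z))"
    by (rule infsum_cong_neutral) auto
  finally show ?thesis .
qed

text \<open>
  With constant coefficients, the operator multiplies the characters by its symbol. The bound on \<open>p\<close>
  ensures that the two parts of the operator give summable families separately.
\<close>

lemma evol_op_char_sum:
  fixes T :: "int ^ 'N::finite \<Rightarrow> 'a::euclidean_space"
  defines "\<nu> \<equiv> \<lambda>\<xi>. (T \<xi>, vec_of_int \<xi>)"
  assumes T: "\<And>\<xi>. T \<xi> \<in> int_lattice" and b: "b \<in> Basis"
    and p: "\<And>\<xi>. norm (p \<xi>) \<le> C * (1 + norm (vec_of_int \<xi>)) ^ m" and \<phi>: "\<phi> \<in> torus_smooth"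
  shows "evol_op b (\<lambda>_. \<kappa>) p (char_sum E \<nu>) \<phi>
       = (\<Sum>\<^sub>\<infinity>\<xi>\<in>E. (of_real (b \<bullet> T \<xi>) + \<kappa> * p \<xi>) * integral torus_cell (\<lambda>z. \<phi> z * tchar (\<nu> \<xi>) z))"
proof -
  define I where "I \<xi> = integral torus_cell (\<lambda>z. \<phi> z * tchar (\<nu> \<xi>) z)" for \<xi>
  have b': "(b, 0) \<in> Basis" by (rule Pair_in_Basis(1)[OF b])
  have \<nu>: "inj_on \<nu> E" "\<nu> ` E \<subseteq> int_lattice"
    using T by (auto simp: \<nu>_def inj_on_def)
  have rI: "rapid E \<nu> I" unfolding I_def by (rule rapid_integral_tchar[OF \<nu> \<phi>])
  have C: "C \<ge> 0"
  proof -
    have "0 \<le> C * (1 + norm (vec_of_int (0 :: int ^ 'N))) ^ m" by (rule order_trans[OF norm_ge_zero p])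
    moreover have "0 < (1 + norm (vec_of_int (0 :: int ^ 'N))) ^ m" by (simp add: add_pos_nonneg)
    ultimately show ?thesis by (simp add: zero_le_mult_iff)
  qed
  define D where "D = C + 1"
  have D: "D > 0" "C \<le> D" using C by (auto simp: D_def)
  have "rapid E \<nu> (\<lambda>\<xi>. p \<xi> * I \<xi> / of_real D)"
  proof (rule rapid_dominated[OF rI, of _ m])
    fix \<xi>
    have "norm (p \<xi>) \<le> C * (1 + norm (vec_of_int \<xi>)) ^ m" by (rule p)
    also have "\<dots> \<le> D * (1 + norm (\<nu> \<xi>)) ^ m"
      using D norm_snd_le[of "vec_of_int \<xi>" "T \<xi>"] by (intro mult_mono power_mono) (auto simp: \<nu>_def)
    finally have "norm (p \<xi>) / D \<le> (1 + norm (\<nu> \<xi>)) ^ m"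
      using D by (simp add: field_simps)
    from mult_left_mono[OF this, of "norm (I \<xi>)"]
    show "norm (p \<xi> * I \<xi> / of_real D) \<le> norm (I \<xi>) * (1 + norm (\<nu> \<xi>)) ^ m"
      using D by (simp add: norm_mult norm_divide mult_ac)
  qed
  then have "(\<lambda>\<xi>. p \<xi> * I \<xi> / of_real D) summable_on E"
    by (rule abs_summable_summable[OF rapid_norm_summable])
  from summable_on_cmult_right[OF this, of "of_real D"]
  have sp: "(\<lambda>\<xi>. p \<xi> * I \<xi>) summable_on E"
    using D by simp
  have d: "integral torus_cell (\<lambda>z. (inverse \<i> * pderiv_dir (b, 0) \<phi> z) * tchar (\<nu> \<xi>) z) = - (of_real (b \<bullet> T \<xi>) * I \<xi>)" for \<xi>
  proof -
    have "integral torus_cell (\<lambda>z. (inverse \<i> * pderiv_dir (b, 0) \<phi> z) * tchar (\<nu> \<xi>) z)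
        = inverse \<i> * integral torus_cell (\<lambda>z. pderiv_dir (b, 0) \<phi> z * tchar (\<nu> \<xi>) z)"
      unfolding mult.assoc by simp
    also have "integral torus_cell (\<lambda>z. pderiv_dir (b, 0) \<phi> z * tchar (\<nu> \<xi>) z)
        = - \<i> * of_real ((b, 0) \<bullet> \<nu> \<xi>) * I \<xi>"
      unfolding I_def using T by (intro integral_pderiv_tchar \<phi> b') (simp add: \<nu>_def)
    finally show ?thesis unfolding \<nu>_def by (simp add: mult.assoc)
  qed
  have "(\<lambda>\<xi>. - (of_real (b \<bullet> T \<xi>) * I \<xi>)) summable_on E"
    unfolding d[symmetric]
    by (rule abs_summable_summable[OF rapid_norm_summable[OF rapid_integral_tchar[OF \<nu>]]])
       (intro torus_smooth_cmult torus_smooth_pderiv \<phi> b')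
  then have sT: "(\<lambda>\<xi>. of_real (b \<bullet> T \<xi>) * I \<xi>) summable_on E"
    by (simp add: summable_on_uminus)
  have "dist_D (b, 0) (char_sum E \<nu>) \<phi> = (\<Sum>\<^sub>\<infinity>\<xi>\<in>E. of_real (b \<bullet> T \<xi>) * I \<xi>)"
    unfolding dist_D_def char_sum_def d infsum_uminus by simp
  moreover have "dist_mult (\<lambda>(t, x). \<kappa>) (pseudo_diff p (char_sum E \<nu>)) \<phi> = (\<Sum>\<^sub>\<infinity>\<xi>\<in>E. \<kappa> * (p \<xi> * I \<xi>))"
    using pseudo_diff_char_sum[OF torus_smooth_cmult[OF \<phi>, of \<kappa>], of p E T]
    by (simp add: dist_mult_def \<nu>_def I_def mult.assoc mult.left_commute[of _ \<kappa>])
  ultimately have "evol_op b (\<lambda>_. \<kappa>) p (char_sum E \<nu>) \<phi>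
      = (\<Sum>\<^sub>\<infinity>\<xi>\<in>E. of_real (b \<bullet> T \<xi>) * I \<xi>) + (\<Sum>\<^sub>\<infinity>\<xi>\<in>E. \<kappa> * (p \<xi> * I \<xi>))"
    by (simp add: evol_op_def)
  also have "\<dots> = (\<Sum>\<^sub>\<infinity>\<xi>\<in>E. of_real (b \<bullet> T \<xi>) * I \<xi> + \<kappa> * (p \<xi> * I \<xi>))"
    by (rule infsum_add[symmetric, OF sT summable_on_cmult_right]) (rule sp)
  finally show ?thesis by (simp add: I_def algebra_simps)
qed

lemma evol_op_char_sum_smooth:
  fixes T :: "int ^ 'N::finite \<Rightarrow> 'a::euclidean_space"
  defines "\<nu> \<equiv> \<lambda>\<xi>. (T \<xi>, vec_of_int \<xi>)"
  assumes T: "\<And>\<xi>. T \<xi> \<in> int_lattice" and b: "b \<in> Basis"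
    and p: "\<And>\<xi>. norm (p \<xi>) \<le> C * (1 + norm (vec_of_int \<xi>)) ^ m"
    and r: "rapid E \<nu> (\<lambda>\<xi>. of_real (b \<bullet> T \<xi>) + \<kappa> * p \<xi>)"
  shows "smooth_distribution (evol_op b (\<lambda>_. \<kappa>) p (char_sum E \<nu>))"
  unfolding smooth_distribution_def
proof (intro bexI ballI)
  let ?f = "trig_series E \<nu> (\<lambda>\<xi>. of_real (b \<bullet> T \<xi>) + \<kappa> * p \<xi>)"
  have \<nu>: "\<nu> \<xi> \<in> int_lattice" for \<xi> using T by (simp add: \<nu>_def)
  show "?f \<in> torus_smooth"
    by (rule torus_smooth_trig_series[OF r \<nu>])
  fix \<phi> :: "'a \<times> (real ^ 'N) \<Rightarrow> complex" assume \<phi>: "\<phi> \<in> torus_smooth"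
  have "evol_op b (\<lambda>_. \<kappa>) p (char_sum E \<nu>) \<phi>
       = (\<Sum>\<^sub>\<infinity>\<xi>\<in>E. (of_real (b \<bullet> T \<xi>) + \<kappa> * p \<xi>) * integral torus_cell (\<lambda>z. tchar (\<nu> \<xi>) z * \<phi> z))"
    unfolding \<nu>_def by (subst evol_op_char_sum[OF T b p \<phi>]) (simp add: mult.commute)
  also have "\<dots> = integral torus_cell (\<lambda>z. ?f z * \<phi> z)"
    by (rule infsumI[OF torus_distribution_trig_series[OF integral_torus_distribution[OF \<phi>] r \<nu>]])
  finally show "evol_op b (\<lambda>_. \<kappa>) p (char_sum E \<nu>) \<phi> = integral torus_cell (\<lambda>z. ?f z * \<phi> z)" .
qed

section \<open>Small divisors\<close>

lemma finite_subset_bound: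
  assumes "finite A"
  shows "\<exists>B::real. \<forall>x\<in>A. f x \<le> B"
  using finite_imageI[OF assms, of f] by (meson bdd_above_finite bdd_above.E image_eqI)

text \<open>
  If the symbol \<open>\<tau> + \<kappa> p(\<xi>)\<close> tended to zero faster than every negative power of \<open>\<parallel>\<xi>\<parallel>\<close> along a
  sequence of frequencies, the sum of the corresponding characters would be a singular distribution with a
  smooth image. Global hypoellipticity therefore bounds the symbol below by a power.
\<close>

theorem hypoelliptic_imp_diophantine:
  fixes p :: "int ^ 'N::finite \<Rightarrow> complex"
  assumes gh: "globally_hypoelliptic {evol_op (1::real) (\<lambda>_. \<kappa>) p}"
    and p: "\<And>\<xi>. norm (p \<xi>) \<le> C * (1 + norm (vec_of_int \<xi>)) ^ m"
  shows "\<exists>M::nat. \<forall>\<xi> \<tau>::int. real M \<le> norm (vec_of_int \<xi>) \<longrightarrow>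
           1 \<le> norm (of_int \<tau> + \<kappa> * p \<xi>) * (1 + norm (vec_of_int \<xi>)) ^ M"
proof (rule ccontr)
  assume "\<not> ?thesis"
  then have "\<forall>M. \<exists>\<xi> \<tau>::int. real M \<le> norm (vec_of_int \<xi>) \<and>
           norm (of_int \<tau> + \<kappa> * p \<xi>) * (1 + norm (vec_of_int \<xi>)) ^ M < 1"
    by (simp add: not_le)
  then obtain \<Xi> and \<Theta> :: "nat \<Rightarrow> int"
    where far: "\<And>M. real M \<le> norm (vec_of_int (\<Xi> M))"
      and small: "\<And>M. norm (of_int (\<Theta> M) + \<kappa> * p (\<Xi> M)) * (1 + norm (vec_of_int (\<Xi> M))) ^ M < 1"
    by metis
  (* A frequency may occur several times in the sequence; ix picks one of its positions, so that
     there is exactly one time frequency for each space frequency. All but finitely many elements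
     of E have a position beyond any given bound. *)
  define E where "E = range \<Xi>"
  define ix where "ix = inv \<Xi>"
  have ix: "\<Xi> (ix \<xi>) = \<xi>" if "\<xi> \<in> E" for \<xi>
    using that by (simp add: E_def ix_def f_inv_into_f)
  define T :: "int ^ 'N \<Rightarrow> real" where "T \<xi> = of_int (\<Theta> (ix \<xi>))" for \<xi>
  define \<nu> where "\<nu> = (\<lambda>\<xi>. (T \<xi>, vec_of_int \<xi>))"
  have T: "T \<xi> \<in> int_lattice" for \<xi> by (simp add: T_def int_lattice_def)
  have \<nu>: "inj_on \<nu> E" "\<nu> ` E \<subseteq> int_lattice"
    using T by (auto simp: \<nu>_def inj_on_def)
  define d where "d \<xi> = of_real (1 \<bullet> T \<xi>) + \<kappa> * p \<xi>" for \<xi>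
  have d: "norm (d \<xi>) * (1 + norm (vec_of_int \<xi>)) ^ ix \<xi> < 1" if "\<xi> \<in> E" for \<xi>
    using small[of "ix \<xi>"] by (simp add: ix[OF that] d_def T_def)
  define A where "A = 3 + norm \<kappa> * \<bar>C\<bar>"
  (* The time frequency is close to - \<kappa> p(\<xi>), hence of polynomial size, so that decay in \<xi>
     is decay in the full frequency. *)
  have \<nu>_le: "1 + norm (\<nu> \<xi>) \<le> A * (1 + norm (vec_of_int \<xi>)) ^ (m + 1)" if \<xi>: "\<xi> \<in> E" for \<xi>
  proof -
    define v where "v = 1 + norm (vec_of_int \<xi>)"
    have v: "v \<ge> 1" "1 \<le> v ^ (m + 1)" "v \<le> v ^ (m + 1)" "v ^ m \<le> v ^ (m + 1)"
      using power_increasing[of 1 "m + 1" v] power_increasing[of m "m + 1" v]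
      by (auto simp: v_def simp del: power_Suc)
    have "norm (d \<xi>) * 1 \<le> norm (d \<xi>) * v ^ ix \<xi>"
      using v(1) by (intro mult_left_mono) auto
    then have "norm (d \<xi>) \<le> 1" using d[OF \<xi>] by (simp add: v_def)
    have "\<bar>T \<xi>\<bar> = norm (d \<xi> - \<kappa> * p \<xi>)" by (simp add: d_def)
    also have "\<dots> \<le> norm (d \<xi>) + norm \<kappa> * norm (p \<xi>)"
      by (metis norm_triangle_ineq4 norm_mult)
    also have "\<dots> \<le> 1 + norm \<kappa> * (\<bar>C\<bar> * v ^ m)"
    proof (intro add_mono mult_left_mono)
      have "norm (p \<xi>) \<le> C * v ^ m" using p[of \<xi>] by (simp add: v_def)
      also have "\<dots> \<le> \<bar>C\<bar> * v ^ m" using v(1) by (intro mult_right_mono) auto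
      finally show "norm (p \<xi>) \<le> \<bar>C\<bar> * v ^ m" .
    qed (use \<open>norm (d \<xi>) \<le> 1\<close> in auto)
    finally have "\<bar>T \<xi>\<bar> \<le> 1 + norm \<kappa> * \<bar>C\<bar> * v ^ m" by simp
    also have "\<dots> \<le> v ^ (m + 1) + norm \<kappa> * \<bar>C\<bar> * v ^ (m + 1)"
      using v by (intro add_mono mult_left_mono) auto
    finally have 1: "\<bar>T \<xi>\<bar> \<le> v ^ (m + 1) + norm \<kappa> * \<bar>C\<bar> * v ^ (m + 1)" .
    have "norm (\<nu> \<xi>) \<le> norm (T \<xi>) + norm (vec_of_int \<xi>)"
      unfolding \<nu>_def by (rule norm_Pair_le)
    then have "1 + norm (\<nu> \<xi>) \<le> \<bar>T \<xi>\<bar> + v" by (simp add: v_def)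
    also have "\<dots> \<le> A * v ^ (m + 1)"
      using 1 v(2,3) unfolding A_def distrib_right by linarith
    finally show ?thesis by (simp add: v_def)
  qed
  have rap: "rapid E \<nu> d"
  proof (rule rapidI[OF \<nu>])
    fix K
    define n where "n = (m + 1) * K"
    have "finite (\<Xi> ` {..<n})" by simp
    from finite_subset_bound[OF this, of "\<lambda>\<xi>. norm (d \<xi>) * (1 + norm (\<nu> \<xi>)) ^ K"]
    obtain B where B: "\<And>\<xi>. \<xi> \<in> \<Xi> ` {..<n} \<Longrightarrow> norm (d \<xi>) * (1 + norm (\<nu> \<xi>)) ^ K \<le> B" by blast
    have A: "A \<ge> 0" by (simp add: A_def)
    have "norm (d \<xi>) * (1 + norm (\<nu> \<xi>)) ^ K \<le> max B (A ^ K)" if \<xi>: "\<xi> \<in> E" for \<xi>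
    proof (cases "ix \<xi> < n")
      case True
      then have "\<xi> \<in> \<Xi> ` {..<n}" using ix[OF \<xi>] by (metis imageI lessThan_iff)
      then show ?thesis using B by fastforce
    next
      case False
      define v where "v = 1 + norm (vec_of_int \<xi>)"
      have v: "v \<ge> 1" by (simp add: v_def)
      have "(1 + norm (\<nu> \<xi>)) ^ K \<le> (A * v ^ (m + 1)) ^ K"
        using \<nu>_le[OF \<xi>] by (intro power_mono) (auto simp: v_def)
      also have "\<dots> = A ^ K * v ^ n" by (simp only: power_mult_distrib n_def power_mult)
      also have "\<dots> \<le> A ^ K * v ^ ix \<xi>"
        using False v A by (intro mult_left_mono power_increasing) auto
      finally have "norm (d \<xi>) * (1 + norm (\<nu> \<xi>)) ^ K \<le> norm (d \<xi>) * (A ^ K * v ^ ix \<xi>)"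
        by (intro mult_left_mono) auto
      also have "\<dots> = A ^ K * (norm (d \<xi>) * v ^ ix \<xi>)" by simp
      also have "\<dots> \<le> A ^ K * 1"
        using d[OF \<xi>] A by (intro mult_left_mono) (auto simp: v_def)
      finally show ?thesis by simp
    qed
    then show "\<exists>B. \<forall>\<xi>\<in>E. norm (d \<xi>) * (1 + norm (\<nu> \<xi>)) ^ K \<le> B" by blast
  qed
  have "\<exists>\<xi>\<in>E. norm (\<nu> \<xi>) > r" for r
  proof -
    obtain M where "real M > r" using reals_Archimedean2 by blast
    moreover have "norm (vec_of_int (\<Xi> M)) \<le> norm (\<nu> (\<Xi> M))"
      using norm_snd_le[of "vec_of_int (\<Xi> M)" "T (\<Xi> M)"] by (simp add: \<nu>_def)
    ultimately have "r < norm (\<nu> (\<Xi> M))" using far[of M] by linarith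
    then show ?thesis unfolding E_def by blast
  qed
  then have "\<not> smooth_distribution (char_sum E \<nu>)" by (rule char_sum_not_smooth[OF \<nu>])
  moreover have "char_sum E \<nu> \<in> torus_distribution" by (rule char_sum_distribution[OF \<nu>])
  moreover have "smooth_distribution (evol_op 1 (\<lambda>_. \<kappa>) p (char_sum E \<nu>))"
    unfolding \<nu>_def
    by (rule evol_op_char_sum_smooth[OF T _ p]) (use rap in \<open>simp_all add: \<nu>_def d_def[abs_def]\<close>)
  ultimately show False
    using gh unfolding globally_hypoelliptic_def by blast
qed

text \<open>
  If \<open>exp (2\<pi>i \<mu>)\<close> is close to \<open>1\<close>, its principal logarithm is small and differs from \<open>2\<pi>i \<mu>\<close> by
  an integer multiple of \<open>2\<pi>i\<close>.
\<close>

lemma exp_minus_one_lower_bound: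
  fixes \<mu> :: complex
  assumes \<delta>: "\<delta> \<le> 1" "\<And>n::int. \<delta> \<le> norm (of_int n + \<mu>)"
  shows "\<delta> / 2 \<le> norm (exp (2 * of_real pi * \<i> * \<mu>) - 1)"
proof (cases "norm (exp (2 * of_real pi * \<i> * \<mu>) - 1) < 1 / 2")
  case True
  define w where "w = exp (2 * of_real pi * \<i> * \<mu>)"
  have "exp (Ln w) = exp (2 * of_real pi * \<i> * \<mu>)" by (simp add: w_def)
  then obtain n :: int where "Ln w = 2 * of_real pi * \<i> * \<mu> + (of_int (2 * n) * pi) * \<i>"
    using exp_eq by blast
  then have "Ln w = (2 * of_real pi * \<i>) * (of_int n + \<mu>)" by (simp add: algebra_simps)
  then have "norm (Ln w) = 2 * pi * norm (of_int n + \<mu>)" by (simp add: norm_mult)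
  moreover have "norm (Ln w) \<le> 2 * norm (w - 1)"
    using norm_Ln_le[of "w - 1"] True by (simp add: w_def)
  moreover have "2 * 1 * \<delta> \<le> 2 * pi * norm (of_int n + \<mu>)"
  proof -
    have "1 * \<delta> \<le> 1 * norm (of_int n + \<mu>)" using \<delta>(2) by simp
    also have "\<dots> \<le> pi * norm (of_int n + \<mu>)" using pi_gt3 by (intro mult_right_mono) auto
    finally show ?thesis by simp
  qed
  ultimately have "\<delta> \<le> norm (w - 1)" by linarith
  moreover have "norm (w - 1) \<ge> 0" by simp
  ultimately have "\<delta> / 2 \<le> norm (w - 1)" by linarith
  then show ?thesis by (simp add: w_def)
next
  case False
  then show ?thesis using \<delta>(1) by simp
qed

section \<open>Periodic solutions of the ordinary differential equation\<close>

lemma norm_diff_le_of_vector_derivative: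
  fixes f :: "real \<Rightarrow> 'b::real_normed_vector"
  assumes "a \<le> b" and f: "\<And>x. (f has_vector_derivative f' x) (at x)"
    and bnd: "\<And>x. a < x \<Longrightarrow> x < b \<Longrightarrow> norm (f' x) \<le> K"
  shows "norm (f b - f a) \<le> K * (b - a)"
proof (cases "a = b")
  case False
  have "norm (f b - f a) \<le> K * b - K * a"
  proof (rule differentiable_bound_general[where f = f and f' = f' and \<phi>' = "\<lambda>_. K"])
    show "continuous_on {a..b} f"
      using f by (intro continuous_at_imp_continuous_on ballI has_vector_derivative_continuous)
    show "((*) K has_vector_derivative K) (at x)" for x
      by (auto intro!: derivative_eq_intros)
  qed (use assms False in \<open>auto intro!: continuous_intros\<close>)
  then show ?thesis by (simp add: right_diff_distrib)
qed simp

lemma vector_derivative_zero_imp_eq: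
  fixes f :: "real \<Rightarrow> 'b::real_normed_vector"
  assumes "\<And>x. (f has_vector_derivative 0) (at x)"
  shows "f a = f b"
  using norm_diff_le_of_vector_derivative[of a b f "\<lambda>_. 0" 0]
    norm_diff_le_of_vector_derivative[of b a f "\<lambda>_. 0" 0] assms
  by (cases "a \<le> b") auto

lemma antiderivative_exists:
  fixes f :: "real \<Rightarrow> complex"
  assumes f: "continuous_on UNIV f"
  shows "\<exists>F. \<forall>t. (F has_vector_derivative f t) (at t)"
proof (intro exI allI)
  define F where "F t = integral {0..t} f - integral {t..0} f" for t
  have cont: "continuous_on A f" for A by (rule continuous_on_subset[OF f]) simp
  have int: "f integrable_on {a..b}" for a b by (rule integrable_continuous_real[OF cont])
  fix t :: real
  define R where "R = \<bar>t\<bar> + 1"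
  have empty: "integral {s..0} f = 0" if "0 \<le> s" for s
    using that by (cases "s = 0") auto
  have F: "integral {-R..s} f - integral {-R..0} f = F s" if "s \<in> {-R<..<R}" for s
    using Henstock_Kurzweil_Integration.integral_combine[of "-R" 0 s f]
      Henstock_Kurzweil_Integration.integral_combine[of "-R" s 0 f] that int
    by (cases "0 \<le> s") (auto simp: F_def R_def empty algebra_simps)
  have "((\<lambda>s. integral {-R..s} f) has_vector_derivative f t) (at t within {-R..R})"
    by (rule integral_has_vector_derivative[OF cont]) (auto simp: R_def)
  then have "((\<lambda>s. integral {-R..s} f) has_vector_derivative f t) (at t)"
    by (subst (asm) at_within_interior) (auto simp: R_def)
  then have "((\<lambda>s. integral {-R..s} f - integral {-R..0} f) has_vector_derivative f t) (at t)"
    by (auto intro!: derivative_eq_intros)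
  then show "(F has_vector_derivative f t) (at t)"
    by (rule has_vector_derivative_transform_within_open[where S = "{-R<..<R}"])
       (use F in \<open>auto simp: R_def\<close>)
qed

lemma pderiv_dir_real: "(f has_vector_derivative D) (at t) \<Longrightarrow> pderiv_dir 1 f t = D"
  unfolding has_vector_derivative_def by (drule pderiv_dir_eq[where b = 1]) simp

lemma has_vector_derivative_pderiv:
  fixes f :: "real \<Rightarrow> complex"
  assumes "f differentiable (at t)"
  shows "(f has_vector_derivative pderiv_dir 1 f t) (at t)"
  using assms pderiv_dir_real by (metis vector_derivative_works)

lemma exp_has_vector_derivative:
  fixes C :: "real \<Rightarrow> complex"
  assumes "(C has_vector_derivative c) (at t)"
  shows "((\<lambda>t. exp (k * C t)) has_vector_derivative k * c * exp (k * C t)) (at t)"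
proof -
  have "((\<lambda>t. k * C t) has_vector_derivative k * c) (at t)"
    by (rule has_vector_derivative_mult_right[OF assms])
  from field_vector_diff_chain_at[OF this DERIV_exp] show ?thesis by (simp add: o_def)
qed

text \<open>
  A primitive of a periodic function is periodic up to the increment given by its mean.
\<close>

lemma periodic_primitive:
  fixes c :: "real \<Rightarrow> complex"
  assumes c: "c \<in> torus_smooth"
  obtains C where "\<And>t. (C has_vector_derivative c t) (at t)"
    "\<And>t. C (t + 2 * pi) = C t + 2 * of_real pi * circle_mean c"
proof -
  obtain C where C: "\<And>t. (C has_vector_derivative c t) (at t)"
    using antiderivative_exists[OF torus_smooth_continuous_on[OF c]] by blast
  have per: "c (t + 2 * pi) = c t" for t
    using torus_smoothD(2)[OF c, of 1 t] by simp
  have shift: "((\<lambda>s. C (s + 2 * pi)) has_vector_derivative c t) (at t)" for t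
  proof -
    have "((\<lambda>s. s + 2 * pi) has_vector_derivative 1) (at t)"
      by (auto intro!: derivative_eq_intros)
    from vector_diff_chain_at[OF this C] show ?thesis by (simp add: o_def per)
  qed
  have "((\<lambda>t. C (t + 2 * pi) - C t) has_vector_derivative 0) (at t)" for t
    using has_vector_derivative_diff[OF shift C] by simp
  from vector_derivative_zero_imp_eq[OF this]
  have const: "C (t + 2 * pi) - C t = C (0 + 2 * pi) - C 0" for t .
  have "(c has_integral (C (2 * pi) - C 0)) {0..2 * pi}"
    by (rule fundamental_theorem_of_calculus) (auto intro: has_vector_derivative_at_within C)
  then have "integral {0..2 * pi} c = C (2 * pi) - C 0" by (rule integral_unique)
  then have "2 * of_real pi * circle_mean c = C (2 * pi) - C 0"
    by (simp add: circle_mean_def)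
  then have "C (t + 2 * pi) - C t = 2 * of_real pi * circle_mean c" for t
    using const[of t] by simp
  then have "C (t + 2 * pi) = C t + 2 * of_real pi * circle_mean c" for t
    by (metis add.commute diff_eq_eq)
  with C that show ?thesis by blast
qed

text \<open>
  The initial value is chosen so that the solution closes up after one period; this is possible as
  soon as the monodromy factor \<open>exp (2\<pi>i \<lambda>)\<close>, with \<open>\<lambda>\<close> the mean of the coefficient, is not \<open>1\<close>.
\<close>

lemma periodic_ode_solution:
  fixes c \<rho> :: "real \<Rightarrow> complex"
  assumes c: "c \<in> torus_smooth" and \<rho>: "\<rho> \<in> torus_smooth"
    and w: "exp (2 * of_real pi * \<i> * (circle_mean c * P)) \<noteq> 1"
  obtains \<psi> where "\<psi> \<in> torus_smooth" "\<And>t. \<i> * pderiv_dir 1 \<psi> t + P * (c t * \<psi> t) = \<rho> t"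
proof -
  obtain C where C: "\<And>t. (C has_vector_derivative c t) (at t)"
    and C_per: "\<And>t. C (t + 2 * pi) = C t + 2 * of_real pi * circle_mean c"
    using periodic_primitive[OF c] by blast
  define w where "w = exp (2 * of_real pi * \<i> * (circle_mean c * P))"
  have w0: "w \<noteq> 0" "w \<noteq> 1" using w by (auto simp: w_def)
  define E where "E t = exp (\<i> * P * C t)" for t
  define E' where "E' t = exp (- (\<i> * P) * C t)" for t
  have E: "(E has_vector_derivative \<i> * P * c t * E t) (at t)"
    and E': "(E' has_vector_derivative - (\<i> * P) * c t * E' t) (at t)" for t
    unfolding E_def E'_def by (rule exp_has_vector_derivative[OF C])+
  have EE': "E t * E' t = 1" for t by (simp add: E_def E'_def flip: exp_add)
  have E_per: "E (t + 2 * pi) = w * E t" and E'_per: "E' (t + 2 * pi) = E' t / w" for t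
  proof -
    have "\<i> * P * C (t + 2 * pi) = 2 * of_real pi * \<i> * (circle_mean c * P) + \<i> * P * C t"
      unfolding C_per by (simp add: algebra_simps)
    then show "E (t + 2 * pi) = w * E t" unfolding E_def w_def by (simp only: exp_add)
    have "- (\<i> * P) * C (t + 2 * pi) = - (\<i> * P) * C t - 2 * of_real pi * \<i> * (circle_mean c * P)"
      unfolding C_per by (simp add: algebra_simps)
    then show "E' (t + 2 * pi) = E' t / w" unfolding E'_def w_def by (simp only: exp_diff)
  qed
  have "continuous_on UNIV (\<lambda>t. E' t * \<rho> t)"
    using E' by (intro continuous_intros torus_smooth_continuous_on[OF \<rho>] continuous_at_imp_continuous_on ballI
        has_vector_derivative_continuous)
  then obtain F where F: "\<And>t. (F has_vector_derivative E' t * \<rho> t) (at t)"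
    using antiderivative_exists by blast
  have \<rho>_per: "\<rho> (t + 2 * pi) = \<rho> t" for t
    using torus_smoothD(2)[OF \<rho>, of 1 t] by simp
  have "((\<lambda>t. F (t + 2 * pi) - 1 / w * F t) has_vector_derivative 0) (at t)" for t
  proof -
    have "((\<lambda>s. s + 2 * pi) has_vector_derivative 1) (at t)"
      by (auto intro!: derivative_eq_intros)
    from vector_diff_chain_at[OF this F]
    have "((\<lambda>t. F (t + 2 * pi)) has_vector_derivative 1 / w * (E' t * \<rho> t)) (at t)"
      by (simp add: o_def E'_per \<rho>_per)
    from has_vector_derivative_diff[OF this has_vector_derivative_mult_right[OF F, of "1 / w"]] show ?thesis by simp
  qed
  from vector_derivative_zero_imp_eq[OF this]
  obtain J where "\<And>t. F (t + 2 * pi) - 1 / w * F t = J" by metis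
  then have F_per: "F (t + 2 * pi) = F t / w + J" for t by (metis add.commute diff_eq_eq mult_1 times_divide_eq_left)
  (* The value of A is determined by the requirement w * A - \<i> * w * J = A. *)
  define A where "A = \<i> * w * J / (w - 1)"
  define \<psi> where "\<psi> t = E t * (A - \<i> * F t)" for t
  have \<psi>_deriv: "(\<psi> has_vector_derivative \<i> * P * (c t * \<psi> t) + (- \<i>) * \<rho> t) (at t)" for t
  proof -
    have "((\<lambda>t. A - \<i> * F t) has_vector_derivative 0 - \<i> * (E' t * \<rho> t)) (at t)"
      by (intro has_vector_derivative_diff has_vector_derivative_const has_vector_derivative_mult_right F)
    from has_vector_derivative_mult[OF E this]
    have "(\<psi> has_vector_derivative E t * (0 - \<i> * (E' t * \<rho> t)) + \<i> * P * c t * E t * (A - \<i> * F t)) (at t)"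
      by (simp add: \<psi>_def[abs_def])
    moreover have "E t * (0 - \<i> * (E' t * \<rho> t)) = - \<i> * \<rho> t * (E t * E' t)" by simp
    ultimately have "(\<psi> has_vector_derivative - \<i> * \<rho> t + \<i> * P * c t * E t * (A - \<i> * F t)) (at t)"
      by (simp only: EE' mult_1_right)
    then show ?thesis by (simp add: \<psi>_def mult_ac)
  qed
  have \<psi>_pd: "pderiv_dir 1 \<psi> = (\<lambda>t. \<i> * P * (c t * \<psi> t) + (- \<i>) * \<rho> t)"
    by (rule ext) (rule pderiv_dir_real[OF \<psi>_deriv])
  have "gen_alg {\<psi>} (pderiv_dir 1 \<psi>)"
    unfolding \<psi>_pd
    by (intro gen_alg.add gen_alg.mult gen_alg.smooth[OF smooth_const] gen_alg.smooth[OF torus_smoothD(1)[OF c]]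
        gen_alg.smooth[OF torus_smoothD(1)[OF \<rho>]] gen_alg.gen) simp
  moreover have "\<psi> differentiable (at t)" for t
    using \<psi>_deriv differentiableI_vector by blast
  ultimately have smooth: "smooth \<psi>"
    by (intro smooth_gen_alg[where G = "{\<psi>}" and f = \<psi>]) (auto intro: gen_alg.gen)
  have per: "\<psi> (t + 2 * pi) = \<psi> t" for t
  proof -
    have "\<psi> (t + 2 * pi) = E t * (w * A - \<i> * F t - \<i> * w * J)"
      unfolding \<psi>_def E_per F_per using w0 by (simp add: field_simps)
    also have "w * A - \<i> * w * J = A"
      using w0 by (simp add: A_def field_simps)
    then have "w * A - \<i> * F t - \<i> * w * J = A - \<i> * F t" by (simp add: algebra_simps)
    finally show ?thesis by (simp add: \<psi>_def)
  qed
  show ?thesis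
  proof (rule that)
    show "\<psi> \<in> torus_smooth" using smooth per by (simp add: torus_smooth_def)
    show "\<i> * pderiv_dir 1 \<psi> t + P * (c t * \<psi> t) = \<rho> t" for t
      by (simp add: \<psi>_pd algebra_simps)
  qed
qed

text \<open>
  Let the solution be multiplied by its integrating factor, normalised to \<open>1\<close> at \<open>t\<close>. Over the
  period after \<open>t\<close> the product changes by \<open>w\<^sup>-\<^sup>1 - 1\<close> times \<open>\<psi>(t)\<close>, over the period before \<open>t\<close> by
  \<open>1 - w\<close> times \<open>\<psi>(t)\<close>, where \<open>w\<close> is the monodromy factor. Its derivative is the right-hand side
  times the integrating factor, up to a factor of modulus \<open>1\<close>. A bound from above on the imaginary
  part of the coefficient controls the integrating factor over the period after \<open>t\<close>, a bound from
  below over the period before \<open>t\<close>. So the mean value inequality gives the estimate in both cases.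
\<close>

lemma periodic_ode_bound:
  fixes c \<rho> \<psi> :: "real \<Rightarrow> complex"
  assumes c: "c \<in> torus_smooth" and \<psi>: "\<psi> \<in> torus_smooth"
    and ode: "\<And>t. \<i> * pderiv_dir 1 \<psi> t + P * (c t * \<psi> t) = \<rho> t"
    and X: "\<And>t. norm (\<rho> t) \<le> X" and L: "L \<ge> 0"
    and sign: "(\<forall>t. - L \<le> Im (c t * P)) \<or> (\<forall>t. Im (c t * P) \<le> L)"
    and \<delta>: "\<delta> > 0" "\<delta> \<le> norm (exp (2 * of_real pi * \<i> * (circle_mean c * P)) - 1)"
      "\<delta> \<le> norm (exp (2 * of_real pi * \<i> * (- (circle_mean c * P))) - 1)"
  shows "norm (\<psi> t) \<le> 2 * pi * exp (2 * pi * L) * X / \<delta>"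
proof -
  obtain C where C: "\<And>t. (C has_vector_derivative c t) (at t)"
    and C_per: "\<And>t. C (t + 2 * pi) = C t + 2 * of_real pi * circle_mean c"
    using periodic_primitive[OF c] by blast
  have X0: "X \<ge> 0" using X norm_ge_zero order_trans by blast
  have \<psi>_per: "\<psi> (t + 2 * pi) = \<psi> t" for t
    using torus_smoothD(2)[OF \<psi>, of 1 t] by simp
  define k where "k s = exp (\<i> * P * C t) * (exp (- (\<i> * P) * C s) * \<psi> s)" for s
  have k: "(k has_vector_derivative exp (\<i> * P * C t) * (- \<i> * (exp (- (\<i> * P) * C s) * \<rho> s))) (at s)" for s
  proof -
    have "(\<psi> has_vector_derivative pderiv_dir 1 \<psi> s) (at s)"
      by (rule has_vector_derivative_pderiv[OF torus_smooth_differentiable[OF \<psi>]])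
    from has_vector_derivative_mult[OF exp_has_vector_derivative[OF C] this]
    have "((\<lambda>s. exp (- (\<i> * P) * C s) * \<psi> s) has_vector_derivative
        exp (- (\<i> * P) * C s) * pderiv_dir 1 \<psi> s + - (\<i> * P) * c s * exp (- (\<i> * P) * C s) * \<psi> s) (at s)" .
    moreover have "exp (- (\<i> * P) * C s) * pderiv_dir 1 \<psi> s + - (\<i> * P) * c s * exp (- (\<i> * P) * C s) * \<psi> s
        = - \<i> * (exp (- (\<i> * P) * C s) * (\<i> * pderiv_dir 1 \<psi> s + P * (c s * \<psi> s)))"
      by (simp add: algebra_simps)
    ultimately have "((\<lambda>s. exp (- (\<i> * P) * C s) * \<psi> s) has_vector_derivative
        - \<i> * (exp (- (\<i> * P) * C s) * \<rho> s)) (at s)"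
      by (simp only: ode)
    from has_vector_derivative_mult_right[OF this] show ?thesis by (simp add: k_def[abs_def])
  qed
  have k': "norm (exp (\<i> * P * C t) * (- \<i> * (exp (- (\<i> * P) * C s) * \<rho> s))) \<le> exp (2 * pi * L) * X"
    if "Im (P * C s) - Im (P * C t) \<le> 2 * pi * L" for s
  proof -
    have "norm (exp (\<i> * P * C t) * (- \<i> * (exp (- (\<i> * P) * C s) * \<rho> s)))
        = exp (Im (P * C s) - Im (P * C t)) * norm (\<rho> s)"
    proof -
      have "Re (\<i> * P * C t) = - Im (P * C t)" "Re (- (\<i> * P) * C s) = Im (P * C s)" by simp_all
      then show ?thesis
        by (simp only: norm_mult norm_exp_eq_Re norm_minus_cancel norm_ii mult_1 diff_conv_add_uminus exp_add mult_ac)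
    qed
    also have "\<dots> \<le> exp (2 * pi * L) * X"
      using that X X0 by (intro mult_mono) auto
    finally show ?thesis .
  qed
  have Q: "((\<lambda>s. Im (P * C s)) has_real_derivative Im (c s * P)) (at s)" for s
  proof -
    have "((\<lambda>s. P * C s) has_vector_derivative P * c s) (at s)"
      by (rule has_vector_derivative_mult_right[OF C])
    from bounded_linear.has_vector_derivative[OF bounded_linear_Im this] show ?thesis
      by (simp add: has_real_derivative_iff_has_vector_derivative mult.commute)
  qed
  have kt: "k t = \<psi> t" by (simp add: k_def flip: exp_add mult.assoc)
  have main: "norm (\<psi> t) \<le> 2 * pi * exp (2 * pi * L) * X / \<delta>" 
    if "norm (y * \<psi> t) \<le> exp (2 * pi * L) * X * (2 * pi)" "\<delta> \<le> norm y" for y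
  proof -
    have "\<delta> * norm (\<psi> t) \<le> norm y * norm (\<psi> t)" using that(2) by (intro mult_right_mono) auto
    also have "\<dots> \<le> exp (2 * pi * L) * X * (2 * pi)" using that(1) by (simp add: norm_mult)
    finally show ?thesis using \<delta>(1) by (simp add: field_simps)
  qed
  from sign show ?thesis
  proof
    assume le: "\<forall>t. Im (c t * P) \<le> L"
    have "norm (k (t + 2 * pi) - k t) \<le> exp (2 * pi * L) * X * ((t + 2 * pi) - t)"
    proof (rule norm_diff_le_of_vector_derivative[OF _ k])
      fix s assume s: "t < s" "s < t + 2 * pi"
      obtain z where "Im (P * C s) - Im (P * C t) = (s - t) * Im (c z * P)"
        using MVT2[of t s "\<lambda>s. Im (P * C s)" "\<lambda>s. Im (c s * P)"] Q s by blast
      also have "\<dots> \<le> (s - t) * L" using le s by (intro mult_left_mono) auto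
      also have "\<dots> \<le> 2 * pi * L" using s L by (intro mult_right_mono) auto
      finally show "norm (exp (\<i> * P * C t) * (- \<i> * (exp (- (\<i> * P) * C s) * \<rho> s))) \<le> exp (2 * pi * L) * X"
        by (rule k')
    qed simp
    moreover have "k (t + 2 * pi) = exp (2 * of_real pi * \<i> * (- (circle_mean c * P))) * \<psi> t"
    proof -
      have "\<i> * P * C t + - (\<i> * P) * C (t + 2 * pi) = 2 * of_real pi * \<i> * (- (circle_mean c * P))"
        unfolding C_per by (simp add: algebra_simps)
      then show ?thesis unfolding k_def \<psi>_per mult.assoc[symmetric] exp_add[symmetric] by simp
    qed
    ultimately show ?thesis
      by (intro main[OF _ \<delta>(3)]) (simp add: kt left_diff_distrib)
  next
    assume ge: "\<forall>t. - L \<le> Im (c t * P)"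
    have "norm (k t - k (t - 2 * pi)) \<le> exp (2 * pi * L) * X * (t - (t - 2 * pi))"
    proof (rule norm_diff_le_of_vector_derivative[OF _ k])
      fix s assume s: "t - 2 * pi < s" "s < t"
      obtain z where "Im (P * C t) - Im (P * C s) = (t - s) * Im (c z * P)"
        using MVT2[of s t "\<lambda>s. Im (P * C s)" "\<lambda>s. Im (c s * P)"] Q s by blast
      moreover have "(t - s) * (- L) \<le> (t - s) * Im (c z * P)" using ge s by (intro mult_left_mono) auto
      moreover have "(t - s) * L \<le> 2 * pi * L" using s L by (intro mult_right_mono) auto
      ultimately have "Im (P * C s) - Im (P * C t) \<le> 2 * pi * L" by simp
      then show "norm (exp (\<i> * P * C t) * (- \<i> * (exp (- (\<i> * P) * C s) * \<rho> s))) \<le> exp (2 * pi * L) * X"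
        by (rule k')
    qed simp
    moreover have "k (t - 2 * pi) = exp (2 * of_real pi * \<i> * (circle_mean c * P)) * \<psi> t"
    proof -
      have "C t = C (t - 2 * pi) + 2 * of_real pi * circle_mean c" "\<psi> (t - 2 * pi) = \<psi> t"
        using C_per[of "t - 2 * pi"] \<psi>_per[of "t - 2 * pi"] by simp_all
      moreover from this(1) have "\<i> * P * C t + - (\<i> * P) * C (t - 2 * pi) = 2 * of_real pi * \<i> * (circle_mean c * P)"
        by (simp add: algebra_simps)
      ultimately show ?thesis unfolding k_def mult.assoc[symmetric] exp_add[symmetric] by simp
    qed
    ultimately show ?thesis
      by (intro main[OF _ \<delta>(2)]) (simp add: kt left_diff_distrib norm_minus_commute)
  qed
qed

section \<open>Growth conditions\<close>

lemma log_growth_bound: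
  fixes \<phi> :: "int ^ 'N::finite \<Rightarrow> 'b::real_normed_vector"
  assumes "log_growth \<phi>"
  obtains \<kappa> R where "\<kappa> > 0" "\<And>\<xi>. R \<le> norm (vec_of_int \<xi>) \<Longrightarrow> norm (\<phi> \<xi>) \<le> \<kappa> * ln (1 + norm (vec_of_int \<xi>))"
proof -
  obtain \<kappa> n0 where \<kappa>: "\<kappa> > 0" "n0 > 0"
    "\<And>\<xi>. n0 \<le> norm (vec_of_int \<xi>) \<Longrightarrow> norm (\<phi> \<xi>) \<le> \<kappa> * ln (norm (vec_of_int \<xi>))"
    using assms unfolding log_growth_def by blast
  have "norm (\<phi> \<xi>) \<le> \<kappa> * ln (1 + norm (vec_of_int \<xi>))" if "n0 \<le> norm (vec_of_int \<xi>)" for \<xi>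
  proof -
    have "0 < norm (vec_of_int \<xi>)" using that \<kappa>(2) by linarith
    then have "\<kappa> * ln (norm (vec_of_int \<xi>)) \<le> \<kappa> * ln (1 + norm (vec_of_int \<xi>))"
      using \<kappa>(1) by (intro mult_left_mono ln_mono) auto
    then show ?thesis using \<kappa>(3)[OF that] by linarith
  qed
  with \<kappa>(1) that show thesis by blast
qed

text \<open>
  Both membership conditions imply one estimate: for each large frequency, the imaginary part
  of \<open>c(t) p(\<xi>)\<close> is bounded on one side by a constant or a logarithm.
\<close>

lemma one_sided_log_bound:
  fixes c :: "'n \<Rightarrow> real \<Rightarrow> complex" and p :: "'n \<Rightarrow> int ^ 'N::finite \<Rightarrow> complex"
  assumes c: "c j \<in> torus_smooth" and j: "j \<in> set_H c p \<union> set_L c p"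
  shows "\<exists>\<Theta>\<ge>0. \<exists>\<kappa>\<ge>0. \<exists>R. \<forall>\<xi>. R \<le> norm (vec_of_int \<xi>) \<longrightarrow>
           (\<forall>t. - (\<Theta> + \<kappa> * ln (1 + norm (vec_of_int \<xi>))) \<le> Im (c j t * p j \<xi>)) \<or>
           (\<forall>t. Im (c j t * p j \<xi>) \<le> \<Theta> + \<kappa> * ln (1 + norm (vec_of_int \<xi>)))"
proof -
  obtain B where B: "B \<ge> 0" "\<And>t. norm (c j t) \<le> B"
    using torus_smooth_bounded[OF c] by blast
  have ReIm: "\<bar>Re (c j t)\<bar> \<le> B" "\<bar>Im (c j t)\<bar> \<le> B" for t
    using B(2)[of t] abs_Re_le_cmod abs_Im_le_cmod order_trans by blast+
  (* The term with the factor of logarithmic growth is the error; the other term has a fixed sign for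
     each frequency, which decides on which side the bound holds. *)
  have mixed: ?thesis if f: "log_growth f" and x: "no_sign_change x" and y: "\<And>t. \<bar>y t\<bar> \<le> B"
    and Im: "\<And>t \<xi>. Im (c j t * p j \<xi>) = x t * g \<xi> + y t * f \<xi>"
    for f g :: "int ^ 'N \<Rightarrow> real" and x y
  proof -
    from log_growth_bound[OF f] obtain \<kappa> R where \<kappa>: "\<kappa> > 0"
      "\<And>\<xi>. R \<le> norm (vec_of_int \<xi>) \<Longrightarrow> \<bar>f \<xi>\<bar> \<le> \<kappa> * ln (1 + norm (vec_of_int \<xi>))" by auto
    have b: "\<bar>y t * f \<xi>\<bar> \<le> (B * \<kappa>) * ln (1 + norm (vec_of_int \<xi>))" if "R \<le> norm (vec_of_int \<xi>)" for \<xi> t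
      unfolding abs_mult mult.assoc using y \<kappa>(2)[OF that] B(1) by (intro mult_mono) auto
    have s: "(\<forall>t. 0 \<le> x t * g \<xi>) \<or> (\<forall>t. x t * g \<xi> \<le> 0)" for \<xi>
      using x unfolding no_sign_change_def
      by (metis linorder_linear mult_nonneg_nonneg mult_nonneg_nonpos mult_nonpos_nonneg mult_nonpos_nonpos)
    have "(\<forall>t. - (0 + (B * \<kappa>) * ln (1 + norm (vec_of_int \<xi>))) \<le> Im (c j t * p j \<xi>)) \<or>
           (\<forall>t. Im (c j t * p j \<xi>) \<le> 0 + (B * \<kappa>) * ln (1 + norm (vec_of_int \<xi>)))"
      if R: "R \<le> norm (vec_of_int \<xi>)" for \<xi>
      using s[of \<xi>]
    proof
      assume "\<forall>t. 0 \<le> x t * g \<xi>"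
      then show ?thesis unfolding Im using b[OF R] by (intro disjI1 allI) (smt (verit))
    next
      assume "\<forall>t. x t * g \<xi> \<le> 0"
      then show ?thesis unfolding Im using b[OF R] by (intro disjI2 allI) (smt (verit))
    qed
    with B(1) \<kappa>(1) show ?thesis
      by (intro exI[of _ 0] conjI exI[of _ "B * \<kappa>"] exI[of _ R] allI impI) auto
  qed
  from j consider "j \<in> set_H c p" | "log_growth (p j)"
    | "log_growth (\<lambda>\<xi>. Re (p j \<xi>))" "no_sign_change (\<lambda>t. Re (c j t))"
    | "log_growth (\<lambda>\<xi>. Im (p j \<xi>))" "no_sign_change (\<lambda>t. Im (c j t))"
    by (auto simp: set_L_def)
  then show ?thesis
  proof cases
    case 1
    then obtain \<Theta> where \<Theta>: "\<Theta> > 0" "\<And>\<xi>. - \<Theta> \<le> (INF t. Im (c j t * p j \<xi>))"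
      by (auto simp: set_H_def)
    have "- \<Theta> \<le> Im (c j t * p j \<xi>)" for t \<xi>
    proof -
      have "- (B * norm (p j \<xi>)) \<le> Im (c j t * p j \<xi>)" for t
      proof -
        have "\<bar>Im (c j t * p j \<xi>)\<bar> \<le> norm (c j t) * norm (p j \<xi>)"
          using abs_Im_le_cmod[of "c j t * p j \<xi>"] by (simp only: norm_mult)
        also have "\<dots> \<le> B * norm (p j \<xi>)" using B by (intro mult_right_mono) auto
        finally show ?thesis by linarith
      qed
      then have "bdd_below (range (\<lambda>t. Im (c j t * p j \<xi>)))" by (intro bdd_belowI2)
      then have "(INF t. Im (c j t * p j \<xi>)) \<le> Im (c j t * p j \<xi>)"
        by (rule cINF_lower) simp
      with \<Theta>(2)[of \<xi>] show ?thesis by linarith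
    qed
    with \<Theta>(1) show ?thesis
      by (intro exI[of _ \<Theta>] conjI exI[of _ 0] allI impI disjI1) auto
  next
    case 2
    from log_growth_bound[OF this] obtain \<kappa> R where \<kappa>: "\<kappa> > 0"
      "\<And>\<xi>. R \<le> norm (vec_of_int \<xi>) \<Longrightarrow> norm (p j \<xi>) \<le> \<kappa> * ln (1 + norm (vec_of_int \<xi>))" by blast
    have "Im (c j t * p j \<xi>) \<le> (B * \<kappa>) * ln (1 + norm (vec_of_int \<xi>))" if "R \<le> norm (vec_of_int \<xi>)" for \<xi> t
    proof -
      have "Im (c j t * p j \<xi>) \<le> norm (c j t) * norm (p j \<xi>)"
        using abs_Im_le_cmod[of "c j t * p j \<xi>"] unfolding norm_mult by linarith
      also have "\<dots> \<le> B * (\<kappa> * ln (1 + norm (vec_of_int \<xi>)))"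
        using B \<kappa>(2)[OF that] by (intro mult_mono) auto
      finally show ?thesis by simp
    qed
    with B(1) \<kappa>(1) show ?thesis
      by (intro exI[of _ 0] conjI exI[of _ "B * \<kappa>"] exI[of _ R] allI impI disjI2) auto
  next
    case 3
    show ?thesis
      by (rule mixed[where y = "\<lambda>t. Im (c j t)" and g = "\<lambda>\<xi>. Im (p j \<xi>)", OF 3 ReIm(2)]) simp
  next
    case 4
    show ?thesis
      by (rule mixed[where y = "\<lambda>t. Re (c j t)" and g = "\<lambda>\<xi>. Re (p j \<xi>)", OF 4 ReIm(1)]) simp
  qed
qed

lemma toroidal_symbol_bound:
  fixes p :: "int ^ 'N::finite \<Rightarrow> complex"
  assumes "p \<in> toroidal_symbol m"
  obtains C k where "C \<ge> 0" "\<And>\<xi>. norm (p \<xi>) \<le> C * (1 + norm (vec_of_int \<xi>)) ^ k"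
proof -
  have "Finite_Set.fold (\<lambda>j q. q) p A = p" if "finite A" for A :: "'N set"
    using that
  proof induction
    case (insert x A)
    interpret comp_fun_commute "\<lambda>(j::'N) (q::int ^ 'N \<Rightarrow> complex). q" by unfold_locales auto
    show ?case using insert by simp
  qed simp
  then have "multi_diff (\<lambda>_. 0) p = p" by (simp add: multi_diff_def)
  moreover obtain C where C: "C > 0"
    "\<And>\<xi>. norm (multi_diff (\<lambda>_. 0) p \<xi>) \<le> C * (1 + norm (vec_of_int \<xi>)) powr (m - real (\<Sum>j\<in>(UNIV :: 'N set). 0))"
    using assms unfolding toroidal_symbol_def by blast
  ultimately have p: "norm (p \<xi>) \<le> C * (1 + norm (vec_of_int \<xi>)) powr m" for \<xi> by simp
  have "norm (p \<xi>) \<le> C * (1 + norm (vec_of_int \<xi>)) ^ nat \<lceil>m\<rceil>" for \<xi>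
  proof -
    have "(1 + norm (vec_of_int \<xi>)) powr m \<le> (1 + norm (vec_of_int \<xi>)) powr real (nat \<lceil>m\<rceil>)"
      by (intro powr_mono real_nat_ceiling_ge) auto
    also have "\<dots> = (1 + norm (vec_of_int \<xi>)) ^ nat \<lceil>m\<rceil>"
      by (intro powr_realpow) (simp add: add_pos_nonneg)
    finally have "C * (1 + norm (vec_of_int \<xi>)) powr m \<le> C * (1 + norm (vec_of_int \<xi>)) ^ nat \<lceil>m\<rceil>"
      using C(1) by (intro mult_left_mono) auto
    with p[of \<xi>] show ?thesis by linarith
  qed
  with C(1) that show thesis by (metis less_imp_le)
qed

section \<open>Products of functions of one variable as test functions\<close>

text \<open>
  Products of functions of the single variables \<open>t\<^sub>k\<close> are closed under the operations that the
  equations of the system require, namely \<open>t\<close>-derivatives and multiplication by functions of one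
  \<open>t\<^sub>k\<close>, and one factor can be exchanged for the solution of an ordinary differential equation.
\<close>

definition tfun :: "('n::finite \<Rightarrow> real \<Rightarrow> complex) \<Rightarrow> int ^ 'N::finite
    \<Rightarrow> (real ^ 'n) \<times> (real ^ 'N) \<Rightarrow> complex" where
  "tfun G \<xi> z = (\<Prod>k\<in>UNIV. G k (fst z $ k)) * tchar (0, - vec_of_int \<xi>) z"

text \<open>
  The factors of the function \<open>\<Prod>\<^sub>k g\<^sub>k(t\<^sub>k) exp (- i t\<cdot>\<tau>)\<close>.
\<close>

definition modulate :: "('n \<Rightarrow> real \<Rightarrow> complex) \<Rightarrow> real ^ 'n \<Rightarrow> 'n \<Rightarrow> real \<Rightarrow> complex" where
  "modulate g \<tau> = (\<lambda>k s. g k s * tchar (- (\<tau> $ k)) s)"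

lemma inner_axis_Pair [simp]: "z \<bullet> (axis k 1, 0) = fst z $ k"
  by (cases z) (simp add: inner_axis)

lemma torus_smooth_coordinate:
  fixes g :: "real \<Rightarrow> complex"
  assumes "g \<in> torus_smooth"
  shows "(\<lambda>z::(real ^ 'n::finite) \<times> (real ^ 'N::finite). g (fst z $ k)) \<in> torus_smooth"
  using torus_smooth_comp_inner[OF assms Pair_in_Basis(1)[OF axis_in_Basis[of k]]] by simp

lemma torus_smooth_prod_coordinates:
  fixes G :: "'n::finite \<Rightarrow> real \<Rightarrow> complex"
  assumes "\<And>k. G k \<in> torus_smooth"
  shows "(\<lambda>z::(real ^ 'n) \<times> (real ^ 'N::finite). \<Prod>k\<in>UNIV. G k (fst z $ k)) \<in> torus_smooth"
  by (intro torus_smooth_prod torus_smooth_coordinate assms)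

lemma torus_smooth_tfun:
  assumes "\<And>k. G k \<in> torus_smooth"
  shows "tfun G \<xi> \<in> torus_smooth"
  unfolding tfun_def[abs_def]
  by (intro torus_smooth_mult torus_smooth_prod_coordinates torus_smooth_tchar assms)
     (simp add: int_lattice_closed)

lemma tfun_upd:
  "tfun (G(k := A)) \<xi> z = A (fst z $ k) * ((\<Prod>i\<in>UNIV - {k}. G i (fst z $ i)) * tchar (0, - vec_of_int \<xi>) z)"
proof -
  have "(\<Prod>i\<in>UNIV. (G(k := A)) i (fst z $ i)) = A (fst z $ k) * (\<Prod>i\<in>UNIV - {k}. (G(k := A)) i (fst z $ i))"
    by (subst prod.remove[of UNIV k]) auto
  also have "(\<Prod>i\<in>UNIV - {k}. (G(k := A)) i (fst z $ i)) = (\<Prod>i\<in>UNIV - {k}. G i (fst z $ i))"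
    by (rule prod.cong) auto
  finally show ?thesis by (simp add: tfun_def mult.assoc)
qed

lemma pderiv_dir_tfun:
  fixes G :: "'n::finite \<Rightarrow> real \<Rightarrow> complex" and \<xi> :: "int ^ 'N::finite"
  assumes G: "\<And>k. G k \<in> torus_smooth"
  shows "pderiv_dir b (tfun G \<xi>) z
      = (\<Sum>k\<in>UNIV. of_real (fst b $ k) * tfun (G(k := pderiv_dir 1 (G k))) \<xi> z)
        + \<i> * of_real (b \<bullet> (0, - vec_of_int \<xi>)) * tfun G \<xi> z"
proof -
  have "((\<lambda>z. G k (fst z $ k)) has_derivative (\<lambda>b. of_real (fst b $ k) * pderiv_dir 1 (G k) (fst z $ k))) (at z)" for k
    using smooth_comp_inner_pderiv[OF torus_smoothD(1)[OF G[of k]], of "(axis k 1, 0)" z]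
    by (simp only: inner_axis_Pair)
  from has_derivative_mult[OF has_derivative_prod[where I = "UNIV :: 'n set", OF this] tchar_has_derivative[of "(0, - vec_of_int \<xi>)" z]]
  have "(tfun G \<xi> has_derivative (\<lambda>b. (\<Prod>k\<in>UNIV. G k (fst z $ k)) *
        (\<i> * of_real (b \<bullet> (0, - vec_of_int \<xi>)) * tchar (0, - vec_of_int \<xi>) z) +
      (\<Sum>k\<in>UNIV. of_real (fst b $ k) * pderiv_dir 1 (G k) (fst z $ k) * (\<Prod>i\<in>UNIV - {k}. G i (fst z $ i))) *
        tchar (0, - vec_of_int \<xi>) z)) (at z)"
    by (simp only: tfun_def[abs_def])
  from pderiv_dir_eq[OF this, of b] show ?thesis
    by (simp add: tfun_upd tfun_def[of G] sum_distrib_left mult_ac add.commute)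
qed

lemma pderiv_dir_tfun_t:
  fixes G :: "'n::finite \<Rightarrow> real \<Rightarrow> complex"
  assumes "\<And>k. G k \<in> torus_smooth"
  shows "pderiv_dir (axis k 1, 0) (tfun G \<xi>) = tfun (G(k := pderiv_dir 1 (G k))) \<xi>"
proof
  fix z
  have "(\<Sum>i\<in>UNIV. of_real (fst (axis k (1::real), 0) $ i) * tfun (G(i := pderiv_dir 1 (G i))) \<xi> z)
      = (\<Sum>i\<in>UNIV. if i = k then tfun (G(i := pderiv_dir 1 (G i))) \<xi> z else 0)"
    by (intro sum.cong) (auto simp: axis_def)
  then show "pderiv_dir (axis k 1, 0) (tfun G \<xi>) z = tfun (G(k := pderiv_dir 1 (G k))) \<xi> z"
    by (simp add: pderiv_dir_tfun[OF assms])
qed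

lemma pderiv_dir_tfun_x:
  fixes G :: "'n::finite \<Rightarrow> real \<Rightarrow> complex"
  assumes "\<And>k. G k \<in> torus_smooth"
  shows "pderiv_dir (0, b) (tfun G \<xi>) = (\<lambda>z. \<i> * of_real ((0, b) \<bullet> (0, - vec_of_int \<xi>)) * tfun G \<xi> z)"
  by (rule ext) (simp add: pderiv_dir_tfun[OF assms])

text \<open>
  For a fixed smooth function, the decay in \<open>\<xi>\<close> is uniform over all test functions of a given
  size, no matter how fast they vary in \<open>t\<close>: only derivatives in \<open>x\<close> are moved.
\<close>

lemma integral_tfun_decay:
  fixes f :: "(real ^ 'n::finite) \<times> (real ^ 'N::finite) \<Rightarrow> complex"
  assumes f: "f \<in> torus_smooth"
  shows "\<exists>C\<ge>0. \<forall>G \<xi> H. (\<forall>k. G k \<in> torus_smooth) \<longrightarrow> (\<forall>z. norm (tfun G \<xi> z) \<le> H) \<longrightarrow>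
           (1 + norm (vec_of_int \<xi>)) ^ K * norm (integral torus_cell (\<lambda>z. f z * tfun G \<xi> z)) \<le> C * H"
proof (intro exI conjI allI impI)
  let ?C = "(1 + real DIM((real ^ 'n) \<times> (real ^ 'N))) ^ K * (2 * pi) ^ DIM((real ^ 'n) \<times> (real ^ 'N)) * Ck_norm K f"
  show "0 \<le> ?C" using Ck_norm_nonneg[OF f] by (intro mult_nonneg_nonneg) auto
  fix G :: "'n \<Rightarrow> real \<Rightarrow> complex" and \<xi> :: "int ^ 'N" and H
  assume G: "\<forall>k. G k \<in> torus_smooth" and H: "\<forall>z::(real ^ 'n) \<times> (real ^ 'N). norm (tfun G \<xi> z) \<le> H"
  have "(1 + norm (0 :: real ^ 'n, - vec_of_int \<xi>)) ^ K * norm (integral torus_cell (\<lambda>z. f z * tfun G \<xi> z)) \<le> ?C * H"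
  proof (rule oscillatory_decay[OF f])
    show "tfun G \<xi> \<in> torus_smooth" using G by (intro torus_smooth_tfun) auto
    show "norm (tfun G \<xi> z) \<le> H" for z using H by blast
    fix b :: "(real ^ 'n) \<times> (real ^ 'N)"
    assume b: "b \<in> Basis" "(0, - vec_of_int \<xi>) \<bullet> b \<noteq> 0"
    then obtain b' where "b = (0, b')" by (auto simp: Basis_prod_def)
    then show "pderiv_dir b (tfun G \<xi>) = (\<lambda>z. \<i> * of_real (b \<bullet> (0, - vec_of_int \<xi>)) * tfun G \<xi> z)"
      using pderiv_dir_tfun_x[of G b' \<xi>] G by simp
  qed
  then show "(1 + norm (vec_of_int \<xi>)) ^ K * norm (integral torus_cell (\<lambda>z. f z * tfun G \<xi> z)) \<le> ?C * H"
    by (simp add: norm_Pair)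
qed

lemma torus_smooth_modulate:
  assumes "\<And>k. g k \<in> torus_smooth" "\<tau> \<in> int_lattice"
  shows "modulate g \<tau> k \<in> torus_smooth"
proof -
  have "\<tau> \<bullet> axis k 1 \<in> \<int>"
    using assms(2) by (simp add: int_lattice_def)
  then have "\<tau> $ k \<in> \<int>" by (simp add: inner_axis)
  then have "- (\<tau> $ k) \<in> int_lattice" by (simp add: int_lattice_def)
  then show ?thesis
    unfolding modulate_def by (intro torus_smooth_mult torus_smooth_tchar assms(1))
qed

lemma modulate_upd: "modulate (g(k := A)) \<tau> = (modulate g \<tau>)(k := \<lambda>s. A s * tchar (- (\<tau> $ k)) s)"
  by (auto simp: modulate_def fun_eq_iff)

lemma tfun_modulate:
  fixes g :: "'n::finite \<Rightarrow> real \<Rightarrow> complex" and \<xi> :: "int ^ 'N::finite"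
  shows "tfun (modulate g \<tau>) \<xi> z = (\<Prod>k\<in>UNIV. g k (fst z $ k)) * tchar (- \<tau>, - vec_of_int \<xi>) z"
proof -
  have "(\<Prod>k\<in>UNIV. tchar (- (\<tau> $ k)) (fst z $ k)) = tchar (- \<tau>) (fst z)"
    by (simp add: tchar_def inner_vec_def exp_sum[symmetric] sum_distrib_left)
  then show ?thesis
    by (cases z) (simp add: tfun_def modulate_def prod.distrib tchar_Pair mult.assoc)
qed

lemma evol_op_tfun:
  fixes u :: "((real ^ 'n::finite) \<times> (real ^ 'N::finite)) functional"
  assumes u: "u \<in> torus_distribution" and c: "c \<in> torus_smooth" and G: "\<And>i. G i \<in> torus_smooth"
  shows "evol_op (axis k 1) c p u (tfun G \<xi>)
       = u (tfun (G(k := \<lambda>s. \<i> * pderiv_dir 1 (G k) s + p \<xi> * (c s * G k s))) \<xi>)"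
proof -
  have "tfun G \<xi> (t, x) = (\<Prod>k\<in>UNIV. G k (t $ k)) * tchar (- vec_of_int \<xi>) x" for t x
    by (simp add: tfun_def tchar_Pair)
  from evol_op_tensor[OF u c axis_in_Basis torus_smooth_tfun[OF G] this, of k p]
  have "evol_op (axis k 1) c p u (tfun G \<xi>)
      = u (\<lambda>z. \<i> * tfun (G(k := pderiv_dir 1 (G k))) \<xi> z + p \<xi> * (c (fst z $ k) * tfun G \<xi> z))"
    by (simp add: pderiv_dir_tfun_t[OF G])
  also have "(\<lambda>z. \<i> * tfun (G(k := pderiv_dir 1 (G k))) \<xi> z + p \<xi> * (c (fst z $ k) * tfun G \<xi> z))
      = tfun (G(k := \<lambda>s. \<i> * pderiv_dir 1 (G k) s + p \<xi> * (c s * G k s))) \<xi>"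
  proof
    fix z :: "(real ^ 'n) \<times> (real ^ 'N)"
    have "tfun G \<xi> z = tfun (G(k := G k)) \<xi> z" by simp
    then show "\<i> * tfun (G(k := pderiv_dir 1 (G k))) \<xi> z + p \<xi> * (c (fst z $ k) * tfun G \<xi> z)
      = tfun (G(k := \<lambda>s. \<i> * pderiv_dir 1 (G k) s + p \<xi> * (c s * G k s))) \<xi> z"
      unfolding tfun_upd by (simp only: tfun_upd) (simp add: algebra_simps)
  qed
  finally show ?thesis .
qed

text \<open>
  One equation of the system, tested with a modulated product, trades a factor \<open>\<tau>\<^sub>k\<close> for a factor
  \<open>p(\<xi>)\<close> and a change of the amplitude.
\<close>

lemma evol_op_tfun_modulate:
  fixes u :: "((real ^ 'n::finite) \<times> (real ^ 'N::finite)) functional"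
  assumes u: "u \<in> torus_distribution" and c: "c \<in> torus_smooth" and g: "\<And>i. g i \<in> torus_smooth"
    and \<tau>: "\<tau> \<in> int_lattice"
  shows "of_real (\<tau> $ k) * u (tfun (modulate g \<tau>) \<xi>)
       = evol_op (axis k 1) c p u (tfun (modulate g \<tau>) \<xi>)
         - \<i> * u (tfun (modulate (g(k := pderiv_dir 1 (g k))) \<tau>) \<xi>)
         - p \<xi> * u (tfun (modulate (g(k := \<lambda>s. c s * g k s)) \<tau>) \<xi>)"
proof -
  let ?G = "modulate g \<tau>"
  let ?e = "tchar (- (\<tau> $ k)) :: real \<Rightarrow> complex"
  have G: "?G i \<in> torus_smooth" for i by (rule torus_smooth_modulate[OF g \<tau>])
  have g1: "(g(k := pderiv_dir 1 (g k))) i \<in> torus_smooth" for i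
    using g torus_smooth_pderiv[OF g, of 1] by simp
  have g2: "(g(k := \<lambda>s. c s * g k s)) i \<in> torus_smooth" for i
    using g torus_smooth_mult[OF c g] by simp
  have s0: "tfun ?G \<xi> \<in> torus_smooth" by (rule torus_smooth_tfun[OF G])
  have s1: "tfun (modulate (g(k := pderiv_dir 1 (g k))) \<tau>) \<xi> \<in> torus_smooth"
    by (rule torus_smooth_tfun[OF torus_smooth_modulate[OF g1 \<tau>]])
  have s2: "tfun (modulate (g(k := \<lambda>s. c s * g k s)) \<tau>) \<xi> \<in> torus_smooth"
    by (rule torus_smooth_tfun[OF torus_smooth_modulate[OF g2 \<tau>]])
  have d: "pderiv_dir 1 (?G k) s = pderiv_dir 1 (g k) s * ?e s - \<i> * of_real (\<tau> $ k) * (g k s * ?e s)" for s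
    using pderiv_dir_mult[OF torus_smooth_differentiable[OF g[of k]] tchar_differentiable[of "- (\<tau> $ k)"], of 1 s]
    by (simp add: modulate_def pderiv_dir_tchar algebra_simps)
  have "tfun (?G(k := \<lambda>s. \<i> * pderiv_dir 1 (?G k) s + p \<xi> * (c s * ?G k s))) \<xi>
      = (\<lambda>z. (\<i> * tfun (modulate (g(k := pderiv_dir 1 (g k))) \<tau>) \<xi> z + of_real (\<tau> $ k) * tfun ?G \<xi> z)
          + p \<xi> * tfun (modulate (g(k := \<lambda>s. c s * g k s)) \<tau>) \<xi> z)"
  proof
    fix z :: "(real ^ 'n) \<times> (real ^ 'N)"
    have "tfun ?G \<xi> z = tfun (?G(k := ?G k)) \<xi> z" by simp
    then have 0: "tfun ?G \<xi> z = ?G k (fst z $ k) * ((\<Prod>i\<in>UNIV - {k}. ?G i (fst z $ i)) * tchar (0, - vec_of_int \<xi>) z)"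
      unfolding tfun_upd .
    have "?G k = (\<lambda>s. g k s * ?e s)" by (simp add: modulate_def)
    then show "tfun (?G(k := \<lambda>s. \<i> * pderiv_dir 1 (?G k) s + p \<xi> * (c s * ?G k s))) \<xi> z
      = (\<i> * tfun (modulate (g(k := pderiv_dir 1 (g k))) \<tau>) \<xi> z + of_real (\<tau> $ k) * tfun ?G \<xi> z)
          + p \<xi> * tfun (modulate (g(k := \<lambda>s. c s * g k s)) \<tau>) \<xi> z"
      unfolding modulate_upd tfun_upd 0 d by (simp add: algebra_simps)
  qed
  then have "evol_op (axis k 1) c p u (tfun ?G \<xi>)
      = u (\<lambda>z. (\<i> * tfun (modulate (g(k := pderiv_dir 1 (g k))) \<tau>) \<xi> z + of_real (\<tau> $ k) * tfun ?G \<xi> z)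
          + p \<xi> * tfun (modulate (g(k := \<lambda>s. c s * g k s)) \<tau>) \<xi> z)"
    by (simp add: evol_op_tfun[OF u c G])
  also have "\<dots> = \<i> * u (tfun (modulate (g(k := pderiv_dir 1 (g k))) \<tau>) \<xi>) + of_real (\<tau> $ k) * u (tfun ?G \<xi>)
      + p \<xi> * u (tfun (modulate (g(k := \<lambda>s. c s * g k s)) \<tau>) \<xi>)"
    by (simp add: torus_distributionD[OF u] s0 s1 s2 torus_smooth_cmult torus_smooth_add)
  finally show ?thesis by (simp add: algebra_simps)
qed

text \<open>
  Each derivative that falls on the character costs one factor \<open>\<parallel>\<zeta>\<parallel>\<close>. The induction generalises
  the amplitude, since the other derivatives fall on it.
\<close>

lemma Ck_norm_mult_tchar_le:
  fixes g :: "'a::euclidean_space \<Rightarrow> complex"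
  assumes "g \<in> torus_smooth"
  shows "\<exists>C\<ge>0. \<forall>\<zeta>\<in>int_lattice. Ck_norm k (\<lambda>z. g z * tchar \<zeta> z) \<le> C * (1 + norm \<zeta>) ^ k"
proof -
  have "\<exists>C\<ge>0. \<forall>\<zeta>\<in>int_lattice. \<forall>bs z. set bs \<subseteq> Basis \<longrightarrow> length bs \<le> k \<longrightarrow>
      norm (iter_pderiv bs (\<lambda>z. g z * tchar \<zeta> z) z) \<le> C * (1 + norm \<zeta>) ^ k"
    using assms
  proof (induction k arbitrary: g)
    case 0
    obtain B where "B \<ge> 0" "\<And>z. norm (g z) \<le> B" using torus_smooth_bounded[OF 0] by blast
    then show ?case by (intro exI[of _ B]) (auto simp: norm_mult)
  next
    case (Suc k)
    obtain C0 where C0: "C0 \<ge> 0" "\<And>\<zeta> bs z. \<zeta> \<in> int_lattice \<Longrightarrow> set bs \<subseteq> Basis \<Longrightarrow> length bs \<le> k \<Longrightarrow>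
        norm (iter_pderiv bs (\<lambda>z. g z * tchar \<zeta> z) z) \<le> C0 * (1 + norm \<zeta>) ^ k"
      using Suc.IH[OF Suc.prems] by blast
    have "\<forall>b\<in>Basis. \<exists>C\<ge>0. \<forall>\<zeta>\<in>int_lattice. \<forall>bs z. set bs \<subseteq> Basis \<longrightarrow> length bs \<le> k \<longrightarrow>
        norm (iter_pderiv bs (\<lambda>z. pderiv_dir b g z * tchar \<zeta> z) z) \<le> C * (1 + norm \<zeta>) ^ k"
      using Suc.IH[OF torus_smooth_pderiv[OF Suc.prems]] by blast
    then obtain D where D: "\<And>b. b \<in> Basis \<Longrightarrow> D b \<ge> 0" "\<And>b \<zeta> bs z. b \<in> Basis \<Longrightarrow> \<zeta> \<in> int_lattice \<Longrightarrow>
        set bs \<subseteq> Basis \<Longrightarrow> length bs \<le> k \<Longrightarrow>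
        norm (iter_pderiv bs (\<lambda>z. pderiv_dir b g z * tchar \<zeta> z) z) \<le> D b * (1 + norm \<zeta>) ^ k"
      by metis
    define C where "C = C0 + sum D Basis"
    have DC: "D b \<le> sum D Basis" if "b \<in> Basis" for b
      using that D(1) by (intro member_le_sum) auto
    have C: "C \<ge> 0" unfolding C_def using C0(1) D(1) by (intro add_nonneg_nonneg sum_nonneg) auto
    have "norm (iter_pderiv bs (\<lambda>z. g z * tchar \<zeta> z) z) \<le> C * (1 + norm \<zeta>) ^ Suc k"
      if \<zeta>: "\<zeta> \<in> int_lattice" and bs: "set bs \<subseteq> Basis" "length bs \<le> Suc k" for \<zeta> bs z
    proof (cases bs rule: rev_cases)
      case Nil
      then have "norm (iter_pderiv bs (\<lambda>z. g z * tchar \<zeta> z) z) \<le> C0 * (1 + norm \<zeta>) ^ k"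
        using C0(2)[OF \<zeta>, of "[]"] by simp
      also have "\<dots> \<le> C * (1 + norm \<zeta>) ^ Suc k"
        using C0(1) D(1) by (intro mult_mono power_increasing C) (auto simp: C_def intro!: sum_nonneg)
      finally show ?thesis .
    next
      case (snoc as b)
      then have b: "b \<in> Basis" and as: "set as \<subseteq> Basis" "length as \<le> k" using bs by auto
      have sg: "smooth g" "smooth (pderiv_dir b g)"
        using torus_smoothD(1)[OF Suc.prems] smooth_pderiv b by auto
      have "pderiv_dir b (\<lambda>z. g z * tchar \<zeta> z)
          = (\<lambda>z. pderiv_dir b g z * tchar \<zeta> z + (\<i> * of_real (b \<bullet> \<zeta>)) * (g z * tchar \<zeta> z))"
        by (simp add: fun_eq_iff pderiv_dir_mult smooth_differentiable[OF sg(1)] pderiv_dir_tchar algebra_simps)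
      then have "iter_pderiv bs (\<lambda>z. g z * tchar \<zeta> z) z = iter_pderiv as (\<lambda>z. pderiv_dir b g z * tchar \<zeta> z) z
          + (\<i> * of_real (b \<bullet> \<zeta>)) * iter_pderiv as (\<lambda>z. g z * tchar \<zeta> z) z"
        unfolding snoc iter_pderiv_snoc
        by (simp only: iter_pderiv_add[OF smooth_mult[OF sg(2) smooth_tchar]
              smooth_mult[OF smooth_const smooth_mult[OF sg(1) smooth_tchar]] as(1)]
            iter_pderiv_cmult[OF smooth_mult[OF sg(1) smooth_tchar] as(1)])
      also have "norm \<dots> \<le> norm (iter_pderiv as (\<lambda>z. pderiv_dir b g z * tchar \<zeta> z) z)
          + \<bar>b \<bullet> \<zeta>\<bar> * norm (iter_pderiv as (\<lambda>z. g z * tchar \<zeta> z) z)"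
        by (rule norm_triangle_le) (simp add: norm_mult)
      also have "\<dots> \<le> D b * (1 + norm \<zeta>) ^ k + norm \<zeta> * (C0 * (1 + norm \<zeta>) ^ k)"
        using Basis_le_norm[OF b, of \<zeta>]
        by (intro add_mono mult_mono D(2) C0(2) b \<zeta> as) (auto simp: inner_commute)
      also have "\<dots> \<le> C * (1 + norm \<zeta>) ^ Suc k"
      proof -
        have "D b + norm \<zeta> * C0 \<le> C * (1 + norm \<zeta>)"
        proof -
          have "D b + norm \<zeta> * C0 \<le> C + norm \<zeta> * C"
            using DC[OF b] C0(1) D(1) by (intro add_mono mult_left_mono) (auto simp: C_def intro!: sum_nonneg)
          then show ?thesis by (simp add: algebra_simps)
        qed
        from mult_right_mono[OF this, of "(1 + norm \<zeta>) ^ k"] show ?thesis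
          by (simp add: algebra_simps)
      qed
      finally show ?thesis .
    qed
    with C show ?case by blast
  qed
  then obtain C where C: "C \<ge> 0" "\<And>\<zeta> bs z. \<zeta> \<in> int_lattice \<Longrightarrow> set bs \<subseteq> Basis \<Longrightarrow> length bs \<le> k \<Longrightarrow>
      norm (iter_pderiv bs (\<lambda>z. g z * tchar \<zeta> z) z) \<le> C * (1 + norm \<zeta>) ^ k" by blast
  have "Ck_norm k (\<lambda>z. g z * tchar \<zeta> z) \<le> (real (Ck_count TYPE('a) k) * C) * (1 + norm \<zeta>) ^ k"
    if "\<zeta> \<in> int_lattice" for \<zeta>
    using Ck_norm_le[OF C(2)[OF that]] by (simp add: mult.assoc)
  then show ?thesis
    using C(1) by (intro exI[of _ "real (Ck_count TYPE('a) k) * C"]) auto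
qed

section \<open>Decay of the Fourier coefficients\<close>

lemma norm_tchar_frequency:
  fixes \<tau> :: "real ^ 'n::finite" and \<xi> :: "int ^ 'N::finite"
  shows "1 + norm (- \<tau>, - vec_of_int \<xi>) \<le> (1 + norm \<tau>) * (1 + norm (vec_of_int \<xi>))"
proof -
  have "norm (- \<tau>, - vec_of_int \<xi>) \<le> norm \<tau> + norm (vec_of_int \<xi>)"
    using norm_Pair_le[of "- \<tau>" "- vec_of_int \<xi>"] by simp
  moreover have "0 \<le> norm \<tau> * norm (vec_of_int \<xi>)" by simp
  moreover have "(1 + norm \<tau>) * (1 + norm (vec_of_int \<xi>))
      = 1 + norm \<tau> + norm (vec_of_int \<xi>) + norm \<tau> * norm (vec_of_int \<xi>)"
    by (simp add: algebra_simps)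
  ultimately show ?thesis by linarith
qed

text \<open>
  For large \<open>\<xi>\<close> the ordinary differential equation dual to one operator of the system is solvable
  with a loss that is polynomial in \<open>\<xi>\<close>: the small divisor and the integrating factor are both
  under control.
\<close>

lemma ode_solvable:
  fixes c :: "real \<Rightarrow> complex" and p :: "int ^ 'N::finite \<Rightarrow> complex"
  assumes c: "c \<in> torus_smooth"
    and dioph: "\<And>\<xi> \<tau>::int. real M \<le> norm (vec_of_int \<xi>) \<Longrightarrow>
           1 \<le> norm (of_int \<tau> + circle_mean c * p \<xi>) * (1 + norm (vec_of_int \<xi>)) ^ M"
    and \<Theta>: "\<Theta> \<ge> 0" and \<kappa>: "\<kappa> \<ge> 0"
    and sign: "\<And>\<xi>. R \<le> norm (vec_of_int \<xi>) \<Longrightarrow>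
           (\<forall>t. - (\<Theta> + \<kappa> * ln (1 + norm (vec_of_int \<xi>))) \<le> Im (c t * p \<xi>)) \<or>
           (\<forall>t. Im (c t * p \<xi>) \<le> \<Theta> + \<kappa> * ln (1 + norm (vec_of_int \<xi>)))"
  shows "\<exists>A\<ge>0. \<exists>n. \<forall>\<xi> \<rho> X. max R (real M) \<le> norm (vec_of_int \<xi>) \<longrightarrow> \<rho> \<in> torus_smooth \<longrightarrow>
           (\<forall>t. norm (\<rho> t) \<le> X) \<longrightarrow>
           (\<exists>\<psi>\<in>torus_smooth. (\<forall>t. \<i> * pderiv_dir 1 \<psi> t + p \<xi> * (c t * \<psi> t) = \<rho> t) \<and>
              (\<forall>t. norm (\<psi> t) \<le> A * (1 + norm (vec_of_int \<xi>)) ^ n * X))"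
proof (intro exI conjI allI impI)
  define n where "n = nat \<lceil>2 * pi * \<kappa>\<rceil>"
  show "0 \<le> 4 * pi * exp (2 * pi * \<Theta>)" by simp
  fix \<xi> :: "int ^ 'N" and \<rho> :: "real \<Rightarrow> complex" and X :: real
  assume \<xi>: "max R (real M) \<le> norm (vec_of_int \<xi>)" and \<rho>: "\<rho> \<in> torus_smooth" and X: "\<forall>t. norm (\<rho> t) \<le> X"
  define v where "v = 1 + norm (vec_of_int \<xi>)"
  have v: "v \<ge> 1" by (simp add: v_def)
  have X0: "X \<ge> 0" using X norm_ge_zero order_trans by blast
  define \<mu> where "\<mu> = circle_mean c * p \<xi>"
  define \<delta> where "\<delta> = 1 / v ^ M"
  have \<delta>: "0 < \<delta>" "\<delta> \<le> 1" using v by (auto simp: \<delta>_def divide_le_eq)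
  have low: "\<delta> \<le> norm (of_int \<tau> + \<mu>)" for \<tau> :: int
    using dioph[of \<xi> \<tau>] \<xi> v by (simp add: \<delta>_def \<mu>_def v_def divide_le_eq)
  have low': "\<delta> \<le> norm (of_int \<tau> + (- \<mu>))" for \<tau> :: int
    using low[of "- \<tau>"] by (simp add: norm_minus_commute)
  have w: "\<delta> / 2 \<le> norm (exp (2 * of_real pi * \<i> * \<mu>) - 1)"
    by (rule exp_minus_one_lower_bound[OF \<delta>(2) low])
  have w': "\<delta> / 2 \<le> norm (exp (2 * of_real pi * \<i> * (- \<mu>)) - 1)"
    by (rule exp_minus_one_lower_bound[OF \<delta>(2) low'])
  have "exp (2 * of_real pi * \<i> * (circle_mean c * p \<xi>)) \<noteq> 1"
    using w \<delta>(1) by (auto simp: \<mu>_def)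
  from periodic_ode_solution[OF c \<rho> this] obtain \<psi> where \<psi>: "\<psi> \<in> torus_smooth"
    and ode: "\<And>t. \<i> * pderiv_dir 1 \<psi> t + p \<xi> * (c t * \<psi> t) = \<rho> t" by blast
  define L where "L = \<Theta> + \<kappa> * ln v"
  have L: "L \<ge> 0" using \<Theta> \<kappa> v by (simp add: L_def)
  have expL: "exp (2 * pi * L) \<le> exp (2 * pi * \<Theta>) * v ^ n"
  proof -
    have "exp (2 * pi * L) = exp (2 * pi * \<Theta>) * v powr (2 * pi * \<kappa>)"
      using v by (simp add: L_def powr_def exp_add[symmetric] algebra_simps)
    also have "v powr (2 * pi * \<kappa>) \<le> v powr real n"
      unfolding n_def using v by (intro powr_mono real_nat_ceiling_ge) auto
    also have "v powr real n = v ^ n" using v by (intro powr_realpow) auto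
    finally show ?thesis by simp
  qed
  have "norm (\<psi> t) \<le> (4 * pi * exp (2 * pi * \<Theta>)) * v ^ (n + M) * X" for t
  proof -
    have "norm (\<psi> t) \<le> 2 * pi * exp (2 * pi * L) * X / (\<delta> / 2)"
    proof (rule periodic_ode_bound[OF c \<psi> ode _ L])
      show "norm (\<rho> t) \<le> X" for t using X by blast
      show "(\<forall>t. - L \<le> Im (c t * p \<xi>)) \<or> (\<forall>t. Im (c t * p \<xi>) \<le> L)"
        using sign[of \<xi>] \<xi> by (simp add: L_def v_def)
    qed (use \<delta>(1) w w' in \<open>simp_all add: \<mu>_def\<close>)
    also have "\<dots> = 4 * pi * exp (2 * pi * L) * X * v ^ M"
      by (simp add: \<delta>_def)
    also have "\<dots> \<le> 4 * pi * (exp (2 * pi * \<Theta>) * v ^ n) * X * v ^ M"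
      using expL X0 v by (intro mult_right_mono mult_left_mono) auto
    finally show ?thesis by (simp add: power_add mult_ac)
  qed
  then show "\<exists>\<psi>\<in>torus_smooth. (\<forall>t. \<i> * pderiv_dir 1 \<psi> t + p \<xi> * (c t * \<psi> t) = \<rho> t) \<and>
      (\<forall>t. norm (\<psi> t) \<le> 4 * pi * exp (2 * pi * \<Theta>) * (1 + norm (vec_of_int \<xi>)) ^ (n + M) * X)"
    using \<psi> ode by (auto simp: v_def)
qed

text \<open>
  Decay in \<open>\<xi>\<close>, with polynomial growth in \<open>\<tau>\<close>. For large \<open>\<xi>\<close> the test function is replaced by
  the solution of the dual equation in the variable \<open>t\<^sub>j\<close>, so that the distribution is only
  evaluated through the smooth right-hand side; for the remaining frequencies continuity suffices.
\<close>

lemma decay_in_space_frequency: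
  fixes u :: "((real ^ 'n::finite) \<times> (real ^ 'N::finite)) functional"
  assumes u: "u \<in> torus_distribution" and c: "c \<in> torus_smooth"
    and sys: "smooth_distribution (evol_op (axis j 1) c p u)"
    and A: "A \<ge> 0"
    and solv: "\<And>\<xi> \<rho> X. R \<le> norm (vec_of_int \<xi>) \<Longrightarrow> \<rho> \<in> torus_smooth \<Longrightarrow> (\<And>t. norm (\<rho> t) \<le> X) \<Longrightarrow>
           \<exists>\<psi>\<in>torus_smooth. (\<forall>t. \<i> * pderiv_dir 1 \<psi> t + p \<xi> * (c t * \<psi> t) = \<rho> t) \<and>
              (\<forall>t. norm (\<psi> t) \<le> A * (1 + norm (vec_of_int \<xi>)) ^ n * X)"
  shows "\<exists>B. \<forall>g M. (\<forall>k. g k \<in> torus_smooth) \<longrightarrow> (\<exists>C. \<forall>\<tau>\<in>int_lattice. \<forall>\<xi>.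
           norm (u (tfun (modulate g \<tau>) \<xi>)) * (1 + norm (vec_of_int \<xi>)) ^ M \<le> C * (1 + norm \<tau>) ^ B)"
proof -
  obtain C0 B where C0: "C0 \<ge> 0" "\<And>\<phi>. \<phi> \<in> torus_smooth \<Longrightarrow> norm (u \<phi>) \<le> C0 * Ck_norm B \<phi>"
    using torus_distribution_bound[OF u] by blast
  obtain f where f: "f \<in> torus_smooth"
    and fu: "\<And>\<phi>. \<phi> \<in> torus_smooth \<Longrightarrow> evol_op (axis j 1) c p u \<phi> = integral torus_cell (\<lambda>z. f z * \<phi> z)"
    using sys unfolding smooth_distribution_def by blast
  show ?thesis
  proof (intro exI[of _ B] allI impI)
    fix g :: "'n \<Rightarrow> real \<Rightarrow> complex" and M
    assume g: "\<forall>k. g k \<in> torus_smooth"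
    have "\<forall>k. \<exists>X\<ge>0. \<forall>t. norm (g k t) \<le> X"
      using torus_smooth_bounded g by metis
    then obtain X where X: "\<And>k. X k \<ge> 0" "\<And>k t. norm (g k t) \<le> X k" by metis
    obtain C1 where C1: "C1 \<ge> 0" "\<And>\<zeta>. \<zeta> \<in> int_lattice \<Longrightarrow>
        Ck_norm B (\<lambda>z::(real ^ 'n) \<times> (real ^ 'N). (\<Prod>k\<in>UNIV. g k (fst z $ k)) * tchar \<zeta> z) \<le> C1 * (1 + norm \<zeta>) ^ B"
      using Ck_norm_mult_tchar_le[OF torus_smooth_prod_coordinates[of g]] g by blast
    obtain C2 where C2: "C2 \<ge> 0" "\<And>G \<xi> H. (\<forall>k. G k \<in> torus_smooth) \<Longrightarrow> (\<forall>z. norm (tfun G \<xi> z) \<le> H) \<Longrightarrow>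
           (1 + norm (vec_of_int \<xi>)) ^ (M + n) * norm (integral torus_cell (\<lambda>z. f z * tfun G \<xi> z)) \<le> C2 * H"
      using integral_tfun_decay[OF f, of "M + n"] by blast
    define P where "P = (\<Prod>k\<in>UNIV - {j}. X k)"
    have P: "P \<ge> 0" unfolding P_def using X(1) by (intro prod_nonneg) auto
    define D1 where "D1 = C0 * C1 * (1 + \<bar>R\<bar>) ^ B * (1 + \<bar>R\<bar>) ^ M"
    define D2 where "D2 = C2 * (A * X j * P)"
    have D: "D1 \<ge> 0" "D2 \<ge> 0"
      unfolding D1_def D2_def using C0(1) C1(1) C2(1) A X(1) P by (intro mult_nonneg_nonneg zero_le_power; simp)+
    show "\<exists>C. \<forall>\<tau>\<in>int_lattice. \<forall>\<xi>.
        norm (u (tfun (modulate g \<tau>) \<xi>)) * (1 + norm (vec_of_int \<xi>)) ^ M \<le> C * (1 + norm \<tau>) ^ B"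
    proof (intro exI[of _ "D1 + D2"] ballI allI)
      fix \<tau> :: "real ^ 'n" and \<xi> :: "int ^ 'N"
      assume \<tau>: "\<tau> \<in> int_lattice"
      define v where "v = 1 + norm (vec_of_int \<xi>)"
      have v: "v \<ge> 1" by (simp add: v_def)
      have G: "modulate g \<tau> k \<in> torus_smooth" for k
        using torus_smooth_modulate[OF _ \<tau>] g by blast
      have \<tau>1: "1 \<le> (1 + norm \<tau>) ^ B" by (rule one_le_power) simp
      show "norm (u (tfun (modulate g \<tau>) \<xi>)) * (1 + norm (vec_of_int \<xi>)) ^ M \<le> (D1 + D2) * (1 + norm \<tau>) ^ B"
      proof (cases "R \<le> norm (vec_of_int \<xi>)")
        case True
        obtain \<psi> where \<psi>: "\<psi> \<in> torus_smooth" "\<And>t. \<i> * pderiv_dir 1 \<psi> t + p \<xi> * (c t * \<psi> t) = modulate g \<tau> j t"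
          "\<And>t. norm (\<psi> t) \<le> A * v ^ n * X j"
          using solv[OF True G[of j], of "X j"] X(2) unfolding v_def
          by (auto simp: modulate_def norm_mult)
        have G': "((modulate g \<tau>)(j := \<psi>)) k \<in> torus_smooth" for k
          using \<psi>(1) G by simp
        have "evol_op (axis j 1) c p u (tfun ((modulate g \<tau>)(j := \<psi>)) \<xi>) = u (tfun (modulate g \<tau>) \<xi>)"
          using evol_op_tfun[OF u c, where G = "(modulate g \<tau>)(j := \<psi>)" and k = j and p = p and \<xi> = \<xi>] G' \<psi>(2) by simp
        then have eq: "u (tfun (modulate g \<tau>) \<xi>) = integral torus_cell (\<lambda>z. f z * tfun ((modulate g \<tau>)(j := \<psi>)) \<xi> z)"
          using fu[OF torus_smooth_tfun[where G = "(modulate g \<tau>)(j := \<psi>)" and \<xi> = \<xi>]] G' by simp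
        have "norm (tfun ((modulate g \<tau>)(j := \<psi>)) \<xi> z) \<le> A * v ^ n * X j * P" for z
        proof -
          have "(\<Prod>i\<in>UNIV - {j}. norm (modulate g \<tau> i (fst z $ i))) \<le> P"
            unfolding P_def using X(2) by (intro prod_mono) (auto simp: modulate_def norm_mult)
          moreover have "norm (\<psi> (fst z $ j)) \<le> A * v ^ n * X j" by (rule \<psi>(3))
          ultimately have "norm (\<psi> (fst z $ j)) * (\<Prod>i\<in>UNIV - {j}. norm (modulate g \<tau> i (fst z $ i))) \<le> (A * v ^ n * X j) * P"
            by (intro mult_mono) (use A X(1) v in \<open>auto intro!: prod_nonneg mult_nonneg_nonneg\<close>)
          then show ?thesis by (simp add: tfun_upd norm_mult prod_norm)
        qed
        then have "v ^ (M + n) * norm (u (tfun (modulate g \<tau>) \<xi>)) \<le> C2 * (A * v ^ n * X j * P)"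
          unfolding eq v_def using G' by (intro C2(2)) auto
        then have "v ^ n * (norm (u (tfun (modulate g \<tau>) \<xi>)) * v ^ M) \<le> v ^ n * D2"
          by (simp add: D2_def power_add mult_ac)
        then have "norm (u (tfun (modulate g \<tau>) \<xi>)) * v ^ M \<le> D2"
          using v by simp
        also have "\<dots> \<le> (D1 + D2) * 1" using D by simp
        also have "\<dots> \<le> (D1 + D2) * (1 + norm \<tau>) ^ B"
          using D \<tau>1 by (intro mult_left_mono) auto
        finally show ?thesis by (simp add: v_def)
      next
        case False
        then have vR: "v \<le> 1 + \<bar>R\<bar>" by (simp add: v_def)
        define \<zeta> where "\<zeta> = (- \<tau>, - (vec_of_int \<xi> :: real ^ 'N))"
        have \<zeta>: "\<zeta> \<in> int_lattice" using \<tau> by (simp add: \<zeta>_def)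
        have tf: "tfun (modulate g \<tau>) \<xi> = (\<lambda>z. (\<Prod>k\<in>UNIV. g k (fst z $ k)) * tchar \<zeta> z)"
          by (simp add: fun_eq_iff tfun_modulate \<zeta>_def)
        have "norm (u (tfun (modulate g \<tau>) \<xi>)) \<le> C0 * Ck_norm B (tfun (modulate g \<tau>) \<xi>)"
          by (rule C0(2)[OF torus_smooth_tfun[OF G]])
        also have "\<dots> \<le> C0 * (C1 * (1 + norm \<zeta>) ^ B)"
          unfolding tf by (intro mult_left_mono C1(2) \<zeta> C0(1))
        also have "\<dots> \<le> C0 * (C1 * ((1 + norm \<tau>) * v) ^ B)"
          using norm_tchar_frequency[of \<tau> \<xi>] C0(1) C1(1)
          by (intro mult_left_mono power_mono) (auto simp: \<zeta>_def v_def)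
        also have "\<dots> = C0 * C1 * (1 + norm \<tau>) ^ B * v ^ B"
          by (simp add: power_mult_distrib mult_ac)
        finally have le: "norm (u (tfun (modulate g \<tau>) \<xi>)) \<le> C0 * C1 * (1 + norm \<tau>) ^ B * v ^ B" .
        have "norm (u (tfun (modulate g \<tau>) \<xi>)) * v ^ M \<le> C0 * C1 * (1 + norm \<tau>) ^ B * v ^ B * v ^ M"
          using v by (intro mult_right_mono le) auto
        also have "\<dots> \<le> C0 * C1 * (1 + norm \<tau>) ^ B * (1 + \<bar>R\<bar>) ^ B * (1 + \<bar>R\<bar>) ^ M"
          using vR v C0(1) C1(1) by (intro mult_mono power_mono) (auto intro!: mult_nonneg_nonneg)
        also have "\<dots> = D1 * (1 + norm \<tau>) ^ B" by (simp add: D1_def mult_ac)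
        also have "\<dots> \<le> (D1 + D2) * (1 + norm \<tau>) ^ B"
          using D \<tau>1 by (intro mult_right_mono) auto
        finally show ?thesis by (simp add: v_def)
      qed
    qed
  qed
qed

text \<open>
  Decay in \<open>\<tau>\<close>, one power at a time: each equation of the system expresses \<open>\<tau>\<^sub>k\<close> times a
  coefficient by coefficients with other amplitudes, at the cost of a power of \<open>\<xi>\<close>, which is
  available in abundance.
\<close>

lemma decay_in_time_frequency:
  fixes u :: "((real ^ 'n::finite) \<times> (real ^ 'N::finite)) functional"
  assumes u: "u \<in> torus_distribution" and c: "\<And>k. c k \<in> torus_smooth"
    and p: "\<And>k. \<exists>C\<ge>0. \<exists>m. \<forall>\<xi>. norm (p k \<xi>) \<le> C * (1 + norm (vec_of_int \<xi>)) ^ m"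
    and sys: "\<And>k. smooth_distribution (evol_op (axis k 1) (c k) (p k) u)"
    and base: "\<And>g M. (\<forall>k. g k \<in> torus_smooth) \<Longrightarrow> \<exists>C. \<forall>\<tau>\<in>int_lattice. \<forall>\<xi>.
           norm (u (tfun (modulate g \<tau>) \<xi>)) * (1 + norm (vec_of_int \<xi>)) ^ M \<le> C * (1 + norm \<tau>) ^ B"
    and g: "\<forall>k. g k \<in> torus_smooth"
  shows "\<exists>C. \<forall>\<tau>\<in>int_lattice. \<forall>\<xi>. norm (u (tfun (modulate g \<tau>) \<xi>)) *
           ((1 + norm \<tau>) ^ K * (1 + norm (vec_of_int \<xi>)) ^ M) \<le> C * (1 + norm \<tau>) ^ B"
  using g
proof (induction K arbitrary: g M)
  case 0
  then show ?case using base[of g M] by simp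
next
  case (Suc K)
  note g = Suc.prems
  define U where "U g \<tau> \<xi> = norm (u (tfun (modulate g \<tau>) \<xi>))" for g \<tau> \<xi>
  define W where "W M \<tau> \<xi> = (1 + norm \<tau>) ^ K * (1 + norm (vec_of_int \<xi>)) ^ M"
    for M and \<tau> :: "real ^ 'n" and \<xi> :: "int ^ 'N"
  have W0: "W M \<tau> \<xi> \<ge> 0" for M \<tau> \<xi> by (simp add: W_def)
  have IH: "\<exists>C. \<forall>\<tau>\<in>int_lattice. \<forall>\<xi>. U h \<tau> \<xi> * W M \<tau> \<xi> \<le> C * (1 + norm \<tau>) ^ B"
    if "\<forall>k. h k \<in> torus_smooth" for h M
    using Suc.IH[OF that, of M] by (simp add: U_def W_def)
  have "\<exists>C. \<forall>\<tau>\<in>int_lattice. \<forall>\<xi>. \<bar>\<tau> $ k\<bar> * U g \<tau> \<xi> * W M \<tau> \<xi> \<le> C * (1 + norm \<tau>) ^ B" for k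
  proof -
    obtain f where f: "f \<in> torus_smooth"
      and fu: "\<And>\<phi>. \<phi> \<in> torus_smooth \<Longrightarrow> evol_op (axis k 1) (c k) (p k) u \<phi> = integral torus_cell (\<lambda>z. f z * \<phi> z)"
      using sys[of k] unfolding smooth_distribution_def by blast
    define f' where "f' z = f z * (\<Prod>k\<in>UNIV. g k (fst z $ k))" for z
    have f': "f' \<in> torus_smooth"
      unfolding f'_def[abs_def] using g by (intro torus_smooth_mult f torus_smooth_prod_coordinates) auto
    obtain Cp m where Cp: "Cp \<ge> 0" "\<And>\<xi>. norm (p k \<xi>) \<le> Cp * (1 + norm (vec_of_int \<xi>)) ^ m"
      using p[of k] by blast
    let ?g1 = "g(k := pderiv_dir 1 (g k))" and ?g2 = "g(k := \<lambda>s. c k s * g k s)"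
    have "\<forall>i. ?g1 i \<in> torus_smooth" using g torus_smooth_pderiv[of "g k" 1] by simp
    from IH[OF this, of M] obtain C1 where C1: "\<And>\<tau> \<xi>. \<tau> \<in> int_lattice \<Longrightarrow> U ?g1 \<tau> \<xi> * W M \<tau> \<xi> \<le> C1 * (1 + norm \<tau>) ^ B"
      by blast
    have "\<forall>i. ?g2 i \<in> torus_smooth" using g torus_smooth_mult[OF c[of k], of "g k"] by simp
    from IH[OF this, of "M + m"] obtain C2 where C2: "\<And>\<tau> \<xi>. \<tau> \<in> int_lattice \<Longrightarrow> U ?g2 \<tau> \<xi> * W (M + m) \<tau> \<xi> \<le> C2 * (1 + norm \<tau>) ^ B"
      by blast
    define C3 where "C3 = (1 + real DIM((real ^ 'n) \<times> (real ^ 'N))) ^ (K + M) * (2 * pi) ^ DIM((real ^ 'n) \<times> (real ^ 'N)) * Ck_norm (K + M) f'"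
    have C3: "norm (integral torus_cell (\<lambda>z. f z * tfun (modulate g \<tau>) \<xi> z)) * W M \<tau> \<xi> \<le> C3 * (1 + norm \<tau>) ^ B"
      if \<tau>: "\<tau> \<in> int_lattice" for \<tau> \<xi>
    proof -
      let ?\<zeta> = "(- \<tau>, - (vec_of_int \<xi> :: real ^ 'N))"
      let ?I = "norm (integral torus_cell (\<lambda>z. f' z * tchar ?\<zeta> z))"
      have "norm \<tau> \<le> norm ?\<zeta>" "norm (vec_of_int \<xi> :: real ^ 'N) \<le> norm ?\<zeta>"
        using norm_fst_le[of "- \<tau>" "- (vec_of_int \<xi> :: real ^ 'N)"] norm_snd_le[of "- (vec_of_int \<xi> :: real ^ 'N)" "- \<tau>"] by simp_all
      then have "W M \<tau> \<xi> \<le> (1 + norm ?\<zeta>) ^ K * (1 + norm ?\<zeta>) ^ M"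
        unfolding W_def by (intro mult_mono power_mono) auto
      then have "?I * W M \<tau> \<xi> \<le> ?I * ((1 + norm ?\<zeta>) ^ K * (1 + norm ?\<zeta>) ^ M)"
        by (intro mult_left_mono) auto
      also have "\<dots> = (1 + norm ?\<zeta>) ^ (K + M) * ?I" by (simp add: power_add mult_ac)
      also have "\<dots> \<le> C3"
        unfolding C3_def using \<tau> by (intro fourier_decay f') simp
      also have "C3 * 1 \<le> C3 * (1 + norm \<tau>) ^ B"
        using Ck_norm_nonneg[OF f'] unfolding C3_def
        by (intro mult_left_mono one_le_power mult_nonneg_nonneg) auto
      finally show ?thesis by (simp add: tfun_modulate f'_def mult.assoc)
    qed
    have "\<bar>\<tau> $ k\<bar> * U g \<tau> \<xi> * W M \<tau> \<xi> \<le> (C3 + C1 + Cp * C2) * (1 + norm \<tau>) ^ B"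
      if \<tau>: "\<tau> \<in> int_lattice" for \<tau> \<xi>
    proof -
      let ?I = "norm (integral torus_cell (\<lambda>z. f z * tfun (modulate g \<tau>) \<xi> z))"
      have gs: "g i \<in> torus_smooth" for i using g by blast
      have "\<bar>\<tau> $ k\<bar> * U g \<tau> \<xi> = norm (of_real (\<tau> $ k) * u (tfun (modulate g \<tau>) \<xi>))"
        by (simp add: U_def norm_mult)
      also have "\<dots> = norm (integral torus_cell (\<lambda>z. f z * tfun (modulate g \<tau>) \<xi> z)
          - \<i> * u (tfun (modulate ?g1 \<tau>) \<xi>) - p k \<xi> * u (tfun (modulate ?g2 \<tau>) \<xi>))"
        unfolding evol_op_tfun_modulate[OF u c[of k] gs \<tau>, where k = k and \<xi> = \<xi> and p = "p k"]
        by (simp only: fu[OF torus_smooth_tfun[OF torus_smooth_modulate[OF gs \<tau>]]])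
      also have "\<dots> \<le> ?I + U ?g1 \<tau> \<xi> + norm (p k \<xi>) * U ?g2 \<tau> \<xi>"
        unfolding U_def by (intro order_trans[OF norm_triangle_ineq4] add_mono) (simp_all add: norm_mult)
      also have "\<dots> \<le> ?I + U ?g1 \<tau> \<xi> + (Cp * (1 + norm (vec_of_int \<xi>)) ^ m) * U ?g2 \<tau> \<xi>"
        using Cp(2)[of \<xi>] by (intro add_left_mono mult_right_mono) (simp_all add: U_def)
      finally have "\<bar>\<tau> $ k\<bar> * U g \<tau> \<xi> * W M \<tau> \<xi>
          \<le> (?I + U ?g1 \<tau> \<xi> + (Cp * (1 + norm (vec_of_int \<xi>)) ^ m) * U ?g2 \<tau> \<xi>) * W M \<tau> \<xi>"
        by (intro mult_right_mono W0)
      also have "\<dots> = ?I * W M \<tau> \<xi> + U ?g1 \<tau> \<xi> * W M \<tau> \<xi> + Cp * (U ?g2 \<tau> \<xi> * W (M + m) \<tau> \<xi>)"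
        by (simp add: W_def power_add algebra_simps)
      also have "\<dots> \<le> C3 * (1 + norm \<tau>) ^ B + C1 * (1 + norm \<tau>) ^ B + Cp * (C2 * (1 + norm \<tau>) ^ B)"
        by (intro add_mono mult_left_mono C1 C2 C3 Cp(1) \<tau>)
      finally show ?thesis by (simp add: algebra_simps)
    qed
    then show ?thesis by blast
  qed
  then obtain D where D: "\<And>k \<tau> \<xi>. \<tau> \<in> int_lattice \<Longrightarrow> \<bar>\<tau> $ k\<bar> * U g \<tau> \<xi> * W M \<tau> \<xi> \<le> D k * (1 + norm \<tau>) ^ B"
    by metis
  obtain D0 where D0: "\<And>\<tau> \<xi>. \<tau> \<in> int_lattice \<Longrightarrow> U g \<tau> \<xi> * W M \<tau> \<xi> \<le> D0 * (1 + norm \<tau>) ^ B"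
    using IH[OF g, of M] by blast
  show ?case
  proof (intro exI ballI allI)
    fix \<tau> :: "real ^ 'n" and \<xi> :: "int ^ 'N"
    assume \<tau>: "\<tau> \<in> int_lattice"
    have U0: "U g \<tau> \<xi> * W M \<tau> \<xi> \<ge> 0" using W0 by (simp add: U_def)
    have "norm \<tau> \<le> (\<Sum>k\<in>UNIV. \<bar>\<tau> $ k\<bar>)"
      using norm_le_l1_cart by blast
    then have "(1 + norm \<tau>) * (U g \<tau> \<xi> * W M \<tau> \<xi>) \<le> (1 + (\<Sum>k\<in>UNIV. \<bar>\<tau> $ k\<bar>)) * (U g \<tau> \<xi> * W M \<tau> \<xi>)"
      by (intro mult_right_mono U0) simp
    also have "\<dots> = U g \<tau> \<xi> * W M \<tau> \<xi> + (\<Sum>k\<in>UNIV. \<bar>\<tau> $ k\<bar> * U g \<tau> \<xi> * W M \<tau> \<xi>)"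
      by (simp add: distrib_right sum_distrib_right mult.assoc)
    also have "\<dots> \<le> D0 * (1 + norm \<tau>) ^ B + (\<Sum>k\<in>UNIV. D k * (1 + norm \<tau>) ^ B)"
      by (intro add_mono sum_mono D0 D \<tau>)
    also have "\<dots> = (D0 + sum D UNIV) * (1 + norm \<tau>) ^ B"
      by (simp add: distrib_right sum_distrib_right)
    finally show "norm (u (tfun (modulate g \<tau>) \<xi>)) * ((1 + norm \<tau>) ^ Suc K * (1 + norm (vec_of_int \<xi>)) ^ M)
        \<le> (D0 + sum D UNIV) * (1 + norm \<tau>) ^ B"
      by (simp add: U_def W_def mult_ac)
  qed
qed

lemma vec_of_int_surj:
  assumes "\<zeta> \<in> int_lattice"
  obtains \<xi> where "vec_of_int \<xi> = \<zeta>"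
proof -
  have "\<zeta> $ i \<in> \<int>" for i
  proof -
    have "\<zeta> \<bullet> axis i 1 \<in> \<int>" using assms by (simp add: int_lattice_def)
    then show ?thesis by (simp add: inner_axis)
  qed
  then have "\<zeta> $ i = of_int \<lfloor>\<zeta> $ i\<rfloor>" for i by (metis Ints_cases floor_of_int)
  then have "vec_of_int (\<chi> i. \<lfloor>\<zeta> $ i\<rfloor>) = \<zeta>" by (simp add: vec_of_int_def vec_eq_iff)
  with that show thesis by blast
qed

theorem theorem3p7:
  fixes c :: "'n::finite \<Rightarrow> real \<Rightarrow> complex"
    and p :: "'n \<Rightarrow> int ^ 'N::finite \<Rightarrow> complex"
    and m :: "'n \<Rightarrow> real"
  assumes "\<And>j. c j \<in> torus_smooth"
    and "\<And>j. p j \<in> toroidal_symbol (m j)"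
    and "\<exists>j. globally_hypoelliptic {averaged_op c p j} \<and> j \<in> set_H c p \<union> set_L c p"
  shows "globally_hypoelliptic (range (system_op c p))"
  unfolding globally_hypoelliptic_def
proof (intro ballI impI)
  fix u :: "((real ^ 'n) \<times> (real ^ 'N)) functional"
  assume u: "u \<in> torus_distribution" and "\<forall>L\<in>range (system_op c p). smooth_distribution (L u)"
  then have sys: "smooth_distribution (evol_op (axis k 1) (c k) (p k) u)" for k
    by (auto simp: system_op_def)
  note c = assms(1)
  have p: "\<exists>C\<ge>0. \<exists>m. \<forall>\<xi>. norm (p k \<xi>) \<le> C * (1 + norm (vec_of_int \<xi>)) ^ m" for k
    using toroidal_symbol_bound[OF assms(2)[of k]] by metis
  obtain j where gh: "globally_hypoelliptic {averaged_op c p j}" and j: "j \<in> set_H c p \<union> set_L c p"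
    using assms(3) by blast
  have "\<exists>M::nat. \<forall>\<xi> \<tau>::int. real M \<le> norm (vec_of_int \<xi>) \<longrightarrow>
      1 \<le> norm (of_int \<tau> + circle_mean (c j) * p j \<xi>) * (1 + norm (vec_of_int \<xi>)) ^ M"
    using p[of j] hypoelliptic_imp_diophantine[OF gh[unfolded averaged_op_def]] by blast
  then obtain M :: nat where dioph: "\<And>\<xi> \<tau>::int. real M \<le> norm (vec_of_int \<xi>) \<Longrightarrow>
      1 \<le> norm (of_int \<tau> + circle_mean (c j) * p j \<xi>) * (1 + norm (vec_of_int \<xi>)) ^ M" by blast
  obtain \<Theta> \<kappa> R where sign: "\<Theta> \<ge> 0" "\<kappa> \<ge> 0" "\<And>\<xi>. R \<le> norm (vec_of_int \<xi>) \<Longrightarrow>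
           (\<forall>t. - (\<Theta> + \<kappa> * ln (1 + norm (vec_of_int \<xi>))) \<le> Im (c j t * p j \<xi>)) \<or>
           (\<forall>t. Im (c j t * p j \<xi>) \<le> \<Theta> + \<kappa> * ln (1 + norm (vec_of_int \<xi>)))"
    using one_sided_log_bound[OF c j] by blast
  obtain A n where A: "A \<ge> 0" and solv: "\<And>\<xi> \<rho> X. max R (real M) \<le> norm (vec_of_int \<xi>) \<Longrightarrow> \<rho> \<in> torus_smooth \<Longrightarrow>
           (\<And>t. norm (\<rho> t) \<le> X) \<Longrightarrow>
           \<exists>\<psi>\<in>torus_smooth. (\<forall>t. \<i> * pderiv_dir 1 \<psi> t + p j \<xi> * (c j t * \<psi> t) = \<rho> t) \<and>
              (\<forall>t. norm (\<psi> t) \<le> A * (1 + norm (vec_of_int \<xi>)) ^ n * X)"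
    using ode_solvable[OF c[of j] dioph sign] by blast
  obtain B where base: "\<And>g M. (\<forall>k. g k \<in> torus_smooth) \<Longrightarrow> \<exists>C. \<forall>\<tau>\<in>int_lattice. \<forall>\<xi>.
           norm (u (tfun (modulate g \<tau>) \<xi>)) * (1 + norm (vec_of_int \<xi>)) ^ M \<le> C * (1 + norm \<tau>) ^ B"
    using decay_in_space_frequency[OF u c[of j] sys[of j] A solv] by blast
  show "smooth_distribution u"
  proof (rule smooth_distribution_if_rapid_coefficients[OF u])
    fix K
    have "\<forall>k::'n. (\<lambda>s::real. 1::complex) \<in> torus_smooth" by simp
    from decay_in_time_frequency[OF u c p sys base this, of "K + B" K]
    obtain C where C: "\<And>\<tau> \<xi>. \<tau> \<in> int_lattice \<Longrightarrow> norm (u (tfun (modulate (\<lambda>_ _. 1) \<tau>) \<xi>)) *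
           ((1 + norm \<tau>) ^ (K + B) * (1 + norm (vec_of_int \<xi>)) ^ K) \<le> C * (1 + norm \<tau>) ^ B"
      by blast
    have "norm (u (tchar \<zeta>)) * (1 + norm \<zeta>) ^ K \<le> C" if "\<zeta> \<in> int_lattice" for \<zeta>
    proof -
      obtain \<zeta>1 \<zeta>2 where \<zeta>: "\<zeta> = (\<zeta>1, \<zeta>2)" by (cases \<zeta>)
      with that have lat: "- \<zeta>1 \<in> int_lattice" "- \<zeta>2 \<in> int_lattice" by auto
      obtain \<xi> where \<xi>: "vec_of_int \<xi> = - \<zeta>2" by (rule vec_of_int_surj[OF lat(2)])
      have t: "tfun (modulate (\<lambda>_ _. 1) (- \<zeta>1)) \<xi> = tchar \<zeta>"
        by (simp add: fun_eq_iff tfun_modulate \<zeta> \<xi>)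
      have pos: "(1 + norm \<zeta>1) ^ B > 0" by (simp add: add_pos_nonneg)
      have "(1 + norm \<zeta>) ^ K \<le> ((1 + norm \<zeta>1) * (1 + norm \<zeta>2)) ^ K"
        using norm_tchar_frequency[of "- \<zeta>1" \<xi>] by (intro power_mono) (simp_all add: \<zeta> \<xi>)
      then have "norm (u (tchar \<zeta>)) * (1 + norm \<zeta>) ^ K
          \<le> norm (u (tchar \<zeta>)) * ((1 + norm \<zeta>1) * (1 + norm \<zeta>2)) ^ K"
        by (intro mult_left_mono) auto
      moreover have "(norm (u (tchar \<zeta>)) * ((1 + norm \<zeta>1) * (1 + norm \<zeta>2)) ^ K) * (1 + norm \<zeta>1) ^ B \<le> C * (1 + norm \<zeta>1) ^ B"
        using C[OF lat(1), of \<xi>] by (simp add: t \<xi> power_add power_mult_distrib mult_ac)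
      then have "norm (u (tchar \<zeta>)) * ((1 + norm \<zeta>1) * (1 + norm \<zeta>2)) ^ K \<le> C"
        using pos by (rule mult_right_le_imp_le)
      ultimately show ?thesis by linarith
    qed
    then show "\<exists>C. \<forall>\<zeta>\<in>int_lattice. norm (u (tchar \<zeta>)) * (1 + norm \<zeta>) ^ K \<le> C" by blast
  qed
qed

end
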